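(* Let $g$ be the Kerr-Newman metric with real parameters $a,m,q$ (see context) and write $c=\cos\theta$. At points where $I_1^2+I_2^2\neq0$, the invariant $$\chi=\frac{I_6-I_5+\frac{12}{5}(I_1I_3-I_2I_4)}{(I_1^2+I_2^2)^{5/4}}$$ of $g$ equals $$\begin{aligned} \chi=\;&\frac{44\sqrt3\,q^2}{5\left(c^2a^2m^2+(rm-q^2)^2\right)^{5/2}(r^2+a^2c^2)^4}\Big(a^{12}m^2\big(rm-\tfrac{19q^2}{66}\big)c^{12}\\ &-2\Big[-\tfrac{7q^6}{132}-\tfrac{17m(m-\frac{176r}{17})q^4}{132}-\tfrac{3m^2(a^2-\frac{25}{9}rm+\frac{427}{18}r^2)q^2}{11}+m^3r(a^2-rm+8r^2)\Big]a^{10}c^{10}\\ &+30a^8\Big(-\tfrac{q^8}{396}+\big(-\tfrac1{165}a^2+\tfrac{79}{990}rm-\tfrac{17}{180}r^2\big)q^6+\tfrac{9(a^2-\frac{1079}{324}rm+\frac{143}{27}r^2)mrq^4}{55}\\ &\qquad-\tfrac{9m^2r^2(a^2-\frac{71}{45}rm+\frac{307}{108}r^2)q^2}{11}+m^3r^3(a^2-rm+\tfrac{19}{10}r^2)\Big)c^8\\ &-84r^2\Big[-\tfrac{q^8}{36}+\big(-\tfrac2{33}a^2+\tfrac7{22}rm-\tfrac{41}{396}r^2\big)q^6+\tfrac{6m(a^2-\frac{475}{216}rm+\frac{11}{9}r^2)rq^4}{11}\\ &\qquad-\tfrac{15m^2(a^2-\frac{61}{45}rm+\frac{89}{90}r^2)r^2q^2}{11}+m^3r^3(a^2-rm+\tfrac67r^2)\Big]a^6c^6\\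 &+60r^4\Big(-\tfrac{7q^8}{66}+\big(-\tfrac7{33}a^2+\tfrac{392}{495}rm-\tfrac{287}{1980}r^2\big)q^6+\tfrac{63(a^2-\frac{601}{324}rm+\frac{121}{189}r^2)mrq^4}{55}\\ &\qquad-\tfrac{21m^2(a^2-\frac{401}{315}rm+\frac{307}{504}r^2)r^2q^2}{11}+m^3r^3(a^2-rm+\tfrac7{12}r^2)\Big)a^4c^4\\ &-10\Big[-\tfrac{91q^8}{330}+\big(-\tfrac{28}{55}a^2+\tfrac{263}{165}rm-\tfrac{17}{60}r^2\big)q^6+\tfrac{108m(a^2-\frac{2213}{1296}rm+\frac{44}{81}r^2)rq^4}{55}\\ &\qquad-\tfrac{27m^2(a^2-\frac{167}{135}rm+\frac{427}{810}r^2)r^2q^2}{11}+m^3r^3(a^2-rm+\tfrac{28}{55}r^2)\Big]r^6a^2c^2\\ &+\tfrac{2}{11}(rm-q^2)^2r^8\Big(-\tfrac{7q^4}{12}+\big(-a^2+\tfrac53rm-\tfrac7{12}r^2\big)q^2+mr(a^2-rm+\tfrac12r^2)\Big)\Big). \end{aligned}$$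
   Context: Kerr-Newman metric: in coordinates $(t,r,\theta,\phi)$, signature $(-,+,+,+)$, $$ds^2=-\frac{\Delta}{\rho^2}(dt-a\sin^2\theta\,d\phi)^2+\frac{\rho^2}{\Delta}dr^2+\rho^2d\theta^2+\frac{\sin^2\theta}{\rho^2}\big(a\,dt-(r^2+a^2)d\phi\big)^2,$$ $\Delta=r^2+a^2-2mr+q^2$, $\rho^2=r^2+a^2\cos^2\theta$, on the domain where the metric is regular ($\rho^2\ne0$, $\Delta\neq0$, $\sin\theta\ne0$). With $C_{\alpha\beta\gamma\delta}$ the Weyl tensor and $C^*_{\alpha\beta\gamma\delta}=\frac12E_{\alpha\beta\kappa\lambda}C^{\kappa\lambda}{}_{\gamma\delta}$ its dual ($E$ the Levi-Civita pseudotensor; $\chi$ does not depend on orientation): $I_1=C_{\alpha\beta\gamma\delta}C^{\alpha\beta\gamma\delta}$, $I_2=C^*_{\alpha\beta\gamma\delta}C^{\alpha\beta\gamma\delta}$, $I_3=\nabla_\mu C_{\alpha\beta\gamma\delta}\nabla^\mu C^{\alpha\beta\gamma\delta}$, $I_4=\nabla_\mu C_{\alpha\beta\gamma\delta}\nabla^\mu C^{*\alpha\beta\gamma\delta}$, $I_5=\nabla_\mu I_1\nabla^\mu I_1$, $I_6=\nabla_\mu I_2\nabla^\mu I_2$. *)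

theory Defs
  imports "HOL-Analysis.Analysis"
begin

text \<open>
  Tensor calculus in a single coordinate chart of a four-dimensional pseudo-Riemannian manifold.
  Points are coordinate tuples in \<^typ>\<open>real^4\<close>, a metric is the field of its covariant component
  matrices, and tensors are families of components. Coordinates are numbered \<open>1, 2, 3, 4\<close>; in the
  index type \<^typ>\<open>4\<close> the numeral \<open>4\<close> equals \<open>0\<close>.
\<close>

type_synonym metric = "real^4 \<Rightarrow> real^4^4"
type_synonym tensor4 = "4 \<Rightarrow> 4 \<Rightarrow> 4 \<Rightarrow> 4 \<Rightarrow> real"

definition partial :: "4 \<Rightarrow> (real^4 \<Rightarrow> real) \<Rightarrow> real^4 \<Rightarrow> real" where
  "partial i f x = deriv (\<lambda>s. f (x + s *\<^sub>R axis i 1)) 0"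

definition inv_metric :: "metric \<Rightarrow> real^4 \<Rightarrow> 4 \<Rightarrow> 4 \<Rightarrow> real" where
  "inv_metric g x i j = matrix_inv (g x) $ i $ j"

text \<open>\<open>christoffel g x i j k\<close> is \<open>\<Gamma>\<close> with upper index \<open>i\<close> and lower indices \<open>j, k\<close>.\<close>

definition christoffel :: "metric \<Rightarrow> real^4 \<Rightarrow> 4 \<Rightarrow> 4 \<Rightarrow> 4 \<Rightarrow> real" where
  "christoffel g x i j k = 1/2 * (\<Sum>l\<in>UNIV. inv_metric g x i l *
     (partial k (\<lambda>y. g y $ l $ j) x + partial j (\<lambda>y. g y $ l $ k) x
      - partial l (\<lambda>y. g y $ j $ k) x))"

text \<open>\<open>riemann_up g x i j k l\<close> has upper index \<open>i\<close> and lower indices \<open>j, k, l\<close>; the sign convention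
  is that of Misner, Thorne and Wheeler.\<close>

definition riemann_up :: "metric \<Rightarrow> real^4 \<Rightarrow> tensor4" where
  "riemann_up g x i j k l =
     partial k (\<lambda>y. christoffel g y i j l) x - partial l (\<lambda>y. christoffel g y i j k) x
     + (\<Sum>e\<in>UNIV. christoffel g x i k e * christoffel g x e j l
                   - christoffel g x i l e * christoffel g x e j k)"

definition riemann :: "metric \<Rightarrow> real^4 \<Rightarrow> tensor4" where
  "riemann g x i j k l = (\<Sum>e\<in>UNIV. g x $ i $ e * riemann_up g x e j k l)"

definition ricci :: "metric \<Rightarrow> real^4 \<Rightarrow> 4 \<Rightarrow> 4 \<Rightarrow> real" where
  "ricci g x i j = (\<Sum>e\<in>UNIV. riemann_up g x e i e j)"

definition scalar_curvature :: "metric \<Rightarrow> real^4 \<Rightarrow> real" where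
  "scalar_curvature g x = (\<Sum>i\<in>UNIV. \<Sum>j\<in>UNIV. inv_metric g x i j * ricci g x i j)"

definition weyl :: "metric \<Rightarrow> real^4 \<Rightarrow> tensor4" where
  "weyl g x i j k l = riemann g x i j k l
     - 1/2 * (g x $ i $ k * ricci g x j l - g x $ i $ l * ricci g x j k
              + g x $ j $ l * ricci g x i k - g x $ j $ k * ricci g x i l)
     + scalar_curvature g x / 6 * (g x $ i $ k * g x $ j $ l - g x $ i $ l * g x $ j $ k)"

definition levi_civita_symbol :: tensor4 where
  "levi_civita_symbol i j k l =
     (let p = (\<lambda>n::4. (vector [i, j, k, l] :: 4^4) $ n)
      in if p permutes UNIV then of_int (sign p) else 0)"

definition levi_civita :: "metric \<Rightarrow> real^4 \<Rightarrow> tensor4" where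
  "levi_civita g x i j k l = sqrt \<bar>det (g x)\<bar> * levi_civita_symbol i j k l"

definition dual_weyl :: "metric \<Rightarrow> real^4 \<Rightarrow> tensor4" where
  "dual_weyl g x i j k l = 1/2 * (\<Sum>u\<in>UNIV. \<Sum>v\<in>UNIV. levi_civita g x i j u v *
     (\<Sum>e\<in>UNIV. \<Sum>f\<in>UNIV. inv_metric g x u e * inv_metric g x v f * weyl g x e f k l))"

text \<open>\<open>covd g T x n\<close> is the covariant derivative, in coordinate direction \<open>n\<close>, of the tensor field
  \<open>T\<close> all of whose indices are covariant.\<close>

definition covd :: "metric \<Rightarrow> (real^4 \<Rightarrow> tensor4) \<Rightarrow> real^4 \<Rightarrow> 4 \<Rightarrow> tensor4" where
  "covd g T x n i j k l = partial n (\<lambda>y. T y i j k l) x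
     - (\<Sum>e\<in>UNIV. christoffel g x e n i * T x e j k l)
     - (\<Sum>e\<in>UNIV. christoffel g x e n j * T x i e k l)
     - (\<Sum>e\<in>UNIV. christoffel g x e n k * T x i j e l)
     - (\<Sum>e\<in>UNIV. christoffel g x e n l * T x i j k e)"

definition raise4 :: "metric \<Rightarrow> real^4 \<Rightarrow> tensor4 \<Rightarrow> tensor4" where
  "raise4 g x T i j k l = (\<Sum>e\<in>UNIV. \<Sum>f\<in>UNIV. \<Sum>u\<in>UNIV. \<Sum>v\<in>UNIV.
     inv_metric g x i e * inv_metric g x j f * inv_metric g x k u * inv_metric g x l v * T e f u v)"

definition contract4 :: "metric \<Rightarrow> real^4 \<Rightarrow> tensor4 \<Rightarrow> tensor4 \<Rightarrow> real" where
  "contract4 g x S T =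
     (\<Sum>i\<in>UNIV. \<Sum>j\<in>UNIV. \<Sum>k\<in>UNIV. \<Sum>l\<in>UNIV. S i j k l * raise4 g x T i j k l)"

definition I1 :: "metric \<Rightarrow> real^4 \<Rightarrow> real" where
  "I1 g x = contract4 g x (weyl g x) (weyl g x)"

definition I2 :: "metric \<Rightarrow> real^4 \<Rightarrow> real" where
  "I2 g x = contract4 g x (dual_weyl g x) (weyl g x)"

definition I3 :: "metric \<Rightarrow> real^4 \<Rightarrow> real" where
  "I3 g x = (\<Sum>m\<in>UNIV. \<Sum>n\<in>UNIV. inv_metric g x m n *
     contract4 g x (covd g (weyl g) x m) (covd g (weyl g) x n))"

definition I4 :: "metric \<Rightarrow> real^4 \<Rightarrow> real" where
  "I4 g x = (\<Sum>m\<in>UNIV. \<Sum>n\<in>UNIV. inv_metric g x m n *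
     contract4 g x (covd g (weyl g) x m) (covd g (dual_weyl g) x n))"

definition I5 :: "metric \<Rightarrow> real^4 \<Rightarrow> real" where
  "I5 g x = (\<Sum>m\<in>UNIV. \<Sum>n\<in>UNIV. inv_metric g x m n * partial m (I1 g) x * partial n (I1 g) x)"

definition I6 :: "metric \<Rightarrow> real^4 \<Rightarrow> real" where
  "I6 g x = (\<Sum>m\<in>UNIV. \<Sum>n\<in>UNIV. inv_metric g x m n * partial m (I2 g) x * partial n (I2 g) x)"

definition chi :: "metric \<Rightarrow> real^4 \<Rightarrow> real" where
  "chi g x = (I6 g x - I5 g x + 12/5 * (I1 g x * I3 g x - I2 g x * I4 g x))
     / ((I1 g x)\<^sup>2 + (I2 g x)\<^sup>2) powr (5/4)"

definition kn_Delta :: "real \<Rightarrow> real \<Rightarrow> real \<Rightarrow> real \<Rightarrow> real" where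
  "kn_Delta a m q r = r\<^sup>2 + a\<^sup>2 - 2 * m * r + q\<^sup>2"

definition kn_rho2 :: "real \<Rightarrow> real \<Rightarrow> real \<Rightarrow> real" where
  "kn_rho2 a r \<theta> = r\<^sup>2 + a\<^sup>2 * (cos \<theta>)\<^sup>2"

text \<open>
  The coordinates are \<open>(t, r, \<theta>, \<phi>)\<close>. The line element is a combination of squares of the 1-forms
  \<open>dt - a sin\<^sup>2 \<theta> d\<phi>\<close>, \<open>dr\<close>, \<open>d\<theta>\<close> and \<open>a dt - (r\<^sup>2 + a\<^sup>2) d\<phi>\<close>; their component
  vectors are \<open>\<alpha>\<close>, \<open>axis 2 1\<close>, \<open>axis 3 1\<close> and \<open>\<beta>\<close> below.
\<close>

definition kerr_newman :: "real \<Rightarrow> real \<Rightarrow> real \<Rightarrow> metric" where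
  "kerr_newman a m q x =
     (let r = x $ 2; \<theta> = x $ 3; \<Delta> = kn_Delta a m q r; \<rho>2 = kn_rho2 a r \<theta>;
          \<alpha> = vector [1, 0, 0, - a * (sin \<theta>)\<^sup>2] :: real^4;
          \<beta> = vector [a, 0, 0, - (r\<^sup>2 + a\<^sup>2)] :: real^4
      in \<chi> i j. - (\<Delta> / \<rho>2) * (\<alpha> $ i * \<alpha> $ j)
               + \<rho>2 / \<Delta> * (axis 2 1 $ i * axis 2 1 $ j)
               + \<rho>2 * (axis 3 1 $ i * axis 3 1 $ j)
               + (sin \<theta>)\<^sup>2 / \<rho>2 * (\<beta> $ i * \<beta> $ j))"

end

theory Submission
  imports Defs
begin

text \<open>
  In the Carter frame the Weyl tensor of the Kerr-Newman metric has the type D normal form with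
  \<open>\<Psi>\<^sub>2 = (q\<^sup>2 - m z') / (z\<^sup>3 z')\<close>, where \<open>z = r + \<i> a cos \<theta>\<close>, \<open>z'\<close> is its conjugate and \<open>\<rho>\<^sup>2 = z z'\<close>.
  Cartan's structure equations give the connection and the curvature in this frame. Then \<open>I\<^sub>1\<close> and \<open>I\<^sub>2\<close>
  are the real and imaginary parts of \<open>48 \<Psi>\<^sub>2\<^sup>2\<close>, up to the sign of \<open>I\<^sub>2\<close>, and \<open>I\<^sub>3\<close>, \<open>I\<^sub>4\<close> are
  those of \<open>48 (\<nabla>\<Psi>\<^sub>2)\<^sup>2 + 288 (\<Delta> - a\<^sup>2 sin\<^sup>2 \<theta>) \<Psi>\<^sub>2\<^sup>2 / (\<rho>\<^sup>2 z\<^sup>2)\<close>. The numerator of \<open>\<chi>\<close> is thus the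
  real part of a rational function of \<open>z\<close> and \<open>z'\<close>; for \<open>q = 0\<close> its two contributions cancel, which
  is the source of the factor \<open>q\<^sup>2\<close>.
\<close>

section \<open>Partial derivatives and tensor components\<close>

text \<open>The invariants are defined through coordinate components, \<open>deriv\<close> and
  \<open>matrix_inv\<close>; expanding the curvature and its covariant derivative directly would
  give enormous expressions. In the frame only six connection forms remain, and the Weyl tensor is
  linear in the two functions \<open>Re \<Psi>\<close> and \<open>Im \<Psi>\<close> with constant
  coefficients, so that its covariant derivative consists of two gradients and an infinitesimal
  rotation of a constant tensor. The number 12/5 is tuned to the vacuum case. There
  \<open>\<Psi> = -m/z^3\<close>, hence
  \<open>(\<nabla>\<Psi>)^2 = 9 \<Psi>^2 (\<nabla>z)^2/z^2\<close> with
  \<open>(\<nabla>z)^2 = (\<Delta> - a^2 sin^2 \<theta>)/\<rho>^2\<close>. Both contributions to the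
  numerator are then multiples of the real part of \<open>\<Psi>^4 (\<nabla>z)^2/z^2\<close>: the
  gradients of \<open>I1\<close> and \<open>I2\<close> give the coefficient
  \<open>-9216 * 9\<close>, the other bracket gives \<open>12/5 * 48 * (48 * 9 + 288)\<close>, and
  these add up to zero. Since the numerator is even in \<open>q\<close>, a factor \<open>q^2\<close>
  splits off.\<close>

lemma vector_4 [simp]:
  "(vector [u, v, w, z] :: 'a::zero^4) $ 1 = u"
  "(vector [u, v, w, z] :: 'a::zero^4) $ 2 = v"
  "(vector [u, v, w, z] :: 'a::zero^4) $ 3 = w"
  "(vector [u, v, w, z] :: 'a::zero^4) $ 4 = z"
  by (simp_all add: vector_def)

text \<open>\<open>deriv\<close> has an unspecified value where no derivative exists, so the value
  is carried together with the existence of the derivative along the coordinate line.\<close>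

definition has_partial :: "4 \<Rightarrow> (real^4 \<Rightarrow> real) \<Rightarrow> real \<Rightarrow> real^4 \<Rightarrow> bool" where
  "has_partial i f D x \<longleftrightarrow> ((\<lambda>s. f (x + s *\<^sub>R axis i 1)) has_field_derivative D) (at 0)"

definition pdiff :: "4 \<Rightarrow> (real^4 \<Rightarrow> real) \<Rightarrow> real^4 \<Rightarrow> bool" where
  "pdiff i f x \<longleftrightarrow> has_partial i f (partial i f x) x"

lemma has_partial_partial: "has_partial i f D x \<Longrightarrow> partial i f x = D"
  unfolding has_partial_def partial_def by (rule DERIV_imp_deriv)

lemma has_partial_pdiff: "has_partial i f D x \<Longrightarrow> pdiff i f x"
  unfolding pdiff_def using has_partial_partial by fastforce

lemma has_partial_const: "has_partial i (\<lambda>y. k) 0 x"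
  unfolding has_partial_def by simp

lemma has_partial_add:
  "has_partial i f D x \<Longrightarrow> has_partial i f' D' x \<Longrightarrow> has_partial i (\<lambda>y. f y + f' y) (D + D') x"
  unfolding has_partial_def by (rule DERIV_add)

lemma has_partial_mult:
  assumes "has_partial i f D x" "has_partial i f' D' x"
  shows "has_partial i (\<lambda>y. f y * f' y) (D * f' x + f x * D') x"
  using DERIV_mult[OF assms[unfolded has_partial_def]]
  unfolding has_partial_def by (simp add: algebra_simps)

lemma has_partial_cmult: "has_partial i f D x \<Longrightarrow> has_partial i (\<lambda>y. k * f y) (k * D) x"
  using has_partial_mult[OF has_partial_const] by fastforce

lemma has_partial_sum:
  assumes "\<And>k. k \<in> A \<Longrightarrow> has_partial i (f k) (D k) x"
  shows "has_partial i (\<lambda>y. \<Sum>k\<in>A. f k y) (\<Sum>k\<in>A. D k) x"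
  using assms unfolding has_partial_def by (intro DERIV_sum) auto

text \<open>An open set contains a short segment of every coordinate line through its points. Hence
  identities that hold only on an open set may be differentiated there.\<close>

lemma eventually_line:
  fixes x :: "real^4"
  assumes "open U" "x \<in> U"
  shows "\<forall>\<^sub>F s in nhds 0. x + s *\<^sub>R axis i 1 \<in> U"
proof -
  have "((\<lambda>s::real. x + s *\<^sub>R axis i 1) \<longlongrightarrow> x + 0 *\<^sub>R axis i 1) (nhds 0)"
    by (intro tendsto_intros filterlim_ident)
  then show ?thesis
    using assms by (auto simp: tendsto_def)
qed

lemma partial_cong:
  assumes "open U" "x \<in> U" "\<And>y. y \<in> U \<Longrightarrow> f y = f' y"
  shows "partial i f x = partial i f' x"
  unfolding partial_def
  by (rule deriv_cong_ev[OF eventually_mono[OF eventually_line[OF assms(1,2), of i]]]) (auto simp: assms(3))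

lemma has_partial_cong:
  assumes "open U" "x \<in> U" "\<And>y. y \<in> U \<Longrightarrow> f y = f' y" "has_partial i f D x"
  shows "has_partial i f' D x"
proof -
  have "\<forall>\<^sub>F s in nhds 0. f' (x + s *\<^sub>R axis i 1) = f (x + s *\<^sub>R axis i 1)"
    by (rule eventually_mono[OF eventually_line[OF assms(1,2), of i]]) (auto simp: assms(3))
  from DERIV_cong_ev[OF refl this refl] show ?thesis
    using assms(4) unfolding has_partial_def by blast
qed

lemma matrix_inv_eqI:
  fixes M N :: "real^'n^'n"
  assumes "M ** N = mat 1"
  shows "matrix_inv M = N"
proof -
  have N: "N ** M = mat 1" using assms matrix_left_right_inverse by blast
  have "M ** matrix_inv M = mat 1 \<and> matrix_inv M ** M = mat 1"
    unfolding matrix_inv_def by (rule someI[of _ N]) (simp add: assms N)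
  then have "N ** (M ** matrix_inv M) = N" by simp
  then show ?thesis by (simp add: matrix_mul_assoc N)
qed

section \<open>Matrices acting on single slots of a tensor\<close>

definition op1 :: "(4 \<Rightarrow> 4 \<Rightarrow> real) \<Rightarrow> tensor4 \<Rightarrow> tensor4" where
  "op1 M T i j k l = (\<Sum>a\<in>UNIV. M a i * T a j k l)"
definition op2 :: "(4 \<Rightarrow> 4 \<Rightarrow> real) \<Rightarrow> tensor4 \<Rightarrow> tensor4" where
  "op2 M T i j k l = (\<Sum>a\<in>UNIV. M a j * T i a k l)"
definition op3 :: "(4 \<Rightarrow> 4 \<Rightarrow> real) \<Rightarrow> tensor4 \<Rightarrow> tensor4" where
  "op3 M T i j k l = (\<Sum>a\<in>UNIV. M a k * T i j a l)"
definition op4 :: "(4 \<Rightarrow> 4 \<Rightarrow> real) \<Rightarrow> tensor4 \<Rightarrow> tensor4" where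
  "op4 M T i j k l = (\<Sum>a\<in>UNIV. M a l * T i j k a)"

definition mmul :: "(4 \<Rightarrow> 4 \<Rightarrow> real) \<Rightarrow> (4 \<Rightarrow> 4 \<Rightarrow> real) \<Rightarrow> 4 \<Rightarrow> 4 \<Rightarrow> real" where
  "mmul M N a b = (\<Sum>i\<in>UNIV. M a i * N i b)"

lemmas op_defs = op1_def op2_def op3_def op4_def

text \<open>Working one slot at a time turns changes of frame into rewriting: operators on different
  slots commute, and by \<open>op_mult\<close> those on one slot compose to a matrix
  product.\<close>

lemma op_commute:
  "op2 M (op1 N T) = op1 N (op2 M T)" "op3 M (op1 N T) = op1 N (op3 M T)"
  "op4 M (op1 N T) = op1 N (op4 M T)" "op3 M (op2 N T) = op2 N (op3 M T)"
  "op4 M (op2 N T) = op2 N (op4 M T)" "op4 M (op3 N T) = op3 N (op4 M T)"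
  by (intro ext; simp add: op_defs sum_distrib_left mult.left_commute; subst sum.swap; rule refl)+

lemma op_mult:
  "op1 N (op1 M T) = op1 (mmul M N) T" "op2 N (op2 M T) = op2 (mmul M N) T"
  "op3 N (op3 M T) = op3 (mmul M N) T" "op4 N (op4 M T) = op4 (mmul M N) T"
  by (intro ext; simp add: op_defs mmul_def sum_distrib_left sum_distrib_right mult_ac;
      subst sum.swap; rule refl)+

lemma op_diag:
  assumes "\<And>a b. M a b = (if a = b then D a else 0)"
  shows "op1 M T i j k l = D i * T i j k l" "op2 M T i j k l = D j * T i j k l"
    "op3 M T i j k l = D k * T i j k l" "op4 M T i j k l = D l * T i j k l"
  unfolding op_defs by (simp_all add: assms if_distrib[of "\<lambda>u. u * _"] cong: if_cong)

definition tensor_prod :: "tensor4 \<Rightarrow> tensor4 \<Rightarrow> real" where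
  "tensor_prod S T = (\<Sum>i\<in>UNIV. \<Sum>j\<in>UNIV. \<Sum>k\<in>UNIV. \<Sum>l\<in>UNIV. S i j k l * T i j k l)"

text \<open>\<open>pull (e y)\<close> produces the coordinate components of a covariant tensor from
  its components in the coframe \<open>e y\<close>.\<close>

definition pull :: "(4 \<Rightarrow> 4 \<Rightarrow> real) \<Rightarrow> tensor4 \<Rightarrow> tensor4" where
  "pull M T = op1 M (op2 M (op3 M (op4 M T)))"

lemma pull_sum:
  "pull M T i j k l = (\<Sum>a\<in>UNIV. \<Sum>b\<in>UNIV. \<Sum>c\<in>UNIV. \<Sum>d\<in>UNIV.
     M a i * M b j * M c k * M d l * T a b c d)"
  by (simp add: pull_def op_defs sum_distrib_left mult_ac)

lemma pull_pull: "pull N (pull M T) = pull (mmul M N) T"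
  by (simp add: pull_def op_commute op_mult)

lemma sum_UNIV_5:
  "(\<Sum>i\<in>UNIV. \<Sum>j\<in>UNIV. \<Sum>k\<in>UNIV. \<Sum>l\<in>UNIV. \<Sum>a\<in>UNIV. f i j k l a)
     = (\<Sum>(i, j, k, l, a)\<in>UNIV. f i j k l a)"
  by (simp add: sum.cartesian_product)

text \<open>Both sides are single sums over five indices; exchanging the slot index with the
  contracted index matches them, so an operator moves to the other factor transposed.\<close>

lemma tensor_prod_op:
  "tensor_prod (op1 M S) T = tensor_prod S (op1 (\<lambda>i a. M a i) T)"
  "tensor_prod (op2 M S) T = tensor_prod S (op2 (\<lambda>i a. M a i) T)"
  "tensor_prod (op3 M S) T = tensor_prod S (op3 (\<lambda>i a. M a i) T)"
  "tensor_prod (op4 M S) T = tensor_prod S (op4 (\<lambda>i a. M a i) T)"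
proof -
  note unf = tensor_prod_def op_defs sum_distrib_left sum_distrib_right sum_UNIV_5
  show "tensor_prod (op1 M S) T = tensor_prod S (op1 (\<lambda>i a. M a i) T)"
    unfolding unf by (rule sum.reindex_bij_witness[where i = "\<lambda>(i, j, k, l, a). (a, j, k, l, i)"
        and j = "\<lambda>(i, j, k, l, a). (a, j, k, l, i)"]) auto
  show "tensor_prod (op2 M S) T = tensor_prod S (op2 (\<lambda>i a. M a i) T)"
    unfolding unf by (rule sum.reindex_bij_witness[where i = "\<lambda>(i, j, k, l, a). (i, a, k, l, j)"
        and j = "\<lambda>(i, j, k, l, a). (i, a, k, l, j)"]) auto
  show "tensor_prod (op3 M S) T = tensor_prod S (op3 (\<lambda>i a. M a i) T)"
    unfolding unf by (rule sum.reindex_bij_witness[where i = "\<lambda>(i, j, k, l, a). (i, j, a, l, k)"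
        and j = "\<lambda>(i, j, k, l, a). (i, j, a, l, k)"]) auto
  show "tensor_prod (op4 M S) T = tensor_prod S (op4 (\<lambda>i a. M a i) T)"
    unfolding unf by (rule sum.reindex_bij_witness[where i = "\<lambda>(i, j, k, l, a). (i, j, k, a, l)"
        and j = "\<lambda>(i, j, k, l, a). (i, j, k, a, l)"]) auto
qed

lemma tensor_prod_pull: "tensor_prod (pull M S) T = tensor_prod S (pull (\<lambda>i a. M a i) T)"
  by (simp add: pull_def tensor_prod_op op_commute)

section \<open>Orthonormal frames and the structure equations\<close>

lemma pdiff_add: "pdiff i f x \<Longrightarrow> pdiff i f' x \<Longrightarrow> pdiff i (\<lambda>y. f y + f' y) x"
  unfolding pdiff_def[of _ f] pdiff_def[of _ f'] by (rule has_partial_pdiff, rule has_partial_add)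

lemma pdiff_mult: "pdiff i f x \<Longrightarrow> pdiff i f' x \<Longrightarrow> pdiff i (\<lambda>y. f y * f' y) x"
  unfolding pdiff_def[of _ f] pdiff_def[of _ f'] by (rule has_partial_pdiff, rule has_partial_mult)

lemma pdiff_sum: "(\<And>k. k \<in> A \<Longrightarrow> pdiff i (f k) x) \<Longrightarrow> pdiff i (\<lambda>y. \<Sum>k\<in>A. f k y) x"
  unfolding pdiff_def[of _ "f _"] by (rule has_partial_pdiff, rule has_partial_sum)

lemma pdiff_cong:
  assumes "open U" "x \<in> U" "\<And>y. y \<in> U \<Longrightarrow> f y = f' y" "pdiff i f x"
  shows "pdiff i f' x"
  using has_partial_pdiff[OF has_partial_cong[OF assms(1-3) assms(4)[unfolded pdiff_def]]] .

lemma partial_sum_mult: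
  assumes "\<And>k. pdiff n (f k) x" "\<And>k. pdiff n (f' k) x"
  shows "partial n (\<lambda>y. \<Sum>k\<in>A. f k y * f' k y) x
    = (\<Sum>k\<in>A. partial n (f k) x * f' k x + f k x * partial n (f' k) x)"
  by (intro has_partial_partial has_partial_sum has_partial_mult assms[unfolded pdiff_def])

lemma partial_add:
  "pdiff i f x \<Longrightarrow> pdiff i f' x \<Longrightarrow> partial i (\<lambda>y. f y + f' y) x = partial i f x + partial i f' x"
  unfolding pdiff_def by (intro has_partial_partial has_partial_add)

lemma sum_antisym_sym:
  fixes A S :: "4 \<Rightarrow> 4 \<Rightarrow> real"
  assumes "\<And>a b. A a b = - A b a" "\<And>a b. S a b = S b a"
  shows "(\<Sum>a\<in>UNIV. \<Sum>b\<in>UNIV. A a b * S a b) = 0"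
proof -
  have "(\<Sum>a\<in>UNIV. \<Sum>b\<in>UNIV. A a b * S a b) = (\<Sum>b\<in>UNIV. \<Sum>a\<in>UNIV. A a b * S a b)"
    by (rule sum.swap)
  also have "\<dots> = (\<Sum>b\<in>UNIV. \<Sum>a\<in>UNIV. - (A b a * S b a))"
    by (intro sum.cong refl) (metis assms mult_minus_left)
  finally show ?thesis by (simp add: sum_negf)
qed

lemma sum_mult_delta:
  fixes f :: "4 \<Rightarrow> real"
  shows "(\<Sum>b\<in>UNIV. (if a = b then 1 else 0) * f b) = f a"
    "(\<Sum>b\<in>UNIV. f b * (if a = b then 1 else 0)) = f a"
  by (simp_all add: if_distrib[of "\<lambda>u. u * _"] if_distrib[of "\<lambda>u. _ * u"] cong: if_cong)

text \<open>The frame index comes first in \<open>e y a i\<close> and last in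
  \<open>E y i a\<close>; \<open>h\<close> lists the signs of the signature. Zero torsion and
  \<open>metric_connection\<close> characterize the Levi-Civita connection, so the forms
  \<open>w\<close> can be given as explicit candidates and checked instead of being derived from the
  coframe.\<close>

locale orthonormal_frame =
  fixes g :: metric and U :: "(real^4) set" and h :: "4 \<Rightarrow> real"
    and e E :: "real^4 \<Rightarrow> 4 \<Rightarrow> 4 \<Rightarrow> real" and w :: "real^4 \<Rightarrow> 4 \<Rightarrow> 4 \<Rightarrow> 4 \<Rightarrow> real"
  assumes open_U: "open U"
    and h_square: "h a * h a = 1"
    and metric_frame: "y \<in> U \<Longrightarrow> g y $ i $ j = (\<Sum>a\<in>UNIV. h a * (e y a i * e y a j))"
    and dual_frame: "y \<in> U \<Longrightarrow> (\<Sum>i\<in>UNIV. e y a i * E y i b) = (if a = b then 1 else 0)"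
    and pdiff_e: "y \<in> U \<Longrightarrow> pdiff k (\<lambda>z. e z a i) y"
    and pdiff_E: "y \<in> U \<Longrightarrow> pdiff k (\<lambda>z. E z i a) y"
    and pdiff_w: "y \<in> U \<Longrightarrow> pdiff k (\<lambda>z. w z n a b) y"
    and pdiff_de: "y \<in> U \<Longrightarrow> pdiff k (\<lambda>z. partial l (\<lambda>z. e z a i) z) y"
    and mixed_partials: "y \<in> U \<Longrightarrow>
      partial k (\<lambda>z. partial l (\<lambda>z. e z a i) z) y = partial l (\<lambda>z. partial k (\<lambda>z. e z a i) z) y"
    and torsion_free: "y \<in> U \<Longrightarrow>
      partial j (\<lambda>z. e z a k) y + (\<Sum>b\<in>UNIV. w y j a b * e y b k)
        = partial k (\<lambda>z. e z a j) y + (\<Sum>b\<in>UNIV. w y k a b * e y b j)"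
    and metric_connection: "y \<in> U \<Longrightarrow> h a * w y n a b = - (h b * w y n b a)"
begin

text \<open>
  The connection is \<open>\<omega>\<^sup>a\<^sub>b(\<partial>\<^sub>n) = w y n a b\<close>; \<open>torsion_free\<close> is Cartan's first structure equation.
  Below, \<open>conn_coframe y a j k\<close> turns out to be \<open>e\<^sup>a\<^sub>i \<Gamma>\<^sup>i\<^sub>j\<^sub>k\<close>, so that second derivatives of the metric are never needed.
\<close>

definition conn_coframe :: "real^4 \<Rightarrow> 4 \<Rightarrow> 4 \<Rightarrow> 4 \<Rightarrow> real" where
  "conn_coframe y a j k = partial j (\<lambda>z. e z a k) y + (\<Sum>b\<in>UNIV. w y j a b * e y b k)"

definition curv :: "real^4 \<Rightarrow> 4 \<Rightarrow> 4 \<Rightarrow> 4 \<Rightarrow> 4 \<Rightarrow> real" where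
  "curv y a b k l = partial k (\<lambda>z. w z l a b) y - partial l (\<lambda>z. w z k a b) y
     + (\<Sum>c\<in>UNIV. w y k a c * w y l c b - w y l a c * w y k c b)"

lemma conn_coframe_sym: "y \<in> U \<Longrightarrow> conn_coframe y a j k = conn_coframe y a k j"
  unfolding conn_coframe_def by (rule torsion_free)

lemma dual_frame':
  assumes "y \<in> U"
  shows "(\<Sum>a\<in>UNIV. E y i a * e y a j) = (if i = j then 1 else 0)"
proof -
  let ?M = "(\<chi> a i. e y a i) :: real^4^4" and ?N = "(\<chi> i a. E y i a) :: real^4^4"
  have "?M ** ?N = mat 1"
    by (simp add: matrix_matrix_mult_def mat_def vec_eq_iff dual_frame[OF assms])
  then have "?N ** ?M = mat 1"
    using matrix_left_right_inverse by blast
  then show ?thesis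
    by (simp add: matrix_matrix_mult_def mat_def vec_eq_iff)
qed

lemma contract_e_E:
  assumes "y \<in> U" shows "(\<Sum>i\<in>UNIV. e y a i * (\<Sum>b\<in>UNIV. E y i b * f b)) = f a"
proof -
  have "(\<Sum>i\<in>UNIV. e y a i * (\<Sum>b\<in>UNIV. E y i b * f b))
      = (\<Sum>b\<in>UNIV. (\<Sum>i\<in>UNIV. e y a i * E y i b) * f b)"
    unfolding sum_distrib_left sum_distrib_right by (subst sum.swap) (simp add: mult_ac)
  then show ?thesis by (simp only: dual_frame[OF assms] sum_mult_delta)
qed

lemma contract_E_e:
  assumes "y \<in> U" shows "(\<Sum>a\<in>UNIV. E y i a * (\<Sum>j\<in>UNIV. e y a j * f j)) = f i"
proof -
  have "(\<Sum>a\<in>UNIV. E y i a * (\<Sum>j\<in>UNIV. e y a j * f j))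
      = (\<Sum>j\<in>UNIV. (\<Sum>a\<in>UNIV. E y i a * e y a j) * f j)"
    unfolding sum_distrib_left sum_distrib_right by (subst sum.swap) (simp add: mult_ac)
  then show ?thesis by (simp only: dual_frame'[OF assms] sum_mult_delta)
qed

lemma inv_metric_frame:
  assumes "y \<in> U"
  shows "inv_metric g y i j = (\<Sum>a\<in>UNIV. h a * (E y i a * E y j a))"
proof -
  have "(\<Sum>k\<in>UNIV. (\<Sum>a\<in>UNIV. h a * (e y a i * e y a k)) * (\<Sum>b\<in>UNIV. h b * (E y k b * E y j b)))
        = (if i = j then 1 else 0)" for i j
  proof -
    have "(\<Sum>k\<in>UNIV. (\<Sum>a\<in>UNIV. h a * (e y a i * e y a k)) * (\<Sum>b\<in>UNIV. h b * (E y k b * E y j b)))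
        = (\<Sum>k\<in>UNIV. \<Sum>a\<in>UNIV. (h a * e y a i) * (e y a k * (\<Sum>b\<in>UNIV. E y k b * (h b * E y j b))))"
      by (simp add: sum_distrib_left sum_distrib_right mult_ac)
    also have "\<dots> = (\<Sum>a\<in>UNIV. (h a * e y a i) * (\<Sum>k\<in>UNIV. e y a k * (\<Sum>b\<in>UNIV. E y k b * (h b * E y j b))))"
      unfolding sum_distrib_left[of "h _ * _"] by (rule sum.swap)
    also have "\<dots> = (\<Sum>a\<in>UNIV. (h a * e y a i) * (h a * E y j a))"
      by (simp only: contract_e_E[OF assms])
    also have "\<dots> = (\<Sum>a\<in>UNIV. (h a * h a) * (E y j a * e y a i))"
      by (simp add: mult_ac)
    also have "\<dots> = (if j = i then 1 else 0)"
      by (simp add: h_square dual_frame'[OF assms])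
    finally show ?thesis by auto
  qed
  then have "g y ** (\<chi> i j. \<Sum>a\<in>UNIV. h a * (E y i a * E y j a)) = mat 1"
    by (simp add: matrix_matrix_mult_def mat_def vec_eq_iff metric_frame[OF assms])
  from matrix_inv_eqI[OF this] show ?thesis
    by (simp add: inv_metric_def)
qed

lemma contract_metric_E:
  assumes "y \<in> U" shows "(\<Sum>j\<in>UNIV. inv_metric g y i j * (\<Sum>a\<in>UNIV. h a * (e y a j * f a)))
      = (\<Sum>a\<in>UNIV. E y i a * f a)"
proof -
  have "(\<Sum>j\<in>UNIV. inv_metric g y i j * (\<Sum>a\<in>UNIV. h a * (e y a j * f a)))
      = (\<Sum>j\<in>UNIV. \<Sum>a\<in>UNIV. (h a * f a) * (e y a j * (\<Sum>b\<in>UNIV. E y j b * (h b * E y i b))))"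
    unfolding inv_metric_frame[OF assms] sum_distrib_left[of "inv_metric _ _ _ _"]
    by (subst sum_distrib_left) (simp add: mult_ac)
  also have "\<dots> = (\<Sum>a\<in>UNIV. (h a * f a) * (\<Sum>j\<in>UNIV. e y a j * (\<Sum>b\<in>UNIV. E y j b * (h b * E y i b))))"
    unfolding sum_distrib_left[of "h _ * _"] by (rule sum.swap)
  also have "\<dots> = (\<Sum>a\<in>UNIV. (h a * f a) * (h a * E y i a))"
    by (simp only: contract_e_E[OF assms])
  also have "\<dots> = (\<Sum>a\<in>UNIV. (h a * h a) * (E y i a * f a))"
    by (simp add: mult_ac)
  finally show ?thesis by (simp add: h_square)
qed

text \<open>Connection terms may be added to both coframe derivatives, because the lowered
  connection is antisymmetric in its frame indices and is paired with an expression symmetric in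
  them.\<close>

lemma partial_metric:
  assumes "y \<in> U"
  shows "partial k (\<lambda>z. g z $ i $ j) y = (\<Sum>a\<in>UNIV. h a * (conn_coframe y a k i * e y a j
      + e y a i * conn_coframe y a k j))"
proof -
  have "partial k (\<lambda>z. g z $ i $ j) y = partial k (\<lambda>z. \<Sum>a\<in>UNIV. h a * (e z a i * e z a j)) y"
    by (rule partial_cong[OF open_U assms metric_frame])
  also have "\<dots> = (\<Sum>a\<in>UNIV. h a * (partial k (\<lambda>z. e z a i) y * e y a j + e y a i * partial k (\<lambda>z. e z a j) y))"
    by (intro has_partial_partial has_partial_sum has_partial_mult has_partial_cmult
        pdiff_e[OF assms, unfolded pdiff_def])
  also have "\<dots> = (\<Sum>a\<in>UNIV. h a * (conn_coframe y a k i * e y a j + e y a i * conn_coframe y a k j))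
      - (\<Sum>a\<in>UNIV. \<Sum>b\<in>UNIV. (h a * w y k a b) * (e y b i * e y a j + e y a i * e y b j))"
    by (simp add: conn_coframe_def algebra_simps sum.distrib sum_distrib_left sum_distrib_right sum_subtractf)
  also have "(\<Sum>a\<in>UNIV. \<Sum>b\<in>UNIV. (h a * w y k a b) * (e y b i * e y a j + e y a i * e y b j)) = 0"
    by (rule sum_antisym_sym) (rule metric_connection[OF assms], simp add: mult_ac add_ac)
  finally show ?thesis by simp
qed

text \<open>The three metric derivatives yield six terms by \<open>partial_metric\<close>. By the
  symmetry of \<open>conn_coframe\<close> four of them cancel and the remaining two agree.\<close>

lemma christoffel_frame:
  assumes "y \<in> U"
  shows "christoffel g y i j k = (\<Sum>a\<in>UNIV. E y i a * conn_coframe y a j k)"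
proof -
  have "partial k (\<lambda>z. g z $ l $ j) y + partial j (\<lambda>z. g z $ l $ k) y - partial l (\<lambda>z. g z $ j $ k) y
     = (\<Sum>a\<in>UNIV. h a * (e y a l * (2 * conn_coframe y a j k)))" for l
    unfolding partial_metric[OF assms] sum.distrib[symmetric] sum_subtractf[symmetric]
    using conn_coframe_sym[OF assms, of _ l j] conn_coframe_sym[OF assms, of _ l k] conn_coframe_sym[OF
        assms, of _ k j]
    by (intro sum.cong refl) (simp add: algebra_simps)
  then show ?thesis
    unfolding christoffel_def
    by (simp add: contract_metric_E[OF assms]) (simp add: mult.left_commute[of _ 2] flip: sum_distrib_left)
qed

lemma e_christoffel:
  assumes "y \<in> U" shows "(\<Sum>i\<in>UNIV. e y a i * christoffel g y i j k) = conn_coframe y a j k"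
  unfolding christoffel_frame[OF assms] by (rule contract_e_E[OF assms])

lemma pdiff_conn_coframe: "y \<in> U \<Longrightarrow> pdiff n (\<lambda>z. conn_coframe z a j k) y"
  unfolding conn_coframe_def by (intro pdiff_add pdiff_sum pdiff_mult pdiff_e pdiff_w pdiff_de)

lemma pdiff_christoffel:
  assumes "y \<in> U" shows "pdiff n (\<lambda>z. christoffel g z i j k) y"
  by (rule pdiff_cong[OF open_U assms christoffel_frame[symmetric]])
    (auto intro!: pdiff_sum pdiff_mult pdiff_E pdiff_conn_coframe assms)

lemma partial_conn_coframe:
  assumes "y \<in> U"
  shows "partial k (\<lambda>z. conn_coframe z a l j) y = partial k (\<lambda>z. partial l (\<lambda>z. e z a j) z) y
    + (\<Sum>b\<in>UNIV. partial k (\<lambda>z. w z l a b) y * e y b j + w y l a b * partial k (\<lambda>z. e z b j) y)"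
  unfolding conn_coframe_def
  by (subst partial_add)
    (auto intro!: pdiff_sum pdiff_mult pdiff_de pdiff_w pdiff_e partial_sum_mult assms)

text \<open>The coframe absorbs the first Christoffel symbol, which leaves a coframe derivative and
  a connection form. The derivative term occurs with the opposite sign in
  \<open>e_partial_christoffel\<close>.\<close>

lemma e_christoffel_christoffel:
  assumes "y \<in> U"
  shows "(\<Sum>i\<in>UNIV. e y a i * (\<Sum>n\<in>UNIV. christoffel g y i k n * christoffel g y n j l))
    = (\<Sum>n\<in>UNIV. partial k (\<lambda>z. e z a n) y * christoffel g y n j l)
      + (\<Sum>b\<in>UNIV. w y k a b * conn_coframe y b j l)"
proof -
  have "(\<Sum>i\<in>UNIV. e y a i * (\<Sum>n\<in>UNIV. christoffel g y i k n * christoffel g y n j l))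
    = (\<Sum>n\<in>UNIV. (\<Sum>i\<in>UNIV. e y a i * christoffel g y i k n) * christoffel g y n j l)"
    unfolding sum_distrib_left sum_distrib_right by (subst sum.swap) (simp add: mult_ac)
  also have "\<dots> = (\<Sum>n\<in>UNIV. partial k (\<lambda>z. e z a n) y * christoffel g y n j l)
      + (\<Sum>n\<in>UNIV. \<Sum>b\<in>UNIV. w y k a b * (e y b n * christoffel g y n j l))"
    unfolding e_christoffel[OF assms] conn_coframe_def
    by (simp only: sum.distrib distrib_right sum_distrib_right mult.assoc)
  also have "(\<Sum>n\<in>UNIV. \<Sum>b\<in>UNIV. w y k a b * (e y b n * christoffel g y n j l))
      = (\<Sum>b\<in>UNIV. w y k a b * (\<Sum>n\<in>UNIV. e y b n * christoffel g y n j l))"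
    unfolding sum_distrib_left by (rule sum.swap)
  finally show ?thesis by (simp only: e_christoffel[OF assms])
qed

text \<open>Leibniz rule for \<open>e \<Gamma> = conn_coframe\<close>; the derivative of a
  Christoffel symbol is traded for one of \<open>conn_coframe\<close>.\<close>

lemma e_partial_christoffel:
  assumes "y \<in> U"
  shows "(\<Sum>i\<in>UNIV. e y a i * partial k (\<lambda>z. christoffel g z i j l) y)
    = partial k (\<lambda>z. conn_coframe z a l j) y - (\<Sum>i\<in>UNIV. partial k (\<lambda>z. e z a i) y * christoffel g y i j l)"
proof -
  have "partial k (\<lambda>z. conn_coframe z a l j) y = partial k (\<lambda>z. \<Sum>i\<in>UNIV. e z a i * christoffel g z i j l) y"
    by (rule partial_cong[OF open_U assms]) (simp add: e_christoffel conn_coframe_sym)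
  also have "\<dots> = (\<Sum>i\<in>UNIV. partial k (\<lambda>z. e z a i) y * christoffel g y i j l
      + e y a i * partial k (\<lambda>z. christoffel g z i j l) y)"
    by (intro partial_sum_mult pdiff_e pdiff_christoffel assms)
  finally show ?thesis by (simp add: sum.distrib)
qed

text \<open>Cartan's second structure equation.\<close>

lemma e_riemann_up:
  assumes "y \<in> U"
  shows "(\<Sum>i\<in>UNIV. e y a i * riemann_up g y i j k l) = (\<Sum>b\<in>UNIV. curv y a b k l * e y b j)"
proof -
  have ww: "(\<Sum>b\<in>UNIV. w y k a b * conn_coframe y b j l) = (\<Sum>b\<in>UNIV. w y k a b * partial l (\<lambda>z. e z b j) y)
      + (\<Sum>b\<in>UNIV. \<Sum>c\<in>UNIV. w y k a c * w y l c b * e y b j)" for k l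
  proof -
    have "(\<Sum>b\<in>UNIV. w y k a b * conn_coframe y b j l) = (\<Sum>b\<in>UNIV. w y k a b * conn_coframe y b l j)"
      by (simp only: conn_coframe_sym[OF assms, of _ j])
    also have "\<dots> = (\<Sum>b\<in>UNIV. w y k a b * partial l (\<lambda>z. e z b j) y)
      + (\<Sum>c\<in>UNIV. \<Sum>b\<in>UNIV. w y k a c * w y l c b * e y b j)"
      by (simp add: conn_coframe_def sum.distrib distrib_left sum_distrib_left mult_ac)
    also have "(\<Sum>c\<in>UNIV. \<Sum>b\<in>UNIV. w y k a c * w y l c b * e y b j)
        = (\<Sum>b\<in>UNIV. \<Sum>c\<in>UNIV. w y k a c * w y l c b * e y b j)"
      by (rule sum.swap)
    finally show ?thesis .
  qed
  have "(\<Sum>i\<in>UNIV. e y a i * riemann_up g y i j k l) =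
      (\<Sum>i\<in>UNIV. e y a i * partial k (\<lambda>z. christoffel g z i j l) y)
    - (\<Sum>i\<in>UNIV. e y a i * partial l (\<lambda>z. christoffel g z i j k) y)
    + ((\<Sum>i\<in>UNIV. e y a i * (\<Sum>n\<in>UNIV. christoffel g y i k n * christoffel g y n j l))
     - (\<Sum>i\<in>UNIV. e y a i * (\<Sum>n\<in>UNIV. christoffel g y i l n * christoffel g y n j k)))"
    unfolding riemann_up_def
    by (simp add: sum.distrib sum_subtractf distrib_left right_diff_distrib)
  \<comment> \<open>The products of a coframe derivative with a Christoffel symbol cancel, the
    second derivatives cancel by \<open>mixed_partials\<close>, and the products of a connection
    form with a coframe derivative cancel after antisymmetrization in \<open>k\<close> and
    \<open>l\<close>.\<close>
  also have "\<dots> = (\<Sum>b\<in>UNIV. partial k (\<lambda>z. w z l a b) y * e y b j)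
     - (\<Sum>b\<in>UNIV. partial l (\<lambda>z. w z k a b) y * e y b j)
     + (\<Sum>b\<in>UNIV. \<Sum>c\<in>UNIV. w y k a c * w y l c b * e y b j)
     - (\<Sum>b\<in>UNIV. \<Sum>c\<in>UNIV. w y l a c * w y k c b * e y b j)"
    unfolding e_partial_christoffel[OF assms] e_christoffel_christoffel[OF assms] ww
      partial_conn_coframe[OF assms] mixed_partials[OF assms, of k l] sum.distrib by simp
  also have "\<dots> = (\<Sum>b\<in>UNIV. curv y a b k l * e y b j)"
    by (simp add: curv_def sum.distrib sum_subtractf distrib_right left_diff_distrib sum_distrib_right)
  finally show ?thesis .
qed

end

section \<open>The Levi-Civita symbol and determinants\<close>

lemma det_4:
  "det (A::real^4^4) =
     A$1$1 * (A$2$2 * (A$3$3 * A$4$4 - A$3$4 * A$4$3) - A$2$3 * (A$3$2 * A$4$4 - A$3$4 * A$4$2)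
              + A$2$4 * (A$3$2 * A$4$3 - A$3$3 * A$4$2))
   - A$1$2 * (A$2$1 * (A$3$3 * A$4$4 - A$3$4 * A$4$3) - A$2$3 * (A$3$1 * A$4$4 - A$3$4 * A$4$1)
              + A$2$4 * (A$3$1 * A$4$3 - A$3$3 * A$4$1))
   + A$1$3 * (A$2$1 * (A$3$2 * A$4$4 - A$3$4 * A$4$2) - A$2$2 * (A$3$1 * A$4$4 - A$3$4 * A$4$1)
              + A$2$4 * (A$3$1 * A$4$2 - A$3$2 * A$4$1))
   - A$1$4 * (A$2$1 * (A$3$2 * A$4$3 - A$3$3 * A$4$2) - A$2$2 * (A$3$1 * A$4$3 - A$3$3 * A$4$1)
              + A$2$3 * (A$3$1 * A$4$2 - A$3$2 * A$4$1))"
proof -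
  have f: "finite {2::4, 3, 4}" "1 \<notin> {2::4, 3, 4}" "finite {3::4, 4}" "2 \<notin> {3::4, 4}"
    "finite {4::4}" "3 \<notin> {4::4}" "finite ({}::4 set)" "4 \<notin> ({}::4 set)"
    by auto
  show ?thesis
    unfolding det_def UNIV_4
    apply (subst sum_over_permutations_insert[OF f(1,2)])
    apply (subst sum_over_permutations_insert[OF f(3,4)])
    apply (subst sum_over_permutations_insert[OF f(5,6)])
    apply (subst sum_over_permutations_insert[OF f(7,8)])
    apply (simp add: permutes_sing sign_swap_id sign_compose permutation_swap_id permutation_compose
        sign_id swap_id_eq transpose_def)
    apply (simp add: algebra_simps)
    done
qed

text \<open>As a determinant the symbol can be evaluated on numerals, and its transformation law
  becomes multiplicativity of \<open>det\<close>. The rows of the matrix are those of the identity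
  permuted if the indices are distinct; otherwise two rows agree.\<close>

lemma levi_civita_symbol_det:
  "levi_civita_symbol i j k l =
     det ((\<chi> n m. if (vector [i, j, k, l] :: 4^4) $ n = m then 1 else 0) :: real^4^4)"
proof -
  define p where "p = (\<lambda>n. (vector [i, j, k, l] :: 4^4) $ n)"
  let ?A = "(\<chi> n m. if p n = m then 1 else 0) :: real^4^4"
  have "levi_civita_symbol i j k l = (if p permutes UNIV then of_int (sign p) else 0)"
    by (simp add: levi_civita_symbol_def Let_def p_def)
  also have "\<dots> = det ?A"
  proof (cases "p permutes UNIV")
    case True
    have "?A = (\<chi> n. (mat 1 :: real^4^4) $ p n)"
      by (simp add: mat_def vec_eq_iff)
    then show ?thesis
      using det_permute_rows[OF True, of "mat 1 :: real^4^4"] True by simp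
  next
    case False
    then have "\<not> inj p"
      using finite_UNIV_inj_surj[of p] unfolding permutes_univ bij_def by (metis finite injD surjD)
    then obtain m n where "m \<noteq> n" "p m = p n"
      unfolding inj_def by blast
    then have "det ?A = 0"
      by (intro det_identical_rows[of m n]) (auto simp: row_def vec_eq_iff)
    then show ?thesis using False by simp
  qed
  finally show ?thesis by (simp add: p_def)
qed

lemma sum_levi_civita_symbol:
  "(\<Sum>a\<in>UNIV. \<Sum>b\<in>UNIV. \<Sum>c\<in>UNIV. \<Sum>d\<in>UNIV. X a * Y b * Z c * W d * levi_civita_symbol a b c d)
    = det (vector [\<chi> m. X m, \<chi> m. Y m, \<chi> m. Z m, \<chi> m. W m])"
  by (simp add: sum_4 levi_civita_symbol_det det_4) (simp add: algebra_simps)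

text \<open>The symbol is a tensor density: the matrix of the selected columns of \<open>M\<close>
  factors into the selection matrix of the indices and the transpose of \<open>M\<close>.\<close>

lemma pull_levi_civita_symbol:
  "pull M levi_civita_symbol i j k l = det (\<chi> a i. M a i) * levi_civita_symbol i j k l"
proof -
  let ?v = "vector [i, j, k, l] :: 4^4"
  let ?A = "(\<chi> n m. if ?v $ n = m then 1 else 0) :: real^4^4"
  have "pull M levi_civita_symbol i j k l
     = det (vector [\<chi> m. M m i, \<chi> m. M m j, \<chi> m. M m k, \<chi> m. M m l] :: real^4^4)"
    unfolding pull_sum by (rule sum_levi_civita_symbol)
  also have "(vector [\<chi> m. M m i, \<chi> m. M m j, \<chi> m. M m k, \<chi> m. M m l] :: real^4^4)
     = ?A ** transpose (\<chi> a i. M a i)"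
    by (simp add: matrix_matrix_mult_def transpose_def vec_eq_iff forall_4 sum_mult_delta)
  also have "det \<dots> = det ?A * det (\<chi> a i. M a i)"
    by (simp add: det_mul det_transpose)
  finally show ?thesis by (simp only: levi_civita_symbol_det[of i j k l] mult.commute)
qed

section \<open>Frame components of curvature and covariant derivatives\<close>

lemma pull_add: "pull M (\<lambda>a b c d. S a b c d + T a b c d) i j k l = pull M S i j k l + pull M T i j k l"
  by (simp add: pull_sum sum.distrib distrib_left)

lemma pull_diff: "pull M (\<lambda>a b c d. S a b c d - T a b c d) i j k l = pull M S i j k l - pull M T i j k l"
  by (simp add: pull_sum sum_subtractf right_diff_distrib)

lemma pull_scale: "pull M (\<lambda>a b c d. u * T a b c d) i j k l = u * pull M T i j k l"
  by (simp add: pull_sum sum_distrib_left mult_ac)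

definition pull2 :: "(4 \<Rightarrow> 4 \<Rightarrow> real) \<Rightarrow> (4 \<Rightarrow> 4 \<Rightarrow> real) \<Rightarrow> 4 \<Rightarrow> 4 \<Rightarrow> real" where
  "pull2 M X i j = (\<Sum>a\<in>UNIV. \<Sum>b\<in>UNIV. M a i * M b j * X a b)"

text \<open>The correction terms of the Weyl tensor are products of metric and Ricci tensor with
  interleaved indices; separating the four sums lets each factor be pulled back alone.\<close>

lemma pull_pull2_ac: "pull M (\<lambda>a b c d. X a c * Y b d) i j k l = pull2 M X i k * pull2 M Y j l"
proof -
  have "pull M (\<lambda>a b c d. X a c * Y b d) i j k l
      = (\<Sum>a\<in>UNIV. \<Sum>b\<in>UNIV. \<Sum>c\<in>UNIV. \<Sum>d\<in>UNIV. (M a i * M c k * X a c) * (M b j * M d l * Y b d))"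
    by (simp add: pull_sum mult_ac)
  also have "\<dots> = (\<Sum>a\<in>UNIV. \<Sum>c\<in>UNIV. \<Sum>b\<in>UNIV. \<Sum>d\<in>UNIV. (M a i * M c k * X a c) * (M b j * M d l * Y b d))"
    by (rule sum.cong[OF refl sum.swap])
  finally show ?thesis
    by (simp only: pull2_def sum_distrib_left[symmetric] sum_distrib_right[symmetric])
qed

lemma pull_swap34: "pull M (\<lambda>a b c d. T a b d c) i j k l = pull M T i j l k"
  unfolding pull_sum
  by (rule sum.cong[OF refl], rule sum.cong[OF refl], subst sum.swap) (simp add: mult_ac)

lemma pull_pull2_ad: "pull M (\<lambda>a b c d. X a d * Y b c) i j k l = pull2 M X i l * pull2 M Y j k"
  using pull_swap34[of M "\<lambda>a b c d. X a c * Y b d" i j k l] by (simp add: pull_pull2_ac)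

lemma op_add:
  "op1 M (\<lambda>i j k l. S i j k l + T i j k l) = (\<lambda>i j k l. op1 M S i j k l + op1 M T i j k l)"
  "op2 M (\<lambda>i j k l. S i j k l + T i j k l) = (\<lambda>i j k l. op2 M S i j k l + op2 M T i j k l)"
  "op3 M (\<lambda>i j k l. S i j k l + T i j k l) = (\<lambda>i j k l. op3 M S i j k l + op3 M T i j k l)"
  "op4 M (\<lambda>i j k l. S i j k l + T i j k l) = (\<lambda>i j k l. op4 M S i j k l + op4 M T i j k l)"
  unfolding op_defs by (simp_all add: sum.distrib distrib_left)

lemma op_add_matrix:
  "op1 (\<lambda>a i. M a i + N a i) T i j k l = op1 M T i j k l + op1 N T i j k l"
  "op2 (\<lambda>a i. M a i + N a i) T i j k l = op2 M T i j k l + op2 N T i j k l"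
  "op3 (\<lambda>a i. M a i + N a i) T i j k l = op3 M T i j k l + op3 N T i j k l"
  "op4 (\<lambda>a i. M a i + N a i) T i j k l = op4 M T i j k l + op4 N T i j k l"
  unfolding op_defs by (simp_all add: sum.distrib distrib_right)

lemma has_partial_op:
  assumes "\<And>a i. has_partial n (\<lambda>z. M z a i) (dM a i) y"
    "\<And>i j k l. has_partial n (\<lambda>z. T z i j k l) (dT i j k l) y"
  shows "has_partial n (\<lambda>z. op1 (M z) (T z) i j k l) (op1 dM (T y) i j k l + op1 (M y) dT i j k l) y"
    "has_partial n (\<lambda>z. op2 (M z) (T z) i j k l) (op2 dM (T y) i j k l + op2 (M y) dT i j k l) y"
    "has_partial n (\<lambda>z. op3 (M z) (T z) i j k l) (op3 dM (T y) i j k l + op3 (M y) dT i j k l) y"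
    "has_partial n (\<lambda>z. op4 (M z) (T z) i j k l) (op4 dM (T y) i j k l + op4 (M y) dT i j k l) y"
  unfolding op_defs sum.distrib[symmetric] by (intro has_partial_sum has_partial_mult assms)+

text \<open>The four derivatives of \<open>M\<close> are kept in their slots because each of them
  meets the Christoffel term of the same slot in \<open>covd_frame\<close>.\<close>

lemma has_partial_pull:
  assumes "\<And>a i. has_partial n (\<lambda>z. M z a i) (dM a i) y"
    "\<And>i j k l. has_partial n (\<lambda>z. T z i j k l) (dT i j k l) y"
  shows "has_partial n (\<lambda>z. pull (M z) (T z) i j k l)
    (op1 dM (op2 (M y) (op3 (M y) (op4 (M y) (T y)))) i j k l
     + op1 (M y) (op2 dM (op3 (M y) (op4 (M y) (T y)))) i j k l
     + op1 (M y) (op2 (M y) (op3 dM (op4 (M y) (T y)))) i j k l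
     + op1 (M y) (op2 (M y) (op3 (M y) (op4 dM (T y)))) i j k l
     + pull (M y) dT i j k l) y"
proof -
  have 4: "has_partial n (\<lambda>z. op4 (M z) (T z) i j k l) (op4 dM (T y) i j k l + op4 (M y) dT i j k l) y"
      for i j k l
    by (rule has_partial_op assms)+
  have 3: "has_partial n (\<lambda>z. op3 (M z) (op4 (M z) (T z)) i j k l)
    (op3 dM (op4 (M y) (T y)) i j k l + op3 (M y) (\<lambda>i j k l. op4 dM (T y) i j k l + op4 (M y) dT i j k
        l) i j k l) y" for i j k l
    by (rule has_partial_op assms 4)+
  have 2: "has_partial n (\<lambda>z. op2 (M z) (op3 (M z) (op4 (M z) (T z))) i j k l)
    (op2 dM (op3 (M y) (op4 (M y) (T y))) i j k l + op2 (M y) (\<lambda>i j k l. op3 dM (op4 (M y) (T y)) i j k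
        l + op3 (M y) (\<lambda>i j k l. op4 dM (T y) i j k l + op4 (M y) dT i j k l) i j k l) i j k l) y" for i j k l
    by (rule has_partial_op assms 3)+
  show ?thesis
    using has_partial_op(1)[of n M dM y, OF assms(1) 2]
    by (simp add: pull_def op_add add.assoc)
qed

context orthonormal_frame
begin

lemma metric_pull2: "y \<in> U \<Longrightarrow> g y $ i $ j = pull2 (e y) (\<lambda>a b. if a = b then h a else 0) i j"
  by (simp add: metric_frame pull2_def if_distrib[of "\<lambda>u. _ * u"] mult_ac cong: if_cong)

text \<open>\<open>R\<close> holds the fully lowered frame components, \<open>curv\<close> the form
  with its first index raised; the two signs \<open>h a\<close> met on the way square to
  one.\<close>

lemma riemann_frame:
  assumes "y \<in> U" and R: "\<And>a b k l. curv y a b k l = h a * (\<Sum>c\<in>UNIV. \<Sum>d\<in>UNIV. R a b c d * (e y c k * e y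
      d l))"
  shows "riemann g y i j k l = pull (e y) R i j k l"
proof -
  have "riemann g y i j k l = (\<Sum>n\<in>UNIV. \<Sum>a\<in>UNIV. (h a * e y a i) * (e y a n * riemann_up g y n j k l))"
    unfolding riemann_def metric_frame[OF assms(1)] sum_distrib_right by (simp add: mult_ac)
  also have "\<dots> = (\<Sum>a\<in>UNIV. (h a * e y a i) * (\<Sum>n\<in>UNIV. e y a n * riemann_up g y n j k l))"
    unfolding sum_distrib_left by (rule sum.swap)
  also have "\<dots> = (\<Sum>a\<in>UNIV. (h a * e y a i) * (\<Sum>b\<in>UNIV. h a * (\<Sum>c\<in>UNIV. \<Sum>d\<in>UNIV. R a b c d * (e y c k *
      e y d l)) * e y b j))"
    by (simp only: e_riemann_up[OF assms(1)] R)
  also have "\<dots> = (\<Sum>a\<in>UNIV. (h a * h a) * (e y a i * (\<Sum>b\<in>UNIV. (\<Sum>c\<in>UNIV. \<Sum>d\<in>UNIV. R a b c d * (e y c k *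
      e y d l)) * e y b j)))"
    by (simp add: sum_distrib_left mult_ac)
  finally show ?thesis
    by (simp add: h_square pull_sum sum_distrib_left sum_distrib_right mult_ac)
qed

lemma ricci_frame:
  assumes "y \<in> U" and R: "\<And>a b k l. curv y a b k l = h a * (\<Sum>c\<in>UNIV. \<Sum>d\<in>UNIV. R a b c d * (e y c k * e y
      d l))"
  shows "ricci g y i j = pull2 (e y) (\<lambda>b d. \<Sum>a\<in>UNIV. h a * R a b a d) i j"
proof -
  have up: "riemann_up g y n i n j = (\<Sum>a\<in>UNIV. E y n a * (\<Sum>b\<in>UNIV. curv y a b n j * e y b i))" for n
    unfolding e_riemann_up[OF assms(1), symmetric] contract_E_e[OF assms(1)] ..
  have Ee: "(\<Sum>n\<in>UNIV. e y c n * E y n a) = (if c = a then 1 else 0)" for a c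
    by (rule dual_frame[OF assms(1)])
  \<comment> \<open>The exchanges below move the coordinate index \<open>n\<close> innermost, where
    it contracts the coframe with the frame and thereby identifies \<open>c\<close> with
    \<open>a\<close>.\<close>
  have "ricci g y i j = (\<Sum>n\<in>UNIV. \<Sum>a\<in>UNIV. \<Sum>b\<in>UNIV. \<Sum>c\<in>UNIV. \<Sum>d\<in>UNIV.
      (e y b i * e y d j * (h a * R a b c d)) * (e y c n * E y n a))"
    by (simp add: ricci_def up R sum_distrib_left sum_distrib_right mult_ac)
  also have "\<dots> = (\<Sum>a\<in>UNIV. \<Sum>n\<in>UNIV. \<Sum>b\<in>UNIV. \<Sum>c\<in>UNIV. \<Sum>d\<in>UNIV.
      (e y b i * e y d j * (h a * R a b c d)) * (e y c n * E y n a))"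
    by (rule sum.swap)
  also have "\<dots> = (\<Sum>a\<in>UNIV. \<Sum>b\<in>UNIV. \<Sum>n\<in>UNIV. \<Sum>c\<in>UNIV. \<Sum>d\<in>UNIV.
      (e y b i * e y d j * (h a * R a b c d)) * (e y c n * E y n a))"
    by (rule sum.cong[OF refl], rule sum.swap)
  also have "\<dots> = (\<Sum>a\<in>UNIV. \<Sum>b\<in>UNIV. \<Sum>c\<in>UNIV. \<Sum>n\<in>UNIV. \<Sum>d\<in>UNIV.
      (e y b i * e y d j * (h a * R a b c d)) * (e y c n * E y n a))"
    by (rule sum.cong[OF refl], rule sum.cong[OF refl], rule sum.swap)
  also have "\<dots> = (\<Sum>a\<in>UNIV. \<Sum>b\<in>UNIV. \<Sum>c\<in>UNIV. \<Sum>d\<in>UNIV. \<Sum>n\<in>UNIV.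
      (e y b i * e y d j * (h a * R a b c d)) * (e y c n * E y n a))"
    by (rule sum.cong[OF refl], rule sum.cong[OF refl], rule sum.cong[OF refl], rule sum.swap)
  also have "\<dots> = (\<Sum>a\<in>UNIV. \<Sum>b\<in>UNIV. \<Sum>d\<in>UNIV. e y b i * e y d j * (h a * R a b a d))"
    by (simp add: sum_distrib_left[symmetric] Ee sum_4) 
  also have "\<dots> = (\<Sum>b\<in>UNIV. \<Sum>a\<in>UNIV. \<Sum>d\<in>UNIV. e y b i * e y d j * (h a * R a b a d))"
    by (rule sum.swap)
  also have "\<dots> = (\<Sum>b\<in>UNIV. \<Sum>d\<in>UNIV. \<Sum>a\<in>UNIV. e y b i * e y d j * (h a * R a b a d))"
    by (rule sum.cong[OF refl], rule sum.swap)
  finally show ?thesis by (simp add: pull2_def sum_distrib_left)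
qed

lemma trace_pull2:
  assumes "y \<in> U"
  shows "(\<Sum>i\<in>UNIV. \<Sum>j\<in>UNIV. inv_metric g y i j * pull2 (e y) X i j) = (\<Sum>a\<in>UNIV. h a * X a a)"
proof -
  have "(\<Sum>j\<in>UNIV. inv_metric g y i j * pull2 (e y) X i j)
      = (\<Sum>b\<in>UNIV. E y i b * (h b * (\<Sum>a\<in>UNIV. e y a i * X a b)))" for i
  proof -
    have "pull2 (e y) X i j = (\<Sum>b\<in>UNIV. h b * (e y b j * (h b * (\<Sum>a\<in>UNIV. e y a i * X a b))))" for j
    proof -
      have "pull2 (e y) X i j = (\<Sum>b\<in>UNIV. \<Sum>a\<in>UNIV. e y a i * e y b j * X a b)"
        unfolding pull2_def by (rule sum.swap)
      also have "\<dots> = (\<Sum>b\<in>UNIV. (h b * h b) * (e y b j * (\<Sum>a\<in>UNIV. e y a i * X a b)))"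
        by (simp add: h_square sum_distrib_left mult_ac)
      finally show ?thesis by (simp add: mult_ac)
    qed
    then show ?thesis by (simp only: contract_metric_E[OF assms])
  qed
  then have "(\<Sum>i\<in>UNIV. \<Sum>j\<in>UNIV. inv_metric g y i j * pull2 (e y) X i j)
      = (\<Sum>i\<in>UNIV. \<Sum>b\<in>UNIV. \<Sum>a\<in>UNIV. (h b * X a b) * (e y a i * E y i b))"
    by (simp add: sum_distrib_left mult_ac)
  also have "\<dots> = (\<Sum>b\<in>UNIV. \<Sum>i\<in>UNIV. \<Sum>a\<in>UNIV. (h b * X a b) * (e y a i * E y i b))"
    by (rule sum.swap)
  also have "\<dots> = (\<Sum>b\<in>UNIV. \<Sum>a\<in>UNIV. \<Sum>i\<in>UNIV. (h b * X a b) * (e y a i * E y i b))"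
    by (rule sum.cong[OF refl], rule sum.swap)
  finally show ?thesis
    by (simp add: sum_distrib_left[symmetric] dual_frame[OF assms] sum_4)
qed

definition weyl_part :: "tensor4 \<Rightarrow> tensor4" where
  "weyl_part R a b c d =
    (let h2 = (\<lambda>a b. if a = b then h a else 0); Ric = (\<lambda>b d. \<Sum>a\<in>UNIV. h a * R a b a d)
     in R a b c d - 1/2 * (h2 a c * Ric b d - h2 a d * Ric b c + h2 b d * Ric a c - h2 b c * Ric a d)
        + (\<Sum>a\<in>UNIV. h a * Ric a a) / 6 * (h2 a c * h2 b d - h2 a d * h2 b c))"

lemma weyl_frame:
  assumes "y \<in> U" and R: "\<And>a b k l. curv y a b k l = h a * (\<Sum>c\<in>UNIV. \<Sum>d\<in>UNIV. R a b c d * (e y c k * e y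
      d l))"
  shows "weyl g y = pull (e y) (weyl_part R)"
proof (intro ext)
  fix i j k l
  let ?h2 = "\<lambda>a b. if a = b then h a else 0"
  let ?Ric = "\<lambda>b d. \<Sum>a\<in>UNIV. h a * R a b a d"
  have "scalar_curvature g y = (\<Sum>a\<in>UNIV. h a * ?Ric a a)"
    by (simp only: scalar_curvature_def ricci_frame[OF assms] trace_pull2[OF assms(1)])
  moreover have "pull (e y) (weyl_part R) i j k l = pull (e y) R i j k l
     - 1/2 * (pull2 (e y) ?h2 i k * pull2 (e y) ?Ric j l - pull2 (e y) ?h2 i l * pull2 (e y) ?Ric j k
            + pull2 (e y) ?h2 j l * pull2 (e y) ?Ric i k - pull2 (e y) ?h2 j k * pull2 (e y) ?Ric i l)
     + (\<Sum>a\<in>UNIV. h a * ?Ric a a) / 6 * (pull2 (e y) ?h2 i k * pull2 (e y) ?h2 j l - pull2 (e y) ?h2 i l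
         * pull2 (e y) ?h2 j k)"
    unfolding weyl_part_def Let_def pull_add pull_diff pull_scale
    using pull_pull2_ac[of "e y" ?Ric ?h2 i j k l] pull_pull2_ad[of "e y" ?Ric ?h2 i j k l]
    by (simp only: pull_pull2_ac pull_pull2_ad mult.commute)
  ultimately show "weyl g y i j k l = pull (e y) (weyl_part R) i j k l"
    by (simp only: weyl_def metric_pull2[OF assms(1)] riemann_frame[OF assms] ricci_frame[OF assms])
qed

definition frame_covd :: "real^4 \<Rightarrow> 4 \<Rightarrow> tensor4 \<Rightarrow> tensor4 \<Rightarrow> tensor4" where
  "frame_covd y n dT T a b c d = dT a b c d
     - op1 (\<lambda>m a. w y n m a) T a b c d - op2 (\<lambda>m a. w y n m a) T a b c d
     - op3 (\<lambda>m a. w y n m a) T a b c d - op4 (\<lambda>m a. w y n m a) T a b c d"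

lemma covd_frame:
  assumes "y \<in> U" and T: "\<And>z. z \<in> U \<Longrightarrow> T z = pull (e z) (S z)"
    and S: "\<And>a b c d. has_partial n (\<lambda>z. S z a b c d) (dS a b c d) y"
  shows "covd g T y n = pull (e y) (frame_covd y n dS (S y))"
proof (intro ext)
  fix i j k l
  let ?e = "e y" and ?de = "\<lambda>a i. partial n (\<lambda>z. e z a i) y" and ?w = "\<lambda>m a. w y n m a"
    and ?G = "\<lambda>m i. christoffel g y m n i" and ?S = "S y"
  have dT: "partial n (\<lambda>z. T z i j k l) y =
     op1 ?de (op2 ?e (op3 ?e (op4 ?e ?S))) i j k l + op1 ?e (op2 ?de (op3 ?e (op4 ?e ?S))) i j k l
     + op1 ?e (op2 ?e (op3 ?de (op4 ?e ?S))) i j k l + op1 ?e (op2 ?e (op3 ?e (op4 ?de ?S))) i j k l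
     + pull ?e dS i j k l"
    by (rule has_partial_partial, rule has_partial_cong[OF open_U assms(1) _ has_partial_pull[OF _ S]])
      (use pdiff_e[OF assms(1)] T in \<open>auto simp: pdiff_def\<close>)
  \<comment> \<open>In matrix form \<open>e \<Gamma> = de + w e\<close>. The part \<open>de\<close>
    cancels the derivative of the coframe in the same slot, and \<open>w e\<close> survives as a
    rotation of the frame.\<close>
  have "mmul ?e ?G = (\<lambda>a i. ?de a i + mmul ?w ?e a i)"
    by (intro ext) (simp add: mmul_def e_christoffel[OF assms(1)] conn_coframe_def)
  then have G: "op1 ?G (op1 ?e X) i j k l = op1 ?de X i j k l + op1 ?e (op1 ?w X) i j k l"
    "op2 ?G (op2 ?e X) i j k l = op2 ?de X i j k l + op2 ?e (op2 ?w X) i j k l"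
    "op3 ?G (op3 ?e X) i j k l = op3 ?de X i j k l + op3 ?e (op3 ?w X) i j k l"
    "op4 ?G (op4 ?e X) i j k l = op4 ?de X i j k l + op4 ?e (op4 ?w X) i j k l" for X i j k l
    by (simp_all add: op_mult op_add_matrix)
  have "covd g T y n i j k l = partial n (\<lambda>z. T z i j k l) y - op1 ?G (pull ?e ?S) i j k l
     - op2 ?G (pull ?e ?S) i j k l - op3 ?G (pull ?e ?S) i j k l - op4 ?G (pull ?e ?S) i j k l"
    by (simp add: covd_def op_defs T[OF assms(1)])
  also have "op1 ?G (pull ?e ?S) i j k l
      = op1 ?de (op2 ?e (op3 ?e (op4 ?e ?S))) i j k l + pull ?e (op1 ?w ?S) i j k l"
    by (simp add: pull_def G op_commute)
  \<comment> \<open>\<open>G\<close> speaks of components, so the operators on the earlier slots are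
    opened as sums before it can be applied in a later slot.\<close>
  also have "op2 ?G (pull ?e ?S) i j k l
      = op1 ?e (op2 ?de (op3 ?e (op4 ?e ?S))) i j k l + pull ?e (op2 ?w ?S) i j k l"
    by (simp add: pull_def op_commute(1) op1_def[of ?e] G sum.distrib distrib_left) (simp add: op_commute)
  also have "op3 ?G (pull ?e ?S) i j k l
      = op1 ?e (op2 ?e (op3 ?de (op4 ?e ?S))) i j k l + pull ?e (op3 ?w ?S) i j k l"
    by (simp add: pull_def op_commute(2,4) op1_def[of ?e] op2_def[of ?e] G sum.distrib distrib_left)
        (simp add: op_commute)
  also have "op4 ?G (pull ?e ?S) i j k l
      = op1 ?e (op2 ?e (op3 ?e (op4 ?de ?S))) i j k l + pull ?e (op4 ?w ?S) i j k l"
    by (simp add: pull_def op_commute(3,5,6) op1_def[of ?e] op2_def[of ?e] op3_def[of ?e] G sum.distrib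
        distrib_left)
  finally show "covd g T y n i j k l = pull ?e (frame_covd y n dS ?S) i j k l"
    by (simp add: dT frame_covd_def[abs_def] pull_diff)
qed

end

section \<open>Contractions and duals in the frame\<close>

text \<open>In an orthonormal frame the volume form is the bare symbol up to orientation. The
  orientation enters separately, as \<open>s\<close> in \<open>dual_weyl_frame\<close>.\<close>

definition dualize :: "(4 \<Rightarrow> real) \<Rightarrow> tensor4 \<Rightarrow> tensor4" where
  "dualize h T i j k l = 1/2 * (\<Sum>u\<in>UNIV. \<Sum>v\<in>UNIV. levi_civita_symbol i j u v * (h u * (h v * T u v k l)))"

definition pair_comp :: "tensor4 \<Rightarrow> tensor4 \<Rightarrow> tensor4" where
  "pair_comp S T i j k l = (\<Sum>u\<in>UNIV. \<Sum>v\<in>UNIV. S i j u v * T u v k l)"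

lemma sum_UNIV_3:
  "(\<Sum>i\<in>UNIV. \<Sum>j\<in>UNIV. \<Sum>a\<in>UNIV. f i j a) = (\<Sum>(i, j, a)\<in>UNIV. f i j a)"
  by (simp add: sum.cartesian_product)

lemma pair_comp_op:
  "pair_comp (op1 M S) T = op1 M (pair_comp S T)" "pair_comp (op2 M S) T = op2 M (pair_comp S T)"
  "pair_comp S (op3 M T) = op3 M (pair_comp S T)" "pair_comp S (op4 M T) = op4 M (pair_comp S T)"
  "pair_comp (op3 M S) T = pair_comp S (op1 (\<lambda>i a. M a i) T)"
  "pair_comp (op4 M S) T = pair_comp S (op2 (\<lambda>i a. M a i) T)"
proof -
  note rules = sum.reindex_bij_witness[where i = "\<lambda>(i, j, a). (j, a, i)" and j = "\<lambda>(i, j, a). (a, i, j)"]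
    sum.reindex_bij_witness[where i = "\<lambda>(i, j, a). (a, j, i)" and j = "\<lambda>(i, j, a). (a, j, i)"]
    sum.reindex_bij_witness[where i = "\<lambda>(i, j, a). (i, a, j)" and j = "\<lambda>(i, j, a). (i, a, j)"]
  show "pair_comp (op1 M S) T = op1 M (pair_comp S T)" "pair_comp (op2 M S) T = op2 M (pair_comp S T)"
    "pair_comp S (op3 M T) = op3 M (pair_comp S T)" "pair_comp S (op4 M T) = op4 M (pair_comp S T)"
    by (intro ext; unfold pair_comp_def op_defs sum_distrib_left sum_distrib_right sum_UNIV_3;
        rule rules(1); auto)+
  show "pair_comp (op3 M S) T = pair_comp S (op1 (\<lambda>i a. M a i) T)"
    by (intro ext; unfold pair_comp_def op_defs sum_distrib_left sum_distrib_right sum_UNIV_3;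
        rule rules(2); auto)
  show "pair_comp (op4 M S) T = pair_comp S (op2 (\<lambda>i a. M a i) T)"
    by (intro ext; unfold pair_comp_def op_defs sum_distrib_left sum_distrib_right sum_UNIV_3;
        rule rules(3); auto)
qed

definition frame_prod :: "(4 \<Rightarrow> real) \<Rightarrow> tensor4 \<Rightarrow> tensor4 \<Rightarrow> real" where
  "frame_prod h S T = (\<Sum>a\<in>UNIV. \<Sum>b\<in>UNIV. \<Sum>c\<in>UNIV. \<Sum>d\<in>UNIV. S a b c d * (h a * (h b * (h c * (h d * T a b
      c d)))))"

lemma frame_prod_add: "frame_prod h (\<lambda>a b c d. R a b c d + S a b c d) T = frame_prod h R T + frame_prod h S T"
  by (simp add: frame_prod_def distrib_right sum.distrib)

lemma frame_prod_scale: "frame_prod h (\<lambda>a b c d. u * S a b c d) T = u * frame_prod h S T"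
  by (simp add: frame_prod_def sum_distrib_left mult.assoc)

lemma frame_prod_sum_left:
  "frame_prod h (\<lambda>a b c d. \<Sum>m\<in>UNIV. u m * S m a b c d) T = (\<Sum>m\<in>UNIV. u m * frame_prod h (S m) T)" for u
      :: "4 \<Rightarrow> real"
  by (simp add: sum_4 frame_prod_add frame_prod_scale)

lemma frame_prod_commute: "frame_prod h S T = frame_prod h T S"
  by (simp add: frame_prod_def mult_ac)

lemma frame_prod_sum_right:
  "frame_prod h T (\<lambda>a b c d. \<Sum>m\<in>UNIV. u m * S m a b c d) = (\<Sum>m\<in>UNIV. u m * frame_prod h T (S m))" for u
      :: "4 \<Rightarrow> real"
  by (simp add: frame_prod_commute[of h T] frame_prod_sum_left)

text \<open>The derivation that extends a matrix to tensors of rank four. With a connection matrix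
  for \<open>M\<close> it is the rotation term of the covariant derivative.\<close>

definition act :: "(4 \<Rightarrow> 4 \<Rightarrow> real) \<Rightarrow> tensor4 \<Rightarrow> tensor4" where
  "act M T a b c d = op1 M T a b c d + op2 M T a b c d + op3 M T a b c d + op4 M T a b c d"

lemma act_sum:
  "(\<Sum>m\<in>UNIV. u m * act (M m) T a b c d) = act (\<lambda>i j. \<Sum>m\<in>UNIV. u m * M m i j) T a b c d" for u :: "4 \<Rightarrow> real"
  unfolding sum_4[of "\<lambda>m. u m * _ m"] act_def op_defs
  by (simp add: distrib_right distrib_left sum.distrib sum_distrib_left mult.assoc)

context orthonormal_frame
begin

lemma mmul_e_inv: "y \<in> U \<Longrightarrow> mmul (e y) (\<lambda>a i. inv_metric g y i a) = (\<lambda>a i. h a * E y i a)"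
proof (intro ext)
  fix a i assume y: "y \<in> U"
  have "mmul (e y) (\<lambda>a i. inv_metric g y i a) a i = (\<Sum>j\<in>UNIV. e y a j * (\<Sum>b\<in>UNIV. E y j b * (h b * E y i b)))"
    by (simp add: mmul_def inv_metric_frame[OF y] mult_ac)
  then show "mmul (e y) (\<lambda>a i. inv_metric g y i a) a i = h a * E y i a"
    by (simp only: contract_e_E[OF y])
qed

lemma mmul_e_inv_e:
  "y \<in> U \<Longrightarrow> mmul (mmul (e y) (\<lambda>a i. inv_metric g y i a)) (\<lambda>i a. e y a i) = (\<lambda>a b. if a = b then h a else 0)"
proof (intro ext)
  fix a b assume y: "y \<in> U"
  have "mmul (\<lambda>a i. h a * E y i a) (\<lambda>i a. e y a i) a b = h a * (\<Sum>i\<in>UNIV. e y b i * E y i a)"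
    by (simp add: mmul_def sum_distrib_left mult_ac)
  then show "mmul (mmul (e y) (\<lambda>a i. inv_metric g y i a)) (\<lambda>i a. e y a i) a b = (if a = b then h a else 0)"
    unfolding mmul_e_inv[OF y] dual_frame[OF y] by auto
qed

text \<open>Adjointness moves the outer \<open>pull\<close> to the other factor, where coframe,
  inverse metric and transposed coframe collapse to the diagonal matrix of \<open>h\<close>.\<close>

lemma contract4_frame:
  assumes "y \<in> U"
  shows "contract4 g y (pull (e y) S) (pull (e y) T) = frame_prod h S T"
proof -
  have "contract4 g y (pull (e y) S) (pull (e y) T)
      = tensor_prod (pull (e y) S) (pull (\<lambda>a i. inv_metric g y i a) (pull (e y) T))"
    unfolding contract4_def tensor_prod_def raise4_def pull_sum[of "\<lambda>a i. inv_metric g y i a"] ..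
  also have "\<dots> = tensor_prod S (pull (\<lambda>a b. if a = b then h a else 0) T)"
    by (simp add: tensor_prod_pull pull_pull mmul_e_inv_e[OF assms])
  finally show ?thesis
    by (simp add: tensor_prod_def frame_prod_def pull_def op_diag[of _ h])
qed

text \<open>The signature contributes a factor of modulus one, so the square root in
  \<open>levi_civita\<close> becomes the modulus of the coframe determinant.\<close>

lemma det_metric:
  assumes "y \<in> U"
  shows "\<bar>det (g y)\<bar> = (det (\<chi> a i. e y a i))\<^sup>2"
proof -
  let ?e = "(\<chi> a i. e y a i) :: real^4^4" and ?h = "(\<chi> a b. if a = b then h a else 0) :: real^4^4"
  have "g y = transpose ?e ** (?h ** ?e)"
    by (simp add: vec_eq_iff matrix_matrix_mult_def transpose_def metric_frame[OF assms]
        if_distrib[of "\<lambda>u. u * _"] if_distrib[of "\<lambda>u. _ * u"] mult_ac cong: if_cong)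
  then have "det (g y) = det ?h * (det ?e)\<^sup>2"
    by (simp add: det_mul det_transpose power2_eq_square)
  moreover have "\<bar>h a\<bar> = 1" for a
    using h_square[of a] abs_square_eq_1[of "h a"] by (simp add: power2_eq_square)
  then have "\<bar>det ?h\<bar> = 1"
    by (simp add: det_diagonal abs_prod)
  ultimately show ?thesis by (simp add: abs_mult)
qed

text \<open>The volume form contains the modulus of the coframe determinant while the pulled back
  symbol contains the determinant itself; \<open>s\<close> is the orientation sign between them. The
  two inverse metrics collapse to factors \<open>h\<close>.\<close>

lemma dual_weyl_frame:
  assumes "y \<in> U" and W: "weyl g y = pull (e y) T"
    and s: "s * det (\<chi> a i. e y a i) = \<bar>det (\<chi> a i. e y a i)\<bar>"
  shows "dual_weyl g y = pull (e y) (\<lambda>a b c d. s * dualize h T a b c d)"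
proof (intro ext)
  fix i j k l
  let ?e = "e y" and ?g = "\<lambda>a i. inv_metric g y i a" and ?h = "\<lambda>a b. if a = b then h a else 0"
  have lc: "levi_civita g y i j u v = s * pull ?e levi_civita_symbol i j u v" for i j u v
    by (simp add: levi_civita_def pull_levi_civita_symbol det_metric[OF assms(1)] s[symmetric])
  have "dual_weyl g y i j k l = s * (1/2 * pair_comp (pull ?e levi_civita_symbol)
      (op1 ?g (op2 ?g (pull ?e T))) i j k l)"
    by (simp add: dual_weyl_def lc W pair_comp_def op_defs sum_distrib_left mult_ac)
  also have "pair_comp (pull ?e levi_civita_symbol) (op1 ?g (op2 ?g (pull ?e T)))
      = pull ?e (pair_comp levi_civita_symbol (op1 ?h (op2 ?h T)))"
  proof -
    have "op1 ?g (op2 ?g (pull ?e T)) = op3 ?e (op4 ?e (op1 (mmul ?e ?g) (op2 (mmul ?e ?g) T)))"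
      by (simp add: pull_def op_commute op_mult)
    then show ?thesis
      by (simp add: pull_def pair_comp_op(1-4))
        (simp add: pair_comp_op(5,6) op_commute op_mult mmul_e_inv_e[OF assms(1)])
  qed
  finally have "dual_weyl g y i j k l = pull ?e (\<lambda>a b c d. s * (1/2 * pair_comp levi_civita_symbol
      (op1 ?h (op2 ?h T)) a b c d)) i j k l"
    by (simp only: pull_scale)
  moreover have "1/2 * pair_comp levi_civita_symbol (op1 ?h (op2 ?h T)) a b c d = dualize h T a b c d"
      for a b c d
    by (simp add: dualize_def pair_comp_def op_diag[of _ h])
  ultimately show "dual_weyl g y i j k l = pull ?e (\<lambda>a b c d. s * dualize h T a b c d) i j k l"
    by simp
qed

lemma trace_inv_metric:
  assumes "y \<in> U"
  shows "(\<Sum>m\<in>UNIV. \<Sum>n\<in>UNIV. inv_metric g y m n * f m n)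
    = (\<Sum>b\<in>UNIV. h b * (\<Sum>m\<in>UNIV. E y m b * (\<Sum>n\<in>UNIV. E y n b * f m n)))"
proof -
  have "(\<Sum>m\<in>UNIV. \<Sum>n\<in>UNIV. inv_metric g y m n * f m n)
      = (\<Sum>m\<in>UNIV. \<Sum>n\<in>UNIV. \<Sum>b\<in>UNIV. h b * (E y m b * (E y n b * f m n)))"
    unfolding inv_metric_frame[OF assms] sum_distrib_right by (simp add: mult_ac)
  also have "\<dots> = (\<Sum>m\<in>UNIV. \<Sum>b\<in>UNIV. \<Sum>n\<in>UNIV. h b * (E y m b * (E y n b * f m n)))"
    by (rule sum.cong[OF refl], rule sum.swap)
  also have "\<dots> = (\<Sum>b\<in>UNIV. \<Sum>m\<in>UNIV. \<Sum>n\<in>UNIV. h b * (E y m b * (E y n b * f m n)))"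
    by (rule sum.swap)
  finally show ?thesis by (simp only: sum_distrib_left)
qed

definition Dframe :: "real^4 \<Rightarrow> 4 \<Rightarrow> (real^4 \<Rightarrow> real) \<Rightarrow> real" where
  "Dframe y b f = (\<Sum>m\<in>UNIV. E y m b * partial m f y)"

definition rot :: "real^4 \<Rightarrow> 4 \<Rightarrow> 4 \<Rightarrow> 4 \<Rightarrow> real" where
  "rot y f a b = (\<Sum>m\<in>UNIV. E y m f * w y m a b)"

definition nabla :: "real^4 \<Rightarrow> 4 \<Rightarrow> (real^4 \<Rightarrow> tensor4) \<Rightarrow> tensor4" where
  "nabla y f S a b c d = Dframe y f (\<lambda>z. S z a b c d) - act (rot y f) (S y) a b c d"

lemma grad_grad_frame:
  assumes "y \<in> U"
  shows "(\<Sum>m\<in>UNIV. \<Sum>n\<in>UNIV. inv_metric g y m n * partial m f y * partial n f y)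
      = (\<Sum>b\<in>UNIV. h b * (Dframe y b f)\<^sup>2)"
  using trace_inv_metric[OF assms, of "\<lambda>m n. partial m f y * partial n f y"]
  by (simp add: Dframe_def power2_eq_square sum_distrib_left sum_distrib_right mult_ac)

lemma covd_covd_frame:
  assumes "y \<in> U"
    and S: "\<And>z. z \<in> U \<Longrightarrow> T z = pull (e z) (S z)" "\<And>n a b c d. pdiff n (\<lambda>z. S z a b c d) y"
    and S': "\<And>z. z \<in> U \<Longrightarrow> T' z = pull (e z) (S' z)" "\<And>n a b c d. pdiff n (\<lambda>z. S' z a b c d) y"
  shows "(\<Sum>m\<in>UNIV. \<Sum>n\<in>UNIV. inv_metric g y m n * contract4 g y (covd g T y m) (covd g T' y n))
    = (\<Sum>b\<in>UNIV. h b * frame_prod h (nabla y b S) (nabla y b S'))"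
proof -
  let ?N = "\<lambda>S n. frame_covd y n (\<lambda>a b c d. partial n (\<lambda>z. S z a b c d) y) (S y)"
  have N: "nabla y b S = (\<lambda>a c d f. \<Sum>n\<in>UNIV. E y n b * ?N S n a c d f)" for b S
  proof (intro ext)
    fix a c d f
    have "?N S n a c d f = partial n (\<lambda>z. S z a c d f) y - act (w y n) (S y) a c d f" for n
      by (simp add: frame_covd_def act_def)
    moreover have "rot y b = (\<lambda>i j. \<Sum>m\<in>UNIV. E y m b * w y m i j)"
      by (intro ext) (rule rot_def)
    ultimately show "nabla y b S a c d f = (\<Sum>n\<in>UNIV. E y n b * ?N S n a c d f)"
      by (simp add: nabla_def Dframe_def act_sum[symmetric] right_diff_distrib sum_subtractf)
  qed
  have "covd g T y n = pull (e y) (?N S n)" "covd g T' y n = pull (e y) (?N S' n)" for n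
    by (rule covd_frame[OF assms(1)]; use S S' in \<open>simp add: pdiff_def\<close>)+
  then have "contract4 g y (covd g T y m) (covd g T' y n) = frame_prod h (?N S m) (?N S' n)" for m n
    by (simp add: contract4_frame[OF assms(1)])
  then show ?thesis
    by (simp add: trace_inv_metric[OF assms(1)] N frame_prod_sum_left frame_prod_sum_right)
qed

end

section \<open>Weyl tensors of type D\<close>

definition bivec :: "4 \<Rightarrow> 4 \<Rightarrow> 4 \<Rightarrow> 4 \<Rightarrow> real" where
  "bivec m n a b = (if a = m then 1 else 0) * (if b = n then 1 else 0)
     - (if a = n then 1 else 0) * (if b = m then 1 else 0)"

lemma bivec_swap: "bivec n m a b = - bivec m n a b" "bivec m n b a = - bivec m n a b"
  "bivec m m a b = 0"
  by (auto simp: bivec_def)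

text \<open>Antisymmetry reduces all scalar products to ordered index pairs, on which the basis
  bivectors are orthonormal unit vectors; this table replaces case distinctions over
  indices.\<close>

lemma bivec_pairs:
  "\<forall>(m, n) \<in> {(1, 2), (1, 3), (1, 4), (2, 3), (2, 4), (3, 4)}.
   \<forall>(a, b) \<in> {(1, 2), (1, 3), (1, 4), (2, 3), (2, 4), (3, 4)}.
     bivec m n a b = (if m = a \<and> n = b then 1 else 0)"
  by (simp add: bivec_def)

lemmas bivec_eval = bivec_pairs[simplified]

text \<open>
  The Weyl tensor of type D with \<open>\<Psi>\<^sub>2 = A + \<i> B\<close> in a frame adapted to its principal null directions,
  which lie in the plane of the first two frame vectors. The sign \<open>\<epsilon>\<close> tells which of these two is timelike:
  the first one for \<open>\<epsilon> = 1\<close>, the second one for \<open>\<epsilon> = -1\<close>.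
\<close>

definition typeD :: "real \<Rightarrow> real \<Rightarrow> real \<Rightarrow> tensor4" where
  "typeD \<epsilon> A B a b c d =
     2 * A * (bivec 1 2 a b * bivec 1 2 c d - bivec 3 4 a b * bivec 3 4 c d)
   + \<epsilon> * A * (bivec 2 3 a b * bivec 2 3 c d + bivec 2 4 a b * bivec 2 4 c d
              - bivec 1 3 a b * bivec 1 3 c d - bivec 1 4 a b * bivec 1 4 c d)
   + 2 * B * (bivec 1 2 a b * bivec 3 4 c d + bivec 3 4 a b * bivec 1 2 c d)
   + B * (bivec 1 3 a b * bivec 2 4 c d + bivec 2 4 a b * bivec 1 3 c d
          - bivec 1 4 a b * bivec 2 3 c d - bivec 2 3 a b * bivec 1 4 c d)"

definition eta :: "real \<Rightarrow> 4 \<Rightarrow> real" where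
  "eta \<epsilon> a = (if a = 1 then - \<epsilon> else if a = 2 then \<epsilon> else 1)"

text \<open>An element of the Lie algebra of the orthogonal group of \<open>eta \<epsilon>\<close>.
  The six entries above the diagonal determine the others by antisymmetry after lowering the first
  index.\<close>

definition rotation :: "real \<Rightarrow> real \<Rightarrow> real \<Rightarrow> real \<Rightarrow> real \<Rightarrow> real \<Rightarrow> real \<Rightarrow> 4 \<Rightarrow> 4 \<Rightarrow> real" where
  "rotation \<epsilon> w12 w13 w14 w23 w24 w34 a b = (vector [
     vector [0, w12, w13, w14],
     vector [w12, 0, w23, w24],
     vector [\<epsilon> * w13, - \<epsilon> * w23, 0, w34],
     vector [\<epsilon> * w14, - \<epsilon> * w24, - w34, 0]] :: real^4^4) $ a $ b"

lemma rotation_eta: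
  "\<epsilon> * \<epsilon> = 1 \<Longrightarrow> eta \<epsilon> a * rotation \<epsilon> w12 w13 w14 w23 w24 w34 a b = - (eta \<epsilon> b * rotation \<epsilon> w12 w13 w14
      w23 w24 w34 b a)"
  using exhaust_4[of a] exhaust_4[of b] by (auto simp: eta_def rotation_def mult.assoc[symmetric])

definition pair_antisym :: "tensor4 \<Rightarrow> bool" where
  "pair_antisym T \<longleftrightarrow> (\<forall>a b c d. T b a c d = - T a b c d \<and> T a b d c = - T a b c d)"

lemma pair_antisym_bivec: "pair_antisym (\<lambda>a b c d. bivec m n a b * bivec p q c d)"
  unfolding pair_antisym_def
proof (intro allI conjI)
  fix a b c d
  show "bivec m n b a * bivec p q c d = - (bivec m n a b * bivec p q c d)"
    by (subst bivec_swap(2)) simp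
  show "bivec m n a b * bivec p q d c = - (bivec m n a b * bivec p q c d)"
    by (subst bivec_swap(2)[of p q]) simp
qed

lemma pair_antisym_linear:
  "pair_antisym S \<Longrightarrow> pair_antisym T \<Longrightarrow> pair_antisym (\<lambda>a b c d. S a b c d + T a b c d)"
  "pair_antisym S \<Longrightarrow> pair_antisym T \<Longrightarrow> pair_antisym (\<lambda>a b c d. S a b c d - T a b c d)"
  "pair_antisym T \<Longrightarrow> pair_antisym (\<lambda>a b c d. u * T a b c d)"
proof -
  assume T: "pair_antisym T"
  have T': "T b a c d = - T a b c d" "T a b d c = - T a b c d" for a b c d
    using T unfolding pair_antisym_def by blast+
  show "pair_antisym (\<lambda>a b c d. u * T a b c d)"
    unfolding pair_antisym_def mult_minus_right[symmetric]
    by (intro allI conjI arg_cong[of _ _ "(*) u"] T')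
  assume S: "pair_antisym S"
  have S': "S b a c d = - S a b c d" "S a b d c = - S a b c d" for a b c d
    using S unfolding pair_antisym_def by blast+
  show "pair_antisym (\<lambda>a b c d. S a b c d + T a b c d)"
    unfolding pair_antisym_def minus_add_distrib
    by (intro allI conjI arg_cong2[of _ _ _ _ "(+)"] S' T')
  show "pair_antisym (\<lambda>a b c d. S a b c d - T a b c d)"
    unfolding pair_antisym_def minus_diff_eq
    using S' T' by (metis minus_diff_minus minus_diff_eq)
qed

definition pair_sum :: "(4 \<Rightarrow> 4 \<Rightarrow> real) \<Rightarrow> real" where
  "pair_sum f = f 1 2 + f 1 3 + f 1 4 + f 2 3 + f 2 4 + f 3 4"

lemma sum_pair_sum:
  assumes "\<And>a b. f b a = f a b" "\<And>a. f a a = 0"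
  shows "(\<Sum>a\<in>UNIV. \<Sum>b\<in>UNIV. f a b) = 2 * pair_sum f"
  using assms(1)[of 1 2] assms(1)[of 1 3] assms(1)[of 1 4] assms(1)[of 2 3] assms(1)[of 2 4] assms(1)[of 3 4]
  by (simp add: sum_4 pair_sum_def assms(2))

text \<open>Antisymmetry in both index pairs cuts the 256 summands to 36, each of them counted four
  times.\<close>

lemma frame_prod_pair_sum:
  assumes "pair_antisym S" "pair_antisym T"
  shows "frame_prod h S T = 4 * pair_sum (\<lambda>a b. pair_sum (\<lambda>c d. S a b c d *
      (h a * (h b * (h c * (h d * T a b c d))))))"
proof -
  have S: "S b a c d = - S a b c d" "S a b d c = - S a b c d"
    and T: "T b a c d = - T a b c d" "T a b d c = - T a b c d" for a b c d
    using assms unfolding pair_antisym_def by blast+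
  have z: "S a a c d = 0" "S a b c c = 0" for a b c d
    using S(1)[of a a c d] S(2)[of a b c c] by linarith+
  have "(\<Sum>c\<in>UNIV. \<Sum>d\<in>UNIV. S a b c d * (h a * (h b * (h c * (h d * T a b c d)))))
      = 2 * pair_sum (\<lambda>c d. S a b c d * (h a * (h b * (h c * (h d * T a b c d)))))" for a b
  proof (rule sum_pair_sum)
    show "S a b d c * (h a * (h b * (h d * (h c * T a b d c)))) = S a b c d *
        (h a * (h b * (h c * (h d * T a b c d))))" for c d
      by (simp add: S(2)[of a b c d] T(2)[of a b c d] mult_ac)
  qed (simp add: z)
  moreover have "(\<Sum>a\<in>UNIV. \<Sum>b\<in>UNIV. 2 * pair_sum (\<lambda>c d. S a b c d * (h a * (h b * (h c * (h d * T a b c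
      d))))))
      = 2 * pair_sum (\<lambda>a b. 2 * pair_sum (\<lambda>c d. S a b c d * (h a * (h b * (h c * (h d * T a b c d))))))"
  proof (rule sum_pair_sum)
    fix a b
    have "S b a c d * (h b * (h a * (h c * (h d * T b a c d)))) = S a b c d *
        (h a * (h b * (h c * (h d * T a b c d))))" for c d
      by (simp add: S(1)[of b a] T(1)[of b a] mult_ac)
    then show "2 * pair_sum (\<lambda>c d. S b a c d * (h b * (h a * (h c * (h d * T b a c d)))))
        = 2 * pair_sum (\<lambda>c d. S a b c d * (h a * (h b * (h c * (h d * T a b c d)))))"
      by (simp only:)
  qed (simp add: pair_sum_def z)
  ultimately show ?thesis
    by (simp add: frame_prod_def) (simp add: pair_sum_def)
qed

text \<open>
  The tensors which arise from \<open>typeD\<close> by an infinitesimal rotation of the frame. Rotations in the planes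
  \<open>(1, 2)\<close> and \<open>(3, 4)\<close> leave \<open>typeD\<close> fixed, so they do not contribute in \<open>act_typeD\<close>.
\<close>

definition mixD :: "real \<Rightarrow> real \<Rightarrow> real \<Rightarrow> real \<Rightarrow> real \<Rightarrow> tensor4" where
  "mixD \<epsilon> p q r s a b c d =
     p * (bivec 1 2 a b * bivec 1 3 c d + bivec 1 3 a b * bivec 1 2 c d
          + \<epsilon> * (bivec 2 4 a b * bivec 3 4 c d + bivec 3 4 a b * bivec 2 4 c d))
   + q * (bivec 1 2 a b * bivec 1 4 c d + bivec 1 4 a b * bivec 1 2 c d
          - \<epsilon> * (bivec 2 3 a b * bivec 3 4 c d + bivec 3 4 a b * bivec 2 3 c d))
   + r * (bivec 1 2 a b * bivec 2 3 c d + bivec 2 3 a b * bivec 1 2 c d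
          + \<epsilon> * (bivec 1 4 a b * bivec 3 4 c d + bivec 3 4 a b * bivec 1 4 c d))
   + s * (bivec 1 2 a b * bivec 2 4 c d + bivec 2 4 a b * bivec 1 2 c d
          - \<epsilon> * (bivec 1 3 a b * bivec 3 4 c d + bivec 3 4 a b * bivec 1 3 c d))"

lemma pair_antisym_typeD: "pair_antisym (typeD \<epsilon> A B)"
  unfolding typeD_def[abs_def] by (intro pair_antisym_linear pair_antisym_bivec)

lemma pair_antisym_mixD: "pair_antisym (mixD \<epsilon> p q r s)"
  unfolding mixD_def[abs_def] by (intro pair_antisym_linear pair_antisym_bivec)

text \<open>Hodge duality on basis bivectors: each index pair goes to its complement with the sign
  of the permutation.\<close>

lemma sum_levi_civita_symbol_pair:
  "(\<Sum>u\<in>UNIV. \<Sum>v\<in>UNIV. levi_civita_symbol i j u v * X u v)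
    = bivec 3 4 i j * (X 1 2 - X 2 1) - bivec 2 4 i j * (X 1 3 - X 3 1) + bivec 2 3 i j * (X 1 4 - X 4 1)
    + bivec 1 4 i j * (X 2 3 - X 3 2) - bivec 1 3 i j * (X 2 4 - X 4 2) + bivec 1 2 i j * (X 3 4 - X 4 3)"
  using exhaust_4[of i] exhaust_4[of j]
  by (elim disjE) (simp_all add: sum_4 levi_civita_symbol_det det_4 bivec_def)

text \<open>Duality multiplies \<open>A + \<i> B\<close> by \<open>-\<i>\<close>.\<close>

lemma dualize_typeD:
  assumes "\<epsilon> * \<epsilon> = 1"
  shows "dualize (eta \<epsilon>) (typeD \<epsilon> A B) = typeD \<epsilon> B (- A)"
proof (intro ext)
  fix a b c d
  have e: "\<epsilon> * (\<epsilon> * x) = x" for x using assms by (simp flip: mult.assoc)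
  note swap = bivec_swap(2)[of _ _ 2 1] bivec_swap(2)[of _ _ 3 1] bivec_swap(2)[of _ _ 4 1]
    bivec_swap(2)[of _ _ 3 2] bivec_swap(2)[of _ _ 4 2] bivec_swap(2)[of _ _ 4 3]
  show "dualize (eta \<epsilon>) (typeD \<epsilon> A B) a b c d = typeD \<epsilon> B (- A) a b c d"
    unfolding dualize_def sum_levi_civita_symbol_pair
    by (simp add: typeD_def swap bivec_eval eta_def e) (simp add: algebra_simps e)
qed

text \<open>\<open>act M\<close> is a derivation, so on a product of two basis bivectors it replaces
  one leg at a time by means of a row of \<open>M\<close>.\<close>

lemma act_bivec:
  "act M (\<lambda>a b c d. bivec m n a b * bivec p q c d) a b c d =
     (\<Sum>k\<in>UNIV. (M m k * bivec k n a b + M n k * bivec m k a b) * bivec p q c d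
       + bivec m n a b * (M p k * bivec k q c d + M q k * bivec p k c d))"
  unfolding act_def op_defs bivec_def sum.distrib
  by (simp add: algebra_simps sum.distrib sum_subtractf if_distrib[of "\<lambda>u. u * _"] if_distrib[of "\<lambda>u. _
      * u"] cong: if_cong)

lemma act_linear:
  "act M (\<lambda>a b c d. S a b c d + T a b c d) a b c d = act M S a b c d + act M T a b c d"
  "act M (\<lambda>a b c d. S a b c d - T a b c d) a b c d = act M S a b c d - act M T a b c d"
  "act M (\<lambda>a b c d. u * T a b c d) a b c d = u * act M T a b c d"
  unfolding act_def op_defs by (simp_all add: algebra_simps sum.distrib sum_subtractf sum_distrib_left)

lemma act_typeD:
  assumes "\<epsilon> * \<epsilon> = 1"
  shows "act (rotation \<epsilon> w12 w13 w14 w23 w24 w34) (typeD \<epsilon> A B) a b c d =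
    mixD \<epsilon> (3 * (A * w23 - \<epsilon> * (B * w14))) (3 * (A * w24 + \<epsilon> * (B * w13)))
      (- 3 * (A * w13 - \<epsilon> * (B * w24))) (- 3 * (A * w14 + \<epsilon> * (B * w23))) a b c d"
proof -
  have e: "\<epsilon> * (\<epsilon> * x) = x" for x using assms by (simp flip: mult.assoc)
  show ?thesis
    unfolding typeD_def[abs_def] act_linear act_bivec
    by (simp add: sum_4 rotation_def bivec_swap(3)
      bivec_swap(1)[of 2 1] bivec_swap(1)[of 3 1] bivec_swap(1)[of 4 1]
      bivec_swap(1)[of 3 2] bivec_swap(1)[of 4 2] bivec_swap(1)[of 4 3])
      (simp add: mixD_def algebra_simps e)
qed

text \<open>\<open>typeD\<close> and \<open>mixD\<close> are supported on disjoint sets of bivector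
  pairs, hence orthogonal. The first summand is 48 times the real part of
  \<open>(A + \<i> B) (A' + \<i> B')\<close>.\<close>

lemma frame_prod_typeD_mixD:
  assumes "\<epsilon> * \<epsilon> = 1"
  shows "frame_prod (eta \<epsilon>) (\<lambda>a b c d. typeD \<epsilon> A B a b c d - mixD \<epsilon> p q r s a b c d)
      (\<lambda>a b c d. typeD \<epsilon> A' B' a b c d - mixD \<epsilon> p' q' r' s' a b c d)
    = 48 * (A * A' - B * B') + 16 * \<epsilon> * (p * p' + q * q' - r * r' - s * s')"
proof -
  have e: "\<epsilon> * (\<epsilon> * x) = x" for x using assms by (simp flip: mult.assoc)
  note anti = pair_antisym_linear(2)[OF pair_antisym_typeD pair_antisym_mixD]
  show ?thesis
    unfolding frame_prod_pair_sum[OF anti anti] pair_sum_def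
    by (simp add: typeD_def mixD_def bivec_eval eta_def assms e) (simp add: algebra_simps e)
qed

section \<open>Twice differentiable functions of the coordinates\<close>

text \<open>
  Only the symmetry of the mixed second partial derivatives of the coframe is needed. It is derived here
  from closure properties rather than from explicit second derivatives.
\<close>

definition smooth2 :: "(real^4) set \<Rightarrow> (real^4 \<Rightarrow> real) \<Rightarrow> bool" where
  "smooth2 U f \<longleftrightarrow> (\<forall>y\<in>U. \<forall>k l. pdiff k f y \<and> pdiff l (partial k f) y
     \<and> partial l (partial k f) y = partial k (partial l f) y)"

lemma smooth2I:
  assumes "open U" "\<And>k y. y \<in> U \<Longrightarrow> has_partial k f (D k y) y"
    "\<And>k l y. y \<in> U \<Longrightarrow> has_partial l (D k) (DD k l y) y"
    "\<And>k l y. y \<in> U \<Longrightarrow> DD k l y = DD l k y"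
  shows "smooth2 U f"
proof -
  have "partial k f y = D k y" if "y \<in> U" for k y
    using has_partial_partial[OF assms(2)[OF that]] .
  then have "has_partial l (partial k f) (DD k l y) y" if "y \<in> U" for k l y
    using has_partial_cong[OF assms(1) that _ assms(3)[OF that]] by simp
  then show ?thesis
    unfolding smooth2_def using has_partial_pdiff has_partial_partial assms(2,4) by metis
qed

lemma smooth2D:
  assumes "smooth2 U f" "y \<in> U"
  shows "has_partial k f (partial k f y) y" "has_partial l (partial k f) (partial l (partial k f) y) y"
    "partial l (partial k f) y = partial k (partial l f) y"
  using assms unfolding smooth2_def pdiff_def by blast+

lemma smooth2_const: "open U \<Longrightarrow> smooth2 U (\<lambda>y. u)"
  by (rule smooth2I[where D = "\<lambda>k y. 0" and DD = "\<lambda>k l y. 0"]) (auto intro: has_partial_const)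

lemma has_partial_coord: "has_partial k (\<lambda>y. y $ i) (if i = k then 1 else 0) y"
  unfolding has_partial_def by (auto intro!: derivative_eq_intros simp: axis_def)

lemma smooth2_coord: "open U \<Longrightarrow> smooth2 U (\<lambda>y. y $ i)"
  by (rule smooth2I[where D = "\<lambda>k y. if i = k then 1 else 0" and DD = "\<lambda>k l y. 0"])
    (assumption, rule has_partial_coord, rule has_partial_const, rule refl)

lemma smooth2_add:
  assumes "open U" "smooth2 U f" "smooth2 U f'" shows "smooth2 U (\<lambda>y. f y + f' y)"
proof (rule smooth2I[OF assms(1)])
  fix k l y assume y: "y \<in> U"
  note f = smooth2D[OF assms(2) y] and f' = smooth2D[OF assms(3) y]
  show "has_partial k (\<lambda>y. f y + f' y) (partial k f y + partial k f' y) y"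
    by (intro has_partial_add f f')
  show "has_partial l (\<lambda>y. partial k f y + partial k f' y) (partial l (partial k f) y
      + partial l (partial k f') y) y"
    by (intro has_partial_add f f')
  show "partial l (partial k f) y + partial l (partial k f') y = partial k (partial l f) y
      + partial k (partial l f') y"
    using f(3)[of l k] f'(3)[of l k] by simp
qed

lemma smooth2_mult:
  assumes "open U" "smooth2 U f" "smooth2 U f'" shows "smooth2 U (\<lambda>y. f y * f' y)"
proof (rule smooth2I[OF assms(1)])
  fix k l y assume y: "y \<in> U"
  note f = smooth2D[OF assms(2) y] and f' = smooth2D[OF assms(3) y]
  show "has_partial k (\<lambda>y. f y * f' y) (partial k f y * f' y + f y * partial k f' y) y"
    by (intro has_partial_mult f f')
  show "has_partial l (\<lambda>y. partial k f y * f' y + f y * partial k f' y)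
     ((partial l (partial k f) y * f' y + partial k f y * partial l f' y)
      + (partial l f y * partial k f' y + f y * partial l (partial k f') y)) y"
    by (intro has_partial_add has_partial_mult f f')
  show "(partial l (partial k f) y * f' y + partial k f y * partial l f' y)
      + (partial l f y * partial k f' y + f y * partial l (partial k f') y)
    = (partial k (partial l f) y * f' y + partial l f y * partial k f' y)
      + (partial k f y * partial l f' y + f y * partial k (partial l f') y)"
    using f(3)[of l k] f'(3)[of l k] by simp
qed

lemma has_partial_compose:
  assumes "(\<phi> has_real_derivative D) (at (f y))" "has_partial k f D' y"
  shows "has_partial k (\<lambda>z. \<phi> (f z)) (D * D') y"
  using DERIV_chain2[of \<phi> D "\<lambda>s. f (y + s *\<^sub>R axis k 1)" 0 D' UNIV] assms
  unfolding has_partial_def by simp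

lemma smooth2_compose:
  assumes "open U" "smooth2 U f"
    "\<And>y. y \<in> U \<Longrightarrow> (\<phi> has_real_derivative \<phi>' (f y)) (at (f y))"
    "\<And>y. y \<in> U \<Longrightarrow> (\<phi>' has_real_derivative \<phi>'' (f y)) (at (f y))"
  shows "smooth2 U (\<lambda>y. \<phi> (f y))"
proof (rule smooth2I[OF assms(1)])
  fix k l y assume y: "y \<in> U"
  note f = smooth2D[OF assms(2) y]
  show "has_partial k (\<lambda>y. \<phi> (f y)) (\<phi>' (f y) * partial k f y) y"
    by (intro has_partial_compose assms(3) y f)
  show "has_partial l (\<lambda>y. \<phi>' (f y) * partial k f y)
     ((\<phi>'' (f y) * partial l f y) * partial k f y + \<phi>' (f y) * partial l (partial k f) y) y"
    by (intro has_partial_mult has_partial_compose assms(4) y f)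
  show "(\<phi>'' (f y) * partial l f y) * partial k f y + \<phi>' (f y) * partial l (partial k f) y
    = (\<phi>'' (f y) * partial k f y) * partial l f y + \<phi>' (f y) * partial k (partial l f) y"
    using f(3)[of l k] by simp
qed

lemma smooth2_sin: "open U \<Longrightarrow> smooth2 U f \<Longrightarrow> smooth2 U (\<lambda>y. sin (f y))"
  by (rule smooth2_compose[where \<phi>' = cos and \<phi>'' = "\<lambda>x. - sin x"]) (auto intro!: derivative_eq_intros)

lemma smooth2_cos: "open U \<Longrightarrow> smooth2 U f \<Longrightarrow> smooth2 U (\<lambda>y. cos (f y))"
  by (rule smooth2_compose[where \<phi>' = "\<lambda>x. - sin x" and \<phi>'' = "\<lambda>x. - cos x"]) (auto intro!:
      derivative_eq_intros)

lemma smooth2_inverse: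
  "open U \<Longrightarrow> smooth2 U f \<Longrightarrow> (\<And>y. y \<in> U \<Longrightarrow> f y \<noteq> 0) \<Longrightarrow> smooth2 U (\<lambda>y. inverse (f y))"
  by (rule smooth2_compose[where \<phi>' = "\<lambda>x. - (inverse x ^ 2)" and \<phi>'' = "\<lambda>x. 2 * inverse x ^ 3"])
    (auto intro!: derivative_eq_intros simp: power2_eq_square power3_eq_cube)

lemma smooth2_sqrt:
  assumes "open U" "smooth2 U f" "\<And>y. y \<in> U \<Longrightarrow> f y > 0" shows "smooth2 U (\<lambda>y. sqrt (f y))"
proof (rule smooth2_compose[OF assms(1,2)])
  fix y assume "y \<in> U"
  then have y: "f y > 0" by (rule assms(3))
  then show s: "(sqrt has_real_derivative (\<lambda>x. inverse (sqrt x) / 2) (f y)) (at (f y))"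
    by (rule DERIV_real_sqrt)
  show "((\<lambda>x. inverse (sqrt x) / 2) has_real_derivative
      (\<lambda>x. - (inverse (sqrt x) * (inverse (sqrt x) / 2) * inverse (sqrt x)) / 2) (f y)) (at (f y))"
    by (rule DERIV_cdivide, rule DERIV_inverse'[OF s]) (use y in simp)
qed

lemma smooth2_diff:
  assumes "open U" "smooth2 U f" "smooth2 U f'" shows "smooth2 U (\<lambda>y. f y - f' y)"
  using smooth2_add[OF assms(1,2) smooth2_mult[OF assms(1) smooth2_const[OF assms(1), of "-1"] assms(3)]]
  by simp

lemma smooth2_minus:
  assumes "open U" "smooth2 U f" shows "smooth2 U (\<lambda>y. - f y)"
  using smooth2_mult[OF assms(1) smooth2_const[OF assms(1), of "-1"] assms(2)] by simp

lemma smooth2_divide: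
  assumes "open U" "smooth2 U f" "smooth2 U f'" "\<And>y. y \<in> U \<Longrightarrow> f' y \<noteq> 0" shows "smooth2 U (\<lambda>y. f y / f' y)"
  unfolding divide_inverse by (intro smooth2_mult smooth2_inverse assms)

lemma smooth2_power:
  assumes "open U" "smooth2 U f" shows "smooth2 U (\<lambda>y. f y ^ n)"
  by (induction n) (auto intro: smooth2_const smooth2_mult assms)

section \<open>Functions of \<open>r\<close> and \<open>\<theta>\<close> alone\<close>

lemma partial_r:
  assumes "((\<lambda>r. G r (y $ 3)) has_real_derivative D) (at (y $ 2))"
  shows "has_partial 2 (\<lambda>z. G (z $ 2) (z $ 3)) D y"
  using assms DERIV_shift[of "\<lambda>r. G r (y $ 3)" D 0 "y $ 2"]
  by (simp add: has_partial_def axis_def add.commute)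

lemma partial_theta:
  assumes "((\<lambda>\<theta>. G (y $ 2) \<theta>) has_real_derivative D) (at (y $ 3))"
  shows "has_partial 3 (\<lambda>z. G (z $ 2) (z $ 3)) D y"
  using assms DERIV_shift[of "\<lambda>\<theta>. G (y $ 2) \<theta>" D 0 "y $ 3"]
  by (simp add: has_partial_def axis_def add.commute)

lemma partial_t_phi:
  "has_partial 1 (\<lambda>z. G (z $ 2) (z $ 3)) 0 y" "has_partial 4 (\<lambda>z. G (z $ 2) (z $ 3)) 0 y"
  unfolding has_partial_def by (simp_all add: axis_def)

lemma has_partial_r_theta:
  assumes "((\<lambda>r. G r (y $ 3)) has_real_derivative Gr) (at (y $ 2))"
    "((\<lambda>\<theta>. G (y $ 2) \<theta>) has_real_derivative Gt) (at (y $ 3))"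
  shows "has_partial k (\<lambda>z. G (z $ 2) (z $ 3)) ((vector [0, Gr, Gt, 0] :: real^4) $ k) y"
  by (insert exhaust_4[of k], elim disjE)
    (auto intro: partial_r[where G = G] partial_theta[where G = G] partial_t_phi[where G = G] assms)

section \<open>The Carter frame of the Kerr-Newman metric\<close>

locale kerr_newman_frame =
  fixes a m q \<epsilon> \<sigma> :: real
  assumes eps: "\<epsilon> = 1 \<or> \<epsilon> = -1" and sigma: "\<sigma> = 1 \<or> \<sigma> = -1"
begin

abbreviation "P \<equiv> kn_rho2 a"
abbreviation "\<Delta> \<equiv> kn_Delta a m q"

definition d :: "real \<Rightarrow> real" where "d r = sqrt (\<epsilon> * \<Delta> r)"
definition \<rho> :: "real \<Rightarrow> real \<Rightarrow> real" where "\<rho> r \<theta> = sqrt (P r \<theta>)"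

text \<open>With \<open>\<epsilon>\<close> and \<open>\<sigma>\<close> fixed this is an open set on
  which both square roots have positive arguments; every regular point lies in such a set for a
  suitable choice of the signs.\<close>

definition U :: "(real^4) set" where
  "U = {y. P (y $ 2) (y $ 3) \<noteq> 0 \<and> \<epsilon> * \<Delta> (y $ 2) > 0 \<and> \<sigma> * sin (y $ 3) > 0}"

text \<open>
  The Carter coframe. The metric is regular also where \<open>\<Delta> < 0\<close>; there \<open>d\<close> is the root of \<open>-\<Delta>\<close> and the first
  two frame vectors exchange their causal character. The sign \<open>\<sigma>\<close> of \<open>sin \<theta>\<close> is the orientation of the coframe.
\<close>

definition coframe :: "real \<Rightarrow> real \<Rightarrow> 4 \<Rightarrow> 4 \<Rightarrow> real" where
  "coframe r \<theta> b i = (vector [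
     vector [d r / \<rho> r \<theta>, 0, 0, - a * (sin \<theta>)\<^sup>2 * (d r / \<rho> r \<theta>)],
     vector [0, \<rho> r \<theta> / d r, 0, 0],
     vector [0, 0, \<rho> r \<theta>, 0],
     vector [- a * sin \<theta> / \<rho> r \<theta>, 0, 0, (r\<^sup>2 + a\<^sup>2) * (sin \<theta> / \<rho> r \<theta>)]] :: real^4^4) $ b $ i"

definition frame :: "real \<Rightarrow> real \<Rightarrow> 4 \<Rightarrow> 4 \<Rightarrow> real" where
  "frame r \<theta> i b = (vector [
     vector [(r\<^sup>2 + a\<^sup>2) / (d r * \<rho> r \<theta>), 0, 0, a / (d r * \<rho> r \<theta>)],
     vector [0, d r / \<rho> r \<theta>, 0, 0],
     vector [0, 0, 1 / \<rho> r \<theta>, 0],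
     vector [a * sin \<theta> / \<rho> r \<theta>, 0, 0, 1 / (sin \<theta> * \<rho> r \<theta>)]] :: real^4^4) $ b $ i"

text \<open>
  The connection forms \<open>\<omega>\<^sup>i\<^sub>j\<close> for \<open>i < j\<close> as coordinate components; the other ones follow from antisymmetry.
\<close>

definition w12 :: "real \<Rightarrow> real \<Rightarrow> real^4" where
  "w12 r \<theta> = vector [\<epsilon> * (m * (r\<^sup>2 - a\<^sup>2 * (cos \<theta>)\<^sup>2) - q\<^sup>2 * r) / (P r \<theta>)\<^sup>2, 0, 0,
     - \<epsilon> * a * (sin \<theta>)\<^sup>2 * (m * (r\<^sup>2 - a\<^sup>2 * (cos \<theta>)\<^sup>2) - q\<^sup>2 * r + r * P r \<theta>) / (P r \<theta>)\<^sup>2]"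
definition w13 :: "real \<Rightarrow> real \<Rightarrow> real^4" where
  "w13 r \<theta> = vector [0, 0, 0, - a * (cos \<theta> * sin \<theta> * d r / P r \<theta>)]"
definition w14 :: "real \<Rightarrow> real \<Rightarrow> real^4" where
  "w14 r \<theta> = vector [0, - \<epsilon> * a * r * sin \<theta> / (P r \<theta> * d r), a * cos \<theta> * d r / P r \<theta>, 0]"
definition w23 :: "real \<Rightarrow> real \<Rightarrow> real^4" where
  "w23 r \<theta> = vector [0, - a\<^sup>2 * cos \<theta> * sin \<theta> / (P r \<theta> * d r), - \<epsilon> * r * d r / P r \<theta>, 0]"
definition w24 :: "real \<Rightarrow> real \<Rightarrow> real^4" where
  "w24 r \<theta> = vector [0, 0, 0, - \<epsilon> * r * sin \<theta> * d r / P r \<theta>]"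
definition w34 :: "real \<Rightarrow> real \<Rightarrow> real^4" where
  "w34 r \<theta> = vector [a * cos \<theta> * (2 * m * r - q\<^sup>2) / (P r \<theta>)\<^sup>2, 0, 0,
     - cos \<theta> * ((r\<^sup>2 + a\<^sup>2) * P r \<theta> + a\<^sup>2 * (sin \<theta>)\<^sup>2 * (2 * m * r - q\<^sup>2)) / (P r \<theta>)\<^sup>2]"

definition conn :: "real^4 \<Rightarrow> 4 \<Rightarrow> 4 \<Rightarrow> 4 \<Rightarrow> real" where
  "conn y n = rotation \<epsilon> (w12 (y $ 2) (y $ 3) $ n) (w13 (y $ 2) (y $ 3) $ n) (w14 (y $ 2) (y $ 3) $ n)
     (w23 (y $ 2) (y $ 3) $ n) (w24 (y $ 2) (y $ 3) $ n) (w34 (y $ 2) (y $ 3) $ n)"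

lemma open_U: "open U"
  unfolding U_def kn_rho2_def kn_Delta_def
  by (intro open_Collect_conj open_Collect_neq open_Collect_less continuous_intros)

lemma pos:
  assumes "y \<in> U"
  shows "P (y $ 2) (y $ 3) > 0" "\<epsilon> * \<Delta> (y $ 2) > 0" "sin (y $ 3) \<noteq> 0" "\<rho> (y $ 2) (y $ 3) > 0" "d (y $ 2) > 0"
proof -
  have "P (y $ 2) (y $ 3) \<ge> 0" by (simp add: kn_rho2_def)
  then show "P (y $ 2) (y $ 3) > 0" using assms by (simp add: U_def)
  then show "\<rho> (y $ 2) (y $ 3) > 0" by (simp add: \<rho>_def)
  show "\<epsilon> * \<Delta> (y $ 2) > 0" "sin (y $ 3) \<noteq> 0" using assms by (auto simp: U_def)
  then show "d (y $ 2) > 0" by (simp add: d_def)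
qed

lemma nonzero:
  assumes "y \<in> U"
  shows "P (y $ 2) (y $ 3) \<noteq> 0" "sin (y $ 3) \<noteq> 0" "\<rho> (y $ 2) (y $ 3) \<noteq> 0" "d (y $ 2) \<noteq> 0"
  using pos[OF assms] by simp_all

lemma eps_sq: "\<epsilon> * \<epsilon> = 1" using eps by auto

lemma smooth2_basic:
  "smooth2 U (\<lambda>y. d (y $ 2))" "smooth2 U (\<lambda>y. \<rho> (y $ 2) (y $ 3))" "smooth2 U (\<lambda>y. P (y $ 2) (y $ 3))"
  unfolding d_def \<rho>_def kn_Delta_def kn_rho2_def
  by (intro smooth2_sqrt smooth2_add smooth2_diff smooth2_mult smooth2_power smooth2_const smooth2_cos
      smooth2_coord open_U;
      use pos in \<open>simp add: kn_Delta_def kn_rho2_def\<close>)+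

lemmas smooth2_rules = smooth2_basic smooth2_add smooth2_diff smooth2_minus smooth2_mult smooth2_divide
  smooth2_power smooth2_const smooth2_sin smooth2_cos smooth2_coord open_U

lemma smooth2_coframe: "smooth2 U (\<lambda>y. coframe (y $ 2) (y $ 3) b i)"
  using exhaust_4[of b] exhaust_4[of i]
  by (elim disjE; simp add: coframe_def; intro smooth2_rules; simp add: nonzero)

lemma smooth2_frame: "smooth2 U (\<lambda>y. frame (y $ 2) (y $ 3) i b)"
  using exhaust_4[of b] exhaust_4[of i]
  by (elim disjE; simp add: frame_def; intro smooth2_rules; simp add: nonzero)

lemma smooth2_w:
  "smooth2 U (\<lambda>y. w12 (y $ 2) (y $ 3) $ n)" "smooth2 U (\<lambda>y. w13 (y $ 2) (y $ 3) $ n)"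
  "smooth2 U (\<lambda>y. w14 (y $ 2) (y $ 3) $ n)" "smooth2 U (\<lambda>y. w23 (y $ 2) (y $ 3) $ n)"
  "smooth2 U (\<lambda>y. w24 (y $ 2) (y $ 3) $ n)" "smooth2 U (\<lambda>y. w34 (y $ 2) (y $ 3) $ n)"
  using exhaust_4[of n]
  by (elim disjE; simp add: w12_def w13_def w14_def w23_def w24_def w34_def; intro smooth2_rules; simp
      add: nonzero)+

lemma DERIV_d: "\<epsilon> * \<Delta> r > 0 \<Longrightarrow> (d has_real_derivative \<epsilon> * (r - m) / d r) (at r)"
  unfolding d_def kn_Delta_def by (auto intro!: derivative_eq_intros simp: field_simps)

lemma DERIV_P_r: "((\<lambda>r. P r \<theta>) has_real_derivative 2 * r) (at r)"
  unfolding kn_rho2_def by (auto intro!: derivative_eq_intros)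

lemma DERIV_P_theta: "(P r has_real_derivative - 2 * a\<^sup>2 * cos \<theta> * sin \<theta>) (at \<theta>)"
  unfolding kn_rho2_def by (auto intro!: derivative_eq_intros)

lemma DERIV_rho_r: "P r \<theta> > 0 \<Longrightarrow> ((\<lambda>r. \<rho> r \<theta>) has_real_derivative r / \<rho> r \<theta>) (at r)"
  unfolding \<rho>_def by (auto intro!: derivative_eq_intros DERIV_P_r simp: field_simps)

lemma DERIV_rho_theta: "P r \<theta> > 0 \<Longrightarrow> (\<rho> r has_real_derivative - a\<^sup>2 * cos \<theta> * sin \<theta> / \<rho> r \<theta>) (at \<theta>)"
  unfolding \<rho>_def by (auto intro!: derivative_eq_intros DERIV_P_theta simp: field_simps)

section \<open>The first structure equation for the Carter coframe\<close>

definition coframe_r :: "real \<Rightarrow> real \<Rightarrow> 4 \<Rightarrow> 4 \<Rightarrow> real" where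
  "coframe_r r \<theta> b i = (let d_r = \<epsilon> * (r - m) / d r; p = \<rho> r \<theta>; s = sin \<theta> in (vector [
     vector [d_r / p - d r * r / p^3, 0, 0, - a * s\<^sup>2 * (d_r / p - d r * r / p^3)],
     vector [0, r / p / d r - p * d_r / (d r)\<^sup>2, 0, 0],
     vector [0, 0, r / p, 0],
     vector [a * s * r / p^3, 0, 0, 2 * r * s / p - (r\<^sup>2 + a\<^sup>2) * s * r / p^3]] :: real^4^4) $ b $ i)"

definition coframe_theta :: "real \<Rightarrow> real \<Rightarrow> 4 \<Rightarrow> 4 \<Rightarrow> real" where
  "coframe_theta r \<theta> b i = (let p = \<rho> r \<theta>; s = sin \<theta>; c = cos \<theta>; u = a\<^sup>2 * c * s in (vector [
     vector [d r * u / p^3, 0, 0, - a * (2 * s * c * d r / p + s\<^sup>2 * d r * u / p^3)],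
     vector [0, - u / p / d r, 0, 0],
     vector [0, 0, - u / p, 0],
     vector [- a * (c / p + s * u / p^3), 0, 0, (r\<^sup>2 + a\<^sup>2) * (c / p + s * u / p^3)]] :: real^4^4) $ b $ i)"

lemma DERIV_coframe:
  assumes "y \<in> U"
  shows "((\<lambda>r. coframe r (y $ 3) b i) has_real_derivative coframe_r (y $ 2) (y $ 3) b i) (at (y $ 2))"
    "((\<lambda>\<theta>. coframe (y $ 2) \<theta> b i) has_real_derivative coframe_theta (y $ 2) (y $ 3) b i) (at (y $ 3))"
proof -
  note pos = pos[OF assms] and nz = nonzero[OF assms]
  note d = DERIV_d[OF pos(2)] and r = DERIV_rho_r[OF pos(1)] and t = DERIV_rho_theta[OF pos(1)]
  show "((\<lambda>r. coframe r (y $ 3) b i) has_real_derivative coframe_r (y $ 2) (y $ 3) b i) (at (y $ 2))"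
    by (insert exhaust_4[of b] exhaust_4[of i]; elim disjE; simp add: coframe_def coframe_r_def Let_def;
        (rule DERIV_cong, (rule d r nz derivative_intros)+, simp add: nz divide_simps, (simp add:
            algebra_simps eval_nat_numeral)?)?)
  show "((\<lambda>\<theta>. coframe (y $ 2) \<theta> b i) has_real_derivative coframe_theta (y $ 2) (y $ 3) b i) (at (y $ 3))"
    by (insert exhaust_4[of b] exhaust_4[of i]; elim disjE; simp add: coframe_def coframe_theta_def Let_def;
        (rule DERIV_cong, (rule t nz derivative_intros)+, simp add: nz divide_simps, (simp add:
            algebra_simps eval_nat_numeral)?)?)
qed

lemma partial_coframe:
  assumes "y \<in> U"
  shows "partial k (\<lambda>z. coframe (z $ 2) (z $ 3) b i) y
    = (vector [0, coframe_r (y $ 2) (y $ 3) b i, coframe_theta (y $ 2) (y $ 3) b i, 0] :: real^4) $ k"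
  by (rule has_partial_partial, rule has_partial_r_theta[where G = "\<lambda>r \<theta>. coframe r \<theta> b i"])
    (rule DERIV_coframe[OF assms])+

text \<open>Modulo these relations the components with roots and trigonometric functions become
  polynomials in independent variables, which makes the structure equations ideal membership
  problems.\<close>

lemma relations:
  assumes "y \<in> U"
  shows "P (y $ 2) (y $ 3) = (\<rho> (y $ 2) (y $ 3))\<^sup>2"
    "(\<rho> (y $ 2) (y $ 3))\<^sup>2 = (y $ 2)\<^sup>2 + a\<^sup>2 * (cos (y $ 3))\<^sup>2"
    "(d (y $ 2))\<^sup>2 = \<epsilon> * ((y $ 2)\<^sup>2 + a\<^sup>2 - 2 * m * y $ 2 + q\<^sup>2)"
    "(sin (y $ 3))\<^sup>2 + (cos (y $ 3))\<^sup>2 = 1"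
  using pos[OF assms] by (simp_all add: \<rho>_def d_def kn_rho2_def kn_Delta_def)

lemma torsion:
  assumes "y \<in> U"
  shows "partial j (\<lambda>z. coframe (z $ 2) (z $ 3) b k) y + (\<Sum>c\<in>UNIV. conn y j b c * coframe (y $ 2) (y $ 3) c k)
    = partial k (\<lambda>z. coframe (z $ 2) (z $ 3) b j) y + (\<Sum>c\<in>UNIV. conn y k b c * coframe (y $ 2) (y $ 3) c j)"
proof -
  define r \<theta> where "r = y $ 2" and "\<theta> = y $ 3"
  define D R s c where "D = d r" and "R = \<rho> r \<theta>" and "s = sin \<theta>" and "c = cos \<theta>"
  note defs = r_def[symmetric] \<theta>_def[symmetric]
  note defs2 = D_def[symmetric] R_def[symmetric] s_def[symmetric] c_def[symmetric]
  have P: "P r \<theta> = R\<^sup>2" and R: "R\<^sup>2 = r\<^sup>2 + a\<^sup>2 * c\<^sup>2" and D: "D\<^sup>2 = \<epsilon> * (r\<^sup>2 + a\<^sup>2 - 2 * m * r + q\<^sup>2)"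
    and s: "s\<^sup>2 + c\<^sup>2 = 1" and e: "\<epsilon> * \<epsilon> = 1"
    using relations[OF assms] eps_sq by (simp_all add: defs defs2)
  have nz: "R \<noteq> 0" "D \<noteq> 0" "s \<noteq> 0"
    using nonzero[OF assms] by (simp_all add: defs defs2)
  have e2: "\<epsilon> * (\<epsilon> * x) = x" for x using e by (simp flip: mult.assoc)
  have "\<forall>j k b. partial j (\<lambda>z. coframe (z $ 2) (z $ 3) b k) y + (\<Sum>c\<in>UNIV. conn y j b c * coframe (y $ 2)
      (y $ 3) c k)
    = partial k (\<lambda>z. coframe (z $ 2) (z $ 3) b j) y + (\<Sum>c\<in>UNIV. conn y k b c * coframe (y $ 2) (y $ 3) c j)"
    unfolding partial_coframe[OF assms] conn_def defs forall_4
    apply (simp add: sum_4 rotation_def coframe_def coframe_r_def coframe_theta_def Let_def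
      w12_def w13_def w14_def w23_def w24_def w34_def defs2 P nz)
    \<comment> \<open>Once denominators are cleared, every component is either immediate or a
      polynomial identity modulo \<open>R\<close>, \<open>D\<close>, \<open>s\<close> and
      \<open>e\<close>, decided by Groebner bases.\<close>
    apply (simp add: nz divide_simps)
    apply (intro conjI; (simp add: eval_nat_numeral e2; fail)?; insert R D s e; algebra)
    done
  then show ?thesis by blast
qed

end

section \<open>Curvature forms as infinitesimal rotations\<close>

lemma rotation_linear:
  "rotation \<epsilon> u1 u2 u3 u4 u5 u6 a b - rotation \<epsilon> v1 v2 v3 v4 v5 v6 a b
    = rotation \<epsilon> (u1 - v1) (u2 - v2) (u3 - v3) (u4 - v4) (u5 - v5) (u6 - v6) a b"
  "rotation \<epsilon> u1 u2 u3 u4 u5 u6 a b + rotation \<epsilon> v1 v2 v3 v4 v5 v6 a b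
    = rotation \<epsilon> (u1 + v1) (u2 + v2) (u3 + v3) (u4 + v4) (u5 + v5) (u6 + v6) a b"
  using exhaust_4[of a] exhaust_4[of b] by (elim disjE; simp add: rotation_def algebra_simps)+

text \<open>The Lie bracket of the orthogonal algebra in the six parameters. It keeps the quadratic
  part of the curvature in the form \<open>rotation\<close>.\<close>

lemma rotation_commutator:
  assumes "\<epsilon> * \<epsilon> = 1"
  shows "(\<Sum>c\<in>UNIV. rotation \<epsilon> u1 u2 u3 u4 u5 u6 a c * rotation \<epsilon> v1 v2 v3 v4 v5 v6 c b
      - rotation \<epsilon> v1 v2 v3 v4 v5 v6 a c * rotation \<epsilon> u1 u2 u3 u4 u5 u6 c b)
    = rotation \<epsilon> (\<epsilon> * (v2 * u4 + v3 * u5 - u2 * v4 - u3 * v5))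
        (u1 * v4 - u3 * v6 - v1 * u4 + v3 * u6) (u1 * v5 + u2 * v6 - v1 * u5 - v2 * u6)
        (u1 * v2 - u5 * v6 - v1 * u2 + v5 * u6) (u1 * v3 + u4 * v6 - v1 * u3 - v4 * u6)
        (\<epsilon> * (u2 * v3 - u4 * v5 - v2 * u3 + v4 * u5)) a b"
proof -
  have e: "\<epsilon> * (\<epsilon> * x) = x" for x using assms by (simp flip: mult.assoc)
  show ?thesis
    using exhaust_4[of a] exhaust_4[of b]
    by (elim disjE; simp add: sum_4 rotation_def algebra_simps e)
qed

lemma has_partial_rotation:
  assumes "has_partial k u1 d1 y" "has_partial k u2 d2 y" "has_partial k u3 d3 y"
    "has_partial k u4 d4 y" "has_partial k u5 d5 y" "has_partial k u6 d6 y"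
  shows "has_partial k (\<lambda>z. rotation \<epsilon> (u1 z) (u2 z) (u3 z) (u4 z) (u5 z) (u6 z) a b) (rotation \<epsilon> d1 d2
      d3 d4 d5 d6 a b) y"
  using exhaust_4[of a] exhaust_4[of b] assms has_partial_cmult[OF assms(2), of \<epsilon>] has_partial_cmult[OF
      assms(3), of \<epsilon>]
    has_partial_cmult[OF assms(4), of "-\<epsilon>"] has_partial_cmult[OF assms(5), of "-\<epsilon>"] has_partial_cmult[OF
        assms(6), of "-1"]
  by (elim disjE; simp add: rotation_def has_partial_const)

text \<open>Weyl part plus the Ricci part of an aligned electromagnetic field, whose strength is the
  single number \<open>l\<close>.\<close>

definition curvature_tensor :: "real \<Rightarrow> real \<Rightarrow> real \<Rightarrow> real \<Rightarrow> tensor4" where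
  "curvature_tensor \<epsilon> A B l a b c d = typeD \<epsilon> A B a b c d
     + l * (bivec 1 2 a b * bivec 1 2 c d + bivec 3 4 a b * bivec 3 4 c d)"

text \<open>\<open>X\<close> and \<open>Y\<close> stand for the coframe evaluated on two coordinate
  directions, so \<open>Z\<close> lists the components of the products \<open>e^m \<and> e^n\<close>
  of coframe forms.\<close>

lemma curvature_tensor_rotation:
  fixes X Y :: "4 \<Rightarrow> real"
  assumes "\<epsilon> * \<epsilon> = 1"
  defines "Z \<equiv> \<lambda>m n. X m * Y n - X n * Y m"
  shows "eta \<epsilon> a * (\<Sum>c\<in>UNIV. \<Sum>d\<in>UNIV. curvature_tensor \<epsilon> A B l a b c d * (X c * Y d))
    = rotation \<epsilon> (- \<epsilon> * ((2 * A + l) * Z 1 2 + 2 * B * Z 3 4)) (A * Z 1 3 - \<epsilon> * B * Z 2 4)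
        (A * Z 1 4 + \<epsilon> * B * Z 2 3) (A * Z 2 3 - \<epsilon> * B * Z 1 4)
        (A * Z 2 4 + \<epsilon> * B * Z 1 3) ((l - 2 * A) * Z 3 4 + 2 * B * Z 1 2) a b"
proof -
  have e: "\<epsilon> * (\<epsilon> * x) = x" for x using assms by (simp flip: mult.assoc)
  have XY: "(\<Sum>c\<in>UNIV. \<Sum>d\<in>UNIV. (u * bivec m n c d) * (X c * Y d)) = u * Z m n" for u m n
  proof -
    have "(\<Sum>c\<in>UNIV. \<Sum>d\<in>UNIV. (u * bivec m n c d) * (X c * Y d)) = u * (\<Sum>c\<in>UNIV. \<Sum>d\<in>UNIV. bivec m n c d *
        (X c * Y d))"
      by (simp add: sum_distrib_left mult.assoc)
    moreover have "(\<Sum>c\<in>UNIV. \<Sum>d\<in>UNIV. bivec m n c d * (X c * Y d)) = Z m n"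
      using exhaust_4[of m] exhaust_4[of n] by (elim disjE; simp add: bivec_def sum_4 Z_def)
    ultimately show ?thesis by simp
  qed
  have "curvature_tensor \<epsilon> A B l a b c d =
      ((2 * A + l) * bivec 1 2 a b + 2 * B * bivec 3 4 a b) * bivec 1 2 c d
    + ((l - 2 * A) * bivec 3 4 a b + 2 * B * bivec 1 2 a b) * bivec 3 4 c d
    + (\<epsilon> * A * bivec 2 3 a b - B * bivec 1 4 a b) * bivec 2 3 c d
    + (\<epsilon> * A * bivec 2 4 a b + B * bivec 1 3 a b) * bivec 2 4 c d
    + (B * bivec 2 4 a b - \<epsilon> * A * bivec 1 3 a b) * bivec 1 3 c d
    + (- B * bivec 2 3 a b - \<epsilon> * A * bivec 1 4 a b) * bivec 1 4 c d" for c d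
    by (simp add: curvature_tensor_def typeD_def algebra_simps)
  then have S: "(\<Sum>c\<in>UNIV. \<Sum>d\<in>UNIV. curvature_tensor \<epsilon> A B l a b c d * (X c * Y d)) =
      ((2 * A + l) * bivec 1 2 a b + 2 * B * bivec 3 4 a b) * Z 1 2
    + ((l - 2 * A) * bivec 3 4 a b + 2 * B * bivec 1 2 a b) * Z 3 4
    + (\<epsilon> * A * bivec 2 3 a b - B * bivec 1 4 a b) * Z 2 3
    + (\<epsilon> * A * bivec 2 4 a b + B * bivec 1 3 a b) * Z 2 4
    + (B * bivec 2 4 a b - \<epsilon> * A * bivec 1 3 a b) * Z 1 3
    + (- B * bivec 2 3 a b - \<epsilon> * A * bivec 1 4 a b) * Z 1 4"
    by (simp only: distrib_right[of _ _ "_ * _"] sum.distrib XY)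
  show ?thesis
    unfolding S
    using exhaust_4[of a] exhaust_4[of b]
    by (elim disjE; simp add: eta_def rotation_def bivec_def algebra_simps e)
qed

context kerr_newman_frame
begin

sublocale orthonormal_frame "kerr_newman a m q" U "eta \<epsilon>" "\<lambda>y. coframe (y $ 2) (y $ 3)" "\<lambda>y. frame
    (y $ 2) (y $ 3)" conn
proof
  show "open U" by (rule open_U)
  show "eta \<epsilon> b * eta \<epsilon> b = 1" for b by (simp add: eta_def eps_sq)
  fix y assume y: "y \<in> U"
  define R D s where "R = \<rho> (y $ 2) (y $ 3)" and "D = d (y $ 2)" and "s = sin (y $ 3)"
  have nz: "R \<noteq> 0" "D \<noteq> 0" "s \<noteq> 0"
    using nonzero[OF y] by (simp_all add: R_def D_def s_def)
  have \<Delta>: "\<Delta> (y $ 2) = \<epsilon> * D\<^sup>2"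
    using pos[OF y] eps_sq by (simp add: D_def d_def flip: mult.assoc)
  have R: "R\<^sup>2 = (y $ 2)\<^sup>2 + a\<^sup>2 * (cos (y $ 3))\<^sup>2" and s: "s\<^sup>2 + (cos (y $ 3))\<^sup>2 = 1"
    using relations[OF y] by (simp_all add: R_def s_def)
  have e: "\<epsilon> * (\<epsilon> * x) = x" for x using eps_sq by (simp flip: mult.assoc)
  have e': "x / (\<epsilon> * u) = \<epsilon> * x / u" for x u
    using eps by auto
  have "\<forall>i j. kerr_newman a m q y $ i $ j = (\<Sum>b\<in>UNIV. eta \<epsilon> b * (coframe (y $ 2) (y $ 3) b i * coframe
      (y $ 2) (y $ 3) b j))"
    unfolding forall_4
    by (simp add: kerr_newman_def Let_def sum_4 eta_def coframe_def axis_def relations(1)[OF y] \<Delta> e'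
        R_def[symmetric] D_def[symmetric] s_def[symmetric])
      (simp add: nz power2_eq_square divide_simps, simp add: algebra_simps)
  then show "kerr_newman a m q y $ i $ j = (\<Sum>b\<in>UNIV. eta \<epsilon> b * (coframe (y $ 2) (y $ 3) b i * coframe
      (y $ 2) (y $ 3) b j))" for i j
    by blast
  have "\<forall>b c. (\<Sum>i\<in>UNIV. coframe (y $ 2) (y $ 3) b i * frame (y $ 2) (y $ 3) i c) = (if b = c then 1 else 0)"
    unfolding forall_4
    apply (simp add: sum_4 coframe_def frame_def R_def[symmetric] D_def[symmetric] s_def[symmetric] nz
        divide_simps)
    apply (intro conjI; (simp add: power2_eq_square; fail)?; insert R s; algebra)
    done
  then show "(\<Sum>i\<in>UNIV. coframe (y $ 2) (y $ 3) b i * frame (y $ 2) (y $ 3) i c) = (if b = c then 1 else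
      0)" for b c
    by blast
  show "pdiff k (\<lambda>z. coframe (z $ 2) (z $ 3) b i) y" for k b i
    using smooth2_coframe y unfolding smooth2_def by blast
  show "pdiff k (\<lambda>z. frame (z $ 2) (z $ 3) i b) y" for k b i
    using smooth2_frame y unfolding smooth2_def by blast
  show "pdiff k (\<lambda>z. conn z n b c) y" for k n b c
    unfolding conn_def
    by (rule has_partial_pdiff, rule has_partial_rotation)
      (rule smooth2D(1)[OF smooth2_w(1) y] smooth2D(1)[OF smooth2_w(2) y] smooth2D(1)[OF smooth2_w(3) y]
        smooth2D(1)[OF smooth2_w(4) y] smooth2D(1)[OF smooth2_w(5) y] smooth2D(1)[OF smooth2_w(6) y])+
  show "pdiff k (\<lambda>z. partial l (\<lambda>z. coframe (z $ 2) (z $ 3) b i) z) y" for k l b i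
    using smooth2_coframe y unfolding smooth2_def by blast
  show "partial k (\<lambda>z. partial l (\<lambda>z. coframe (z $ 2) (z $ 3) b i) z) y = partial l (\<lambda>z. partial k
      (\<lambda>z. coframe (z $ 2) (z $ 3) b i) z) y" for k l b i
    using smooth2_coframe y unfolding smooth2_def by blast
  show "partial j (\<lambda>z. coframe (z $ 2) (z $ 3) b k) y + (\<Sum>c\<in>UNIV. conn y j b c * coframe (y $ 2) (y $ 3) c k)
    = partial k (\<lambda>z. coframe (z $ 2) (z $ 3) b j) y + (\<Sum>c\<in>UNIV. conn y k b c * coframe (y $ 2) (y $ 3) c
        j)" for j k b
    by (rule torsion[OF y])
  show "eta \<epsilon> b * conn y n b c = - (eta \<epsilon> c * conn y n c b)" for n b c
    unfolding conn_def by (rule rotation_eta[OF eps_sq])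
qed

end

section \<open>Curvature of the Kerr-Newman metric\<close>

context kerr_newman_frame
begin

section \<open>Derivatives of the connection forms\<close>

definition w12_r :: "real \<Rightarrow> real \<Rightarrow> real^4" where
  "w12_r r \<theta> = (let p = P r \<theta>; N = m * (r\<^sup>2 - a\<^sup>2 * (cos \<theta>)\<^sup>2) - q\<^sup>2 * r; Q = 2 * m * r - q\<^sup>2 in
     vector [\<epsilon> * (Q * p - 4 * r * N) / p^3, 0, 0,
       - \<epsilon> * a * (sin \<theta>)\<^sup>2 * ((Q + p + 2 * r\<^sup>2) * p - 4 * r * (N + r * p)) / p^3])"
definition w12_theta :: "real \<Rightarrow> real \<Rightarrow> real^4" where
  "w12_theta r \<theta> = (let p = P r \<theta>; c = cos \<theta>; s = sin \<theta>; N = m * (r\<^sup>2 - a\<^sup>2 * c\<^sup>2) - q\<^sup>2 * r in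
     vector [\<epsilon> * (2 * m * a\<^sup>2 * c * s * p + 4 * a\<^sup>2 * c * s * N) / p^3, 0, 0,
       - \<epsilon> * a * (2 * s * c * (N + r * p) * p + s\<^sup>2 * (2 * m * a\<^sup>2 * c * s - 2 * r * a\<^sup>2 * c * s) * p
          + 4 * a\<^sup>2 * c * s * s\<^sup>2 * (N + r * p)) / p^3])"
definition w13_r :: "real \<Rightarrow> real \<Rightarrow> real^4" where
  "w13_r r \<theta> = (let p = P r \<theta>; d_r = \<epsilon> * (r - m) / d r in
     vector [0, 0, 0, - a * cos \<theta> * sin \<theta> * (d_r * p - 2 * r * d r) / p\<^sup>2])"
definition w13_theta :: "real \<Rightarrow> real \<Rightarrow> real^4" where
  "w13_theta r \<theta> = (let p = P r \<theta>; c = cos \<theta>; s = sin \<theta> in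
     vector [0, 0, 0, - a * d r * ((c\<^sup>2 - s\<^sup>2) * p + 2 * a\<^sup>2 * c\<^sup>2 * s\<^sup>2) / p\<^sup>2])"
definition w14_r :: "real \<Rightarrow> real \<Rightarrow> real^4" where
  "w14_r r \<theta> = (let p = P r \<theta>; d_r = \<epsilon> * (r - m) / d r in
     vector [0, - \<epsilon> * a * sin \<theta> * (p * d r - 2 * r\<^sup>2 * d r - r * p * d_r) / (p\<^sup>2 * (d r)\<^sup>2),
       a * cos \<theta> * (d_r * p - 2 * r * d r) / p\<^sup>2, 0])"
definition w14_theta :: "real \<Rightarrow> real \<Rightarrow> real^4" where
  "w14_theta r \<theta> = (let p = P r \<theta>; c = cos \<theta>; s = sin \<theta> in
     vector [0, - \<epsilon> * a * r * (c * p + 2 * a\<^sup>2 * c * s\<^sup>2) / (p\<^sup>2 * d r),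
       a * d r * (2 * a\<^sup>2 * c\<^sup>2 * s - s * p) / p\<^sup>2, 0])"
definition w23_r :: "real \<Rightarrow> real \<Rightarrow> real^4" where
  "w23_r r \<theta> = (let p = P r \<theta>; d_r = \<epsilon> * (r - m) / d r in
     vector [0, a\<^sup>2 * cos \<theta> * sin \<theta> * (2 * r * d r + p * d_r) / (p\<^sup>2 * (d r)\<^sup>2),
       - \<epsilon> * (d r * p + r * d_r * p - 2 * r\<^sup>2 * d r) / p\<^sup>2, 0])"
definition w23_theta :: "real \<Rightarrow> real \<Rightarrow> real^4" where
  "w23_theta r \<theta> = (let p = P r \<theta>; c = cos \<theta>; s = sin \<theta> in
     vector [0, - a\<^sup>2 * ((c\<^sup>2 - s\<^sup>2) * p + 2 * a\<^sup>2 * c\<^sup>2 * s\<^sup>2) / (p\<^sup>2 * d r),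
       - \<epsilon> * r * d r * (2 * a\<^sup>2 * c * s) / p\<^sup>2, 0])"
definition w24_r :: "real \<Rightarrow> real \<Rightarrow> real^4" where
  "w24_r r \<theta> = (let p = P r \<theta>; d_r = \<epsilon> * (r - m) / d r in
     vector [0, 0, 0, - \<epsilon> * sin \<theta> * (d r * p + r * d_r * p - 2 * r\<^sup>2 * d r) / p\<^sup>2])"
definition w24_theta :: "real \<Rightarrow> real \<Rightarrow> real^4" where
  "w24_theta r \<theta> = (let p = P r \<theta>; c = cos \<theta>; s = sin \<theta> in
     vector [0, 0, 0, - \<epsilon> * r * d r * (c * p + 2 * a\<^sup>2 * c * s\<^sup>2) / p\<^sup>2])"
definition w34_r :: "real \<Rightarrow> real \<Rightarrow> real^4" where
  "w34_r r \<theta> = (let p = P r \<theta>; c = cos \<theta>; s = sin \<theta>; Q = 2 * m * r - q\<^sup>2; L = (r\<^sup>2 + a\<^sup>2) * p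
      + a\<^sup>2 * s\<^sup>2 * Q in
     vector [a * c * (2 * m * p - 4 * r * Q) / p^3, 0, 0,
       - c * ((2 * r * p + (r\<^sup>2 + a\<^sup>2) * (2 * r) + 2 * m * a\<^sup>2 * s\<^sup>2) * p - 4 * r * L) / p^3])"
definition w34_theta :: "real \<Rightarrow> real \<Rightarrow> real^4" where
  "w34_theta r \<theta> = (let p = P r \<theta>; c = cos \<theta>; s = sin \<theta>; Q = 2 * m * r - q\<^sup>2; L = (r\<^sup>2 + a\<^sup>2) * p
      + a\<^sup>2 * s\<^sup>2 * Q in
     vector [a * Q * (4 * a\<^sup>2 * c\<^sup>2 * s - s * p) / p^3, 0, 0,
       (s * L * p - c * (2 * a\<^sup>2 * s * c * Q - 2 * a\<^sup>2 * c * s * (r\<^sup>2 + a\<^sup>2)) * p - 4 * a\<^sup>2 * c\<^sup>2 * s *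
           L) / p^3])"

lemmas w_defs = w12_def w13_def w14_def w23_def w24_def w34_def
lemmas w_r_defs = w12_r_def w13_r_def w14_r_def w23_r_def w24_r_def w34_r_def
lemmas w_theta_defs = w12_theta_def w13_theta_def w14_theta_def w23_theta_def w24_theta_def w34_theta_def

lemma DERIV_w_r:
  assumes "y \<in> U"
  shows "((\<lambda>r. w12 r (y $ 3) $ n) has_real_derivative w12_r (y $ 2) (y $ 3) $ n) (at (y $ 2))"
    "((\<lambda>r. w13 r (y $ 3) $ n) has_real_derivative w13_r (y $ 2) (y $ 3) $ n) (at (y $ 2))"
    "((\<lambda>r. w14 r (y $ 3) $ n) has_real_derivative w14_r (y $ 2) (y $ 3) $ n) (at (y $ 2))"
    "((\<lambda>r. w23 r (y $ 3) $ n) has_real_derivative w23_r (y $ 2) (y $ 3) $ n) (at (y $ 2))"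
    "((\<lambda>r. w24 r (y $ 3) $ n) has_real_derivative w24_r (y $ 2) (y $ 3) $ n) (at (y $ 2))"
    "((\<lambda>r. w34 r (y $ 3) $ n) has_real_derivative w34_r (y $ 2) (y $ 3) $ n) (at (y $ 2))"
  by (insert exhaust_4[of n] nonzero[OF assms]; elim disjE; simp add: w_defs w_r_defs Let_def;
      (rule DERIV_cong, (rule DERIV_d[OF pos(2)[OF assms]] DERIV_P_r derivative_intros | simp; fail)+,
       simp add: divide_simps, (simp add: algebra_simps eval_nat_numeral)?)?)+

lemma DERIV_w_theta:
  assumes "y \<in> U"
  shows "((\<lambda>\<theta>. w12 (y $ 2) \<theta> $ n) has_real_derivative w12_theta (y $ 2) (y $ 3) $ n) (at (y $ 3))"
    "((\<lambda>\<theta>. w13 (y $ 2) \<theta> $ n) has_real_derivative w13_theta (y $ 2) (y $ 3) $ n) (at (y $ 3))"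
    "((\<lambda>\<theta>. w14 (y $ 2) \<theta> $ n) has_real_derivative w14_theta (y $ 2) (y $ 3) $ n) (at (y $ 3))"
    "((\<lambda>\<theta>. w23 (y $ 2) \<theta> $ n) has_real_derivative w23_theta (y $ 2) (y $ 3) $ n) (at (y $ 3))"
    "((\<lambda>\<theta>. w24 (y $ 2) \<theta> $ n) has_real_derivative w24_theta (y $ 2) (y $ 3) $ n) (at (y $ 3))"
    "((\<lambda>\<theta>. w34 (y $ 2) \<theta> $ n) has_real_derivative w34_theta (y $ 2) (y $ 3) $ n) (at (y $ 3))"
  by (insert exhaust_4[of n] nonzero[OF assms]; elim disjE; simp add: w_defs w_theta_defs Let_def;
      (rule DERIV_cong, (rule DERIV_P_theta derivative_intros | simp; fail)+,
       simp add: divide_simps, (simp add: algebra_simps eval_nat_numeral)?)?)+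

end

lemma rotation_cong:
  "u1 = v1 \<Longrightarrow> u2 = v2 \<Longrightarrow> u3 = v3 \<Longrightarrow> u4 = v4 \<Longrightarrow> u5 = v5 \<Longrightarrow> u6 = v6 \<Longrightarrow>
    rotation \<epsilon> u1 u2 u3 u4 u5 u6 a b = rotation \<epsilon> v1 v2 v3 v4 v5 v6 a b"
  by simp

context kerr_newman_frame
begin

text \<open>\<open>psiA + \<i> psiB = (q\<^sup>2 - m z') / (z\<^sup>3 z')\<close> with \<open>z = r + \<i> a cos \<theta>\<close> and its conjugate \<open>z'\<close>.\<close>

definition psiA :: "real \<Rightarrow> real \<Rightarrow> real" where
  "psiA r \<theta> = ((q\<^sup>2 - m * r) * (r\<^sup>2 - a\<^sup>2 * (cos \<theta>)\<^sup>2) + 2 * m * r * a\<^sup>2 * (cos \<theta>)\<^sup>2) / (P r \<theta>)^3"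

definition psiB :: "real \<Rightarrow> real \<Rightarrow> real" where
  "psiB r \<theta> = (m * (r\<^sup>2 - a\<^sup>2 * (cos \<theta>)\<^sup>2) - 2 * (q\<^sup>2 - m * r) * r) * (a * cos \<theta>) / (P r \<theta>)^3"

lemma partial_conn:
  assumes "y \<in> U"
  shows "partial k (\<lambda>z. conn z l b c) y =
    (let r = y $ 2; \<theta> = y $ 3; D = (\<lambda>f f'. (vector [0, f r \<theta> $ l, f' r \<theta> $ l, 0] :: real^4) $ k)
     in rotation \<epsilon> (D w12_r w12_theta) (D w13_r w13_theta) (D w14_r w14_theta)
       (D w23_r w23_theta) (D w24_r w24_theta) (D w34_r w34_theta) b c)"
  unfolding conn_def Let_def
  by (rule has_partial_partial, rule has_partial_rotation)
    (rule has_partial_r_theta[where G = "\<lambda>r \<theta>. w12 r \<theta> $ l"] has_partial_r_theta[where G = "\<lambda>r \<theta>. w13 r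
        \<theta> $ l"]
       has_partial_r_theta[where G = "\<lambda>r \<theta>. w14 r \<theta> $ l"] has_partial_r_theta[where G = "\<lambda>r \<theta>. w23 r \<theta> $ l"]
       has_partial_r_theta[where G = "\<lambda>r \<theta>. w24 r \<theta> $ l"] has_partial_r_theta[where G = "\<lambda>r \<theta>. w34 r \<theta> $ l"],
     (rule DERIV_w_r[OF assms] DERIV_w_theta[OF assms])+)+

text \<open>The derivatives of the connection, its commutators and the contracted curvature tensor
  are all of the form \<open>rotation\<close>. The second structure equation therefore reduces to
  the six equations \<open>F12\<close> to \<open>F34\<close> between parameters, each for all pairs
  of coordinate directions.\<close>

lemma curvature:
  assumes "y \<in> U"
  shows "curv y b b' k l = eta \<epsilon> b * (\<Sum>c\<in>UNIV. \<Sum>c'\<in>UNIV.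
     curvature_tensor \<epsilon> (psiA (y $ 2) (y $ 3)) (psiB (y $ 2) (y $ 3)) (q\<^sup>2 / (P (y $ 2) (y $ 3))\<^sup>2) b b' c c'
       * (coframe (y $ 2) (y $ 3) c k * coframe (y $ 2) (y $ 3) c' l))"
proof -
  define r \<theta> where "r = y $ 2" and "\<theta> = y $ 3"
  define p D R s c where "p = P r \<theta>" and "D = d r" and "R = \<rho> r \<theta>" and "s = sin \<theta>" and "c = cos \<theta>"
  note defs = r_def[symmetric] \<theta>_def[symmetric]
  note defs2 = p_def[symmetric] D_def[symmetric] R_def[symmetric] s_def[symmetric] c_def[symmetric]
  have R: "R\<^sup>2 = p" and p: "p = r\<^sup>2 + a\<^sup>2 * c\<^sup>2" and D: "D\<^sup>2 = \<epsilon> * (r\<^sup>2 + a\<^sup>2 - 2 * m * r + q\<^sup>2)"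
    and s: "s\<^sup>2 + c\<^sup>2 = 1" and e: "\<epsilon> * \<epsilon> = 1"
    using relations[OF assms] eps_sq by (simp_all add: defs defs2)
  have nz: "R \<noteq> 0" "D \<noteq> 0" "s \<noteq> 0" "p \<noteq> 0" "\<epsilon> \<noteq> 0"
    using nonzero[OF assms] eps by (auto simp: defs defs2)
  have RR: "R * R = p" using R by (simp add: power2_eq_square)
  have e2: "\<epsilon> * (\<epsilon> * x) = x" for x using e by (simp flip: mult.assoc)
  let ?A = "psiA r \<theta>" and ?B = "psiB r \<theta>" and ?l = "q\<^sup>2 / p\<^sup>2"
  let ?Z = "\<lambda>k l u v. coframe r \<theta> u k * coframe r \<theta> v l - coframe r \<theta> v k * coframe r \<theta> u l"
  let ?d = "\<lambda>f f' k l. (vector [0, f r \<theta> $ l, f' r \<theta> $ l, 0] :: real^4) $ k"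
  have F12: "\<forall>k l. ?d w12_r w12_theta k l - ?d w12_r w12_theta l k + \<epsilon> * (w13 r \<theta> $ l * w23 r \<theta> $ k
      + w14 r \<theta> $ l * w24 r \<theta> $ k - w13 r \<theta> $ k * w23 r \<theta> $ l - w14 r \<theta> $ k * w24 r \<theta> $ l) =
          - \<epsilon> * ((2 * ?A + ?l) * ?Z k l 1 2 + 2 * ?B * ?Z k l 3 4)"
    unfolding forall_4
    apply (simp add: w_defs w_r_defs w_theta_defs coframe_def psiA_def psiB_def Let_def defs2 nz)
    apply (simp add: nz divide_simps R RR)
    apply (intro conjI disjI2; (simp add: eval_nat_numeral e2 mult_ac; fail)?; (algebra | (insert p e s
        D, algebra)))
    done
  have F13: "\<forall>k l. ?d w13_r w13_theta k l - ?d w13_r w13_theta l k + (w12 r \<theta> $ k * w23 r \<theta> $ l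
      - w14 r \<theta> $ k * w34 r \<theta> $ l - w12 r \<theta> $ l * w23 r \<theta> $ k + w14 r \<theta> $ l * w34 r \<theta> $ k) = ?A * ?Z k l
          1 3 - \<epsilon> * ?B * ?Z k l 2 4"
    unfolding forall_4
    apply (simp add: w_defs w_r_defs w_theta_defs coframe_def psiA_def psiB_def Let_def defs2 nz)
    apply (simp add: nz divide_simps R RR)
    apply (intro conjI disjI2; (simp add: eval_nat_numeral e2 mult_ac; fail)?; (algebra | (insert p e s
        D, algebra)))
    done
  have F14: "\<forall>k l. ?d w14_r w14_theta k l - ?d w14_r w14_theta l k + (w12 r \<theta> $ k * w24 r \<theta> $ l
      + w13 r \<theta> $ k * w34 r \<theta> $ l - w12 r \<theta> $ l * w24 r \<theta> $ k - w13 r \<theta> $ l * w34 r \<theta> $ k) = ?A * ?Z k l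
          1 4 + \<epsilon> * ?B * ?Z k l 2 3"
    unfolding forall_4
    apply (simp add: w_defs w_r_defs w_theta_defs coframe_def psiA_def psiB_def Let_def defs2 nz)
    apply (simp add: nz divide_simps R RR)
    apply (intro conjI disjI2; (simp add: eval_nat_numeral e2 mult_ac; fail)?; (algebra | (insert p e s
        D, algebra)))
    done
  have F23: "\<forall>k l. ?d w23_r w23_theta k l - ?d w23_r w23_theta l k + (w12 r \<theta> $ k * w13 r \<theta> $ l
      - w24 r \<theta> $ k * w34 r \<theta> $ l - w12 r \<theta> $ l * w13 r \<theta> $ k + w24 r \<theta> $ l * w34 r \<theta> $ k) = ?A * ?Z k l
          2 3 - \<epsilon> * ?B * ?Z k l 1 4"
    unfolding forall_4
    apply (simp add: w_defs w_r_defs w_theta_defs coframe_def psiA_def psiB_def Let_def defs2 nz)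
    apply (simp add: nz divide_simps R RR)
    apply (intro conjI disjI2; (simp add: eval_nat_numeral e2 mult_ac; fail)?; (algebra | (insert p e s
        D, algebra)))
    done
  have F24: "\<forall>k l. ?d w24_r w24_theta k l - ?d w24_r w24_theta l k + (w12 r \<theta> $ k * w14 r \<theta> $ l
      + w23 r \<theta> $ k * w34 r \<theta> $ l - w12 r \<theta> $ l * w14 r \<theta> $ k - w23 r \<theta> $ l * w34 r \<theta> $ k) = ?A * ?Z k l
          2 4 + \<epsilon> * ?B * ?Z k l 1 3"
    unfolding forall_4
    apply (simp add: w_defs w_r_defs w_theta_defs coframe_def psiA_def psiB_def Let_def defs2 nz)
    apply (simp add: nz divide_simps R RR)
    apply (intro conjI disjI2; (simp add: eval_nat_numeral e2 mult_ac; fail)?; (algebra | (insert p e s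
        D, algebra)))
    done
  have F34: "\<forall>k l. ?d w34_r w34_theta k l - ?d w34_r w34_theta l k + \<epsilon> * (w13 r \<theta> $ k * w14 r \<theta> $ l
      - w23 r \<theta> $ k * w24 r \<theta> $ l - w13 r \<theta> $ l * w14 r \<theta> $ k + w23 r \<theta> $ l * w24 r \<theta> $ k) = (?l
          - 2 * ?A) * ?Z k l 3 4 + 2 * ?B * ?Z k l 1 2"
    unfolding forall_4
    apply (simp add: w_defs w_r_defs w_theta_defs coframe_def psiA_def psiB_def Let_def defs2 nz)
    apply (simp add: nz divide_simps R RR)
    apply (intro conjI disjI2; (simp add: eval_nat_numeral e2 mult_ac; fail)?; (algebra | (insert p e s
        D, algebra)))
    done
  show ?thesis
    unfolding curv_def partial_conn[OF assms]
    unfolding conn_def Let_def defs rotation_commutator[OF eps_sq] rotation_linear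
      curvature_tensor_rotation[OF eps_sq] defs2
    by (intro rotation_cong F12[rule_format] F13[rule_format] F14[rule_format] F23[rule_format]
        F24[rule_format] F34[rule_format])
qed

end

section \<open>Type D form of the Weyl tensor and of its dual\<close>

lemma typeD_linear:
  "typeD \<epsilon> A B a b c d = A * typeD \<epsilon> 1 0 a b c d + B * typeD \<epsilon> 0 1 a b c d"
  by (simp add: typeD_def algebra_simps)

lemma pdiff_typeD:
  assumes "pdiff k A y" "pdiff k B y"
  shows "pdiff k (\<lambda>z. typeD \<epsilon> (A z) (B z) a b c d) y"
    "partial k (\<lambda>z. typeD \<epsilon> (A z) (B z) a b c d) y = typeD \<epsilon> (partial k A y) (partial k B y) a b c d"
proof -
  have "has_partial k (\<lambda>z. A z * typeD \<epsilon> 1 0 a b c d + B z * typeD \<epsilon> 0 1 a b c d)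
      (partial k A y * typeD \<epsilon> 1 0 a b c d + partial k B y * typeD \<epsilon> 0 1 a b c d) y"
    using has_partial_add[OF has_partial_mult[OF assms(1)[unfolded pdiff_def] has_partial_const]
        has_partial_mult[OF assms(2)[unfolded pdiff_def] has_partial_const]]
    by simp
  then have *: "has_partial k (\<lambda>z. typeD \<epsilon> (A z) (B z) a b c d) (typeD \<epsilon> (partial k A y) (partial k B y)
      a b c d) y"
    unfolding typeD_linear[of \<epsilon> "A _"] typeD_linear[of \<epsilon> "partial k A y"] .
  show "pdiff k (\<lambda>z. typeD \<epsilon> (A z) (B z) a b c d) y"
    "partial k (\<lambda>z. typeD \<epsilon> (A z) (B z) a b c d) y = typeD \<epsilon> (partial k A y) (partial k B y) a b c d"
    using has_partial_pdiff[OF *] has_partial_partial[OF *] .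
qed

lemma rotation_sum:
  "(\<Sum>m\<in>UNIV. u m * rotation \<epsilon> (w1 m) (w2 m) (w3 m) (w4 m) (w5 m) (w6 m) a b)
    = rotation \<epsilon> (\<Sum>m\<in>UNIV. u m * w1 m) (\<Sum>m\<in>UNIV. u m * w2 m) (\<Sum>m\<in>UNIV. u m * w3 m)
        (\<Sum>m\<in>UNIV. u m * w4 m) (\<Sum>m\<in>UNIV. u m * w5 m) (\<Sum>m\<in>UNIV. u m * w6 m) a b"
  for u :: "4 \<Rightarrow> real"
  using exhaust_4[of a] exhaust_4[of b]
  by (elim disjE; simp add: rotation_def sum_distrib_left sum_negf mult.left_commute)

lemma frame_prod_typeD:
  assumes "\<epsilon> * \<epsilon> = 1"
  shows "frame_prod (eta \<epsilon>) (typeD \<epsilon> A B) (typeD \<epsilon> A' B') = 48 * (A * A' - B * B')"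
  using frame_prod_typeD_mixD[OF assms, of A B 0 0 0 0 A' B' 0 0 0 0]
  by (simp add: mixD_def)

context kerr_newman_frame
begin

text \<open>The mixed Ricci tensor has the eigenvalues \<open>-l, -l, l, l\<close>, so the scalar
  curvature vanishes and the \<open>l\<close> part of the curvature is exactly the Ricci
  correction.\<close>

lemma weyl_part_curvature_tensor: "weyl_part (curvature_tensor \<epsilon> A B l) = typeD \<epsilon> A B"
proof (intro ext)
  fix b1 b2 b3 b4
  have Ric: "(\<Sum>b\<in>UNIV. eta \<epsilon> b * curvature_tensor \<epsilon> A B l b i b j)
      = (if i = j then l * (if i = 1 \<or> i = 2 then - eta \<epsilon> i else 1) else 0)" for i j
    using exhaust_4[of i] exhaust_4[of j]
    by (elim disjE; simp add: sum_4 curvature_tensor_def typeD_def bivec_def eta_def algebra_simps eps_sq)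
  have "(\<Sum>i\<in>UNIV. eta \<epsilon> i * (if i = i then l * (if i = 1 \<or> i = 2 then - eta \<epsilon> i else 1) else 0)) = 0"
    by (simp add: sum_4 eta_def algebra_simps eps_sq)
  then have "weyl_part (curvature_tensor \<epsilon> A B l) b1 b2 b3 b4 = typeD \<epsilon> A B b1 b2 b3 b4
     + l * (bivec 1 2 b1 b2 * bivec 1 2 b3 b4 + bivec 3 4 b1 b2 * bivec 3 4 b3 b4
       - 1/2 * ((if b1 = b3 then eta \<epsilon> b1 else 0) * (if b2 = b4 then (if b2 = 1 \<or> b2 = 2 then
           - eta \<epsilon> b2 else 1) else 0)
              - (if b1 = b4 then eta \<epsilon> b1 else 0) * (if b2 = b3 then (if b2 = 1 \<or> b2 = 2 then
                  - eta \<epsilon> b2 else 1) else 0)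
              + (if b2 = b4 then eta \<epsilon> b2 else 0) * (if b1 = b3 then (if b1 = 1 \<or> b1 = 2 then
                  - eta \<epsilon> b1 else 1) else 0)
              - (if b2 = b3 then eta \<epsilon> b2 else 0) * (if b1 = b4 then (if b1 = 1 \<or> b1 = 2 then
                  - eta \<epsilon> b1 else 1) else 0)))"
    unfolding weyl_part_def Let_def Ric
    by (simp add: curvature_tensor_def algebra_simps)
  also have "\<dots> = typeD \<epsilon> A B b1 b2 b3 b4"
    using exhaust_4[of b1] exhaust_4[of b2] exhaust_4[of b3] exhaust_4[of b4]
    by (elim disjE; simp add: bivec_def eta_def eps_sq)
  finally show "weyl_part (curvature_tensor \<epsilon> A B l) b1 b2 b3 b4 = typeD \<epsilon> A B b1 b2 b3 b4" .
qed

abbreviation g where "g \<equiv> kerr_newman a m q"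
abbreviation A :: "real^4 \<Rightarrow> real" where "A y \<equiv> psiA (y $ 2) (y $ 3)"
abbreviation B :: "real^4 \<Rightarrow> real" where "B y \<equiv> psiB (y $ 2) (y $ 3)"
abbreviation cof where "cof y \<equiv> coframe (y $ 2) (y $ 3)"

lemma weyl_typeD: "y \<in> U \<Longrightarrow> weyl g y = pull (cof y) (typeD \<epsilon> (A y) (B y))"
  using weyl_frame[OF _ curvature] by (simp add: weyl_part_curvature_tensor)

text \<open>A positive multiple of \<open>sin \<theta>\<close>, so \<open>\<sigma>\<close> is the
  orientation sign required by \<open>dual_weyl_frame\<close>.\<close>

lemma det_coframe:
  assumes "y \<in> U"
  shows "det (\<chi> b i. cof y b i) = sin (y $ 3) * P (y $ 2) (y $ 3)"
proof -
  define r R D s c where "r = y $ 2" and "R = \<rho> (y $ 2) (y $ 3)" and "D = d (y $ 2)" and "s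
      = sin (y $ 3)" and "c = cos (y $ 3)"
  note defs = R_def[symmetric] D_def[symmetric] s_def[symmetric] c_def[symmetric]
  have nz: "R \<noteq> 0" "D \<noteq> 0"
    using nonzero[OF assms] unfolding R_def D_def by blast+
  have R: "R\<^sup>2 = r\<^sup>2 + a\<^sup>2 * c\<^sup>2" and s: "s\<^sup>2 + c\<^sup>2 = 1" and P: "P (y $ 2) (y $ 3) = R\<^sup>2"
    using relations[OF assms] by (simp_all add: r_def R_def s_def c_def)
  have "det (\<chi> b i. cof y b i) = s * (r\<^sup>2 + a\<^sup>2 - a\<^sup>2 * s\<^sup>2)"
    by (simp add: det_4 coframe_def defs nz divide_simps) (simp add: r_def algebra_simps eval_nat_numeral)
  also have "r\<^sup>2 + a\<^sup>2 - a\<^sup>2 * s\<^sup>2 = R\<^sup>2"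
    using R s by algebra
  finally show ?thesis unfolding P by (simp add: s_def)
qed

lemma dual_weyl_typeD:
  assumes "y \<in> U"
  shows "dual_weyl g y = pull (cof y) (typeD \<epsilon> (\<sigma> * B y) (- \<sigma> * A y))"
proof -
  have "\<sigma> * sin (y $ 3) = \<bar>sin (y $ 3)\<bar>" "\<bar>P (y $ 2) (y $ 3)\<bar> = P (y $ 2) (y $ 3)"
    using assms sigma pos(1)[OF assms] by (auto simp: U_def)
  then have "\<sigma> * det (\<chi> b i. cof y b i) = \<bar>det (\<chi> b i. cof y b i)\<bar>"
    by (simp add: det_coframe[OF assms] abs_mult)
  moreover have "(\<lambda>a b c d. \<sigma> * typeD \<epsilon> (B y) (- A y) a b c d) = typeD \<epsilon> (\<sigma> * B y) (- \<sigma> * A y)"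
    by (intro ext) (simp add: typeD_def algebra_simps)
  ultimately show ?thesis
    using dual_weyl_frame[OF assms weyl_typeD[OF assms]] by (simp only: dualize_typeD[OF eps_sq])
qed

lemma I1_typeD: "y \<in> U \<Longrightarrow> I1 g y = 48 * ((A y)\<^sup>2 - (B y)\<^sup>2)"
  by (simp add: I1_def weyl_typeD contract4_frame frame_prod_typeD[OF eps_sq] power2_eq_square)

lemma I2_typeD: "y \<in> U \<Longrightarrow> I2 g y = 96 * \<sigma> * (A y * B y)"
  by (simp add: I2_def weyl_typeD dual_weyl_typeD contract4_frame frame_prod_typeD[OF eps_sq])

end

section \<open>The scalar invariants\<close>

context kerr_newman_frame
begin

text \<open>Here \<open>y\<close> stands for \<open>a cos \<theta>\<close>. Extending the fraction
  for \<open>\<Psi>\<close> by \<open>z'^2\<close> gives the denominator \<open>\<rho>^6\<close> and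
  the numerator \<open>(q^2 - m z') z'^2 = numA + \<i> numB\<close>. The functions with suffix
  \<open>_r\<close> or \<open>_y\<close> are the numerators of the derivatives over
  \<open>\<rho>^8\<close>.\<close>

definition numA where "numA r y = (q\<^sup>2 - m * r) * (r\<^sup>2 - y\<^sup>2) + 2 * m * r * y\<^sup>2" for r y :: real
definition numB where "numB r y = (m * (r\<^sup>2 - y\<^sup>2) - 2 * (q\<^sup>2 - m * r) * r) * y" for r y :: real
definition numA_r where "numA_r r y = (2 * r * (q\<^sup>2 - m * r) + 2 * m * y\<^sup>2 - m * (r\<^sup>2 - y\<^sup>2)) * (r\<^sup>2
    + y\<^sup>2) - 6 * r * numA r y" for r y :: real
definition numB_r where "numB_r r y = (6 * m * r - 2 * q\<^sup>2) * y * (r\<^sup>2 + y\<^sup>2) - 6 * r * numB r y" for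
    r y :: real
definition numA_y where "numA_y r y = (4 * m * r * y - 2 * y * (q\<^sup>2 - m * r)) * (r\<^sup>2 + y\<^sup>2)
    - 6 * y * numA r y" for r y :: real
definition numB_y where "numB_y r y = (m * (r\<^sup>2 - 3 * y\<^sup>2) - 2 * (q\<^sup>2 - m * r) * r) * (r\<^sup>2 + y\<^sup>2)
    - 6 * y * numB r y" for r y :: real

lemma P_eq: "P r \<theta> = r\<^sup>2 + (a * cos \<theta>)\<^sup>2"
  by (simp add: kn_rho2_def power_mult_distrib)

lemma psi_num: "psiA r \<theta> = numA r (a * cos \<theta>) / (P r \<theta>)^3" "psiB r \<theta> = numB r (a * cos \<theta>) / (P r \<theta>)^3"
  by (simp_all add: psiA_def psiB_def numA_def numB_def power_mult_distrib)

lemma DERIV_psi: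
  assumes "P r \<theta> \<noteq> 0"
  shows "((\<lambda>r. psiA r \<theta>) has_real_derivative numA_r r (a * cos \<theta>) / (P r \<theta>)^4) (at r)"
    "((\<lambda>r. psiB r \<theta>) has_real_derivative numB_r r (a * cos \<theta>) / (P r \<theta>)^4) (at r)"
    "(psiA r has_real_derivative - (a * sin \<theta> * numA_y r (a * cos \<theta>)) / (P r \<theta>)^4) (at \<theta>)"
    "(psiB r has_real_derivative - (a * sin \<theta> * numB_y r (a * cos \<theta>)) / (P r \<theta>)^4) (at \<theta>)"
  unfolding psi_num[abs_def] numA_r_def numB_r_def numA_y_def numB_y_def P_eq[symmetric]
  unfolding numA_def numB_def
  by (rule DERIV_cong, (rule DERIV_P_r DERIV_P_theta derivative_intros | simp add: assms; fail)+,
      simp add: divide_simps assms, simp add: algebra_simps eval_nat_numeral)+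

lemma has_partial_A_B:
  assumes "y \<in> U"
  shows "has_partial k A ((vector [0, numA_r (y $ 2) (a * cos (y $ 3)) / (P (y $ 2) (y $ 3))^4,
      - (a * sin (y $ 3) * numA_y (y $ 2) (a * cos (y $ 3))) / (P (y $ 2) (y $ 3))^4, 0] :: real^4) $ k) y"
    "has_partial k B ((vector [0, numB_r (y $ 2) (a * cos (y $ 3)) / (P (y $ 2) (y $ 3))^4,
      - (a * sin (y $ 3) * numB_y (y $ 2) (a * cos (y $ 3))) / (P (y $ 2) (y $ 3))^4, 0] :: real^4) $ k) y"
  by (rule has_partial_r_theta DERIV_psi nonzero(1)[OF assms])+

lemma Dframe_A_B:
  assumes "y \<in> U"
  shows "Dframe y b A = (vector [0, d (y $ 2) / \<rho> (y $ 2) (y $ 3) * (numA_r (y $ 2) (a * cos (y $ 3)) /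
      (P (y $ 2) (y $ 3))^4),
      - (a * sin (y $ 3) * numA_y (y $ 2) (a * cos (y $ 3))) / (P (y $ 2) (y $ 3))^4 / \<rho> (y $ 2)
          (y $ 3), 0] :: real^4) $ b"
    "Dframe y b B = (vector [0, d (y $ 2) / \<rho> (y $ 2) (y $ 3) * (numB_r (y $ 2) (a * cos (y $ 3)) /
        (P (y $ 2) (y $ 3))^4),
      - (a * sin (y $ 3) * numB_y (y $ 2) (a * cos (y $ 3))) / (P (y $ 2) (y $ 3))^4 / \<rho> (y $ 2)
          (y $ 3), 0] :: real^4) $ b"
  unfolding Dframe_def has_partial_partial[OF has_partial_A_B(1)[OF assms]] has_partial_partial[OF
      has_partial_A_B(2)[OF assms]]
  by (insert exhaust_4[of b]; elim disjE; simp add: sum_4 frame_def)+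

definition rot13 where "rot13 r \<theta> = (vector [- a\<^sup>2 * cos \<theta> * sin \<theta> / (\<rho> r \<theta> * P r \<theta>), 0, 0,
    - a * cos \<theta> * d r / (\<rho> r \<theta> * P r \<theta>)] :: real^4)"
definition rot14 where "rot14 r \<theta> = (vector [0, - \<epsilon> * a * r * sin \<theta> / (\<rho> r \<theta> * P r \<theta>), a * cos \<theta> * d r /
    (\<rho> r \<theta> * P r \<theta>), 0] :: real^4)"
definition rot23 where "rot23 r \<theta> = (vector [0, - a\<^sup>2 * cos \<theta> * sin \<theta> / (\<rho> r \<theta> * P r \<theta>), - \<epsilon> * r * d r /
    (\<rho> r \<theta> * P r \<theta>), 0] :: real^4)"
definition rot24 where "rot24 r \<theta> = (vector [- \<epsilon> * a * r * sin \<theta> / (\<rho> r \<theta> * P r \<theta>), 0, 0, - \<epsilon> * r * d r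
    / (\<rho> r \<theta> * P r \<theta>)] :: real^4)"

text \<open>The parameters of the planes \<open>(1, 2)\<close> and \<open>(3, 4)\<close> stay
  existential, since rotations in these planes fix \<open>typeD\<close>.\<close>

lemma rot_rotation:
  assumes "y \<in> U"
  shows "\<exists>u12 u34. rot y b = rotation \<epsilon> u12 (rot13 (y $ 2) (y $ 3) $ b) (rot14 (y $ 2) (y $ 3) $ b)
     (rot23 (y $ 2) (y $ 3) $ b) (rot24 (y $ 2) (y $ 3) $ b) u34"
proof -
  let ?s = "\<lambda>w. \<Sum>k\<in>UNIV. frame (y $ 2) (y $ 3) k b * w (y $ 2) (y $ 3) $ k"
  have "?s w13 = rot13 (y $ 2) (y $ 3) $ b" "?s w14 = rot14 (y $ 2) (y $ 3) $ b"
    "?s w23 = rot23 (y $ 2) (y $ 3) $ b" "?s w24 = rot24 (y $ 2) (y $ 3) $ b"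
    by (insert exhaust_4[of b] nonzero[OF assms]; elim disjE;
        simp add: sum_4 frame_def w_defs rot13_def rot14_def rot23_def rot24_def divide_simps
            power2_eq_square)+
  then have "rot y b = rotation \<epsilon> (?s w12) (rot13 (y $ 2) (y $ 3) $ b) (rot14 (y $ 2) (y $ 3) $ b)
     (rot23 (y $ 2) (y $ 3) $ b) (rot24 (y $ 2) (y $ 3) $ b) (?s w34)"
    by (intro ext) (simp add: rot_def conn_def rotation_sum)
  then show ?thesis by blast
qed

lemma pdiff_A_B: "y \<in> U \<Longrightarrow> pdiff k A y" "y \<in> U \<Longrightarrow> pdiff k B y"
  using has_partial_pdiff has_partial_A_B by blast+

lemma nabla_typeD:
  assumes "y \<in> U" "\<And>k. pdiff k A' y" "\<And>k. pdiff k B' y"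
  shows "nabla y b (\<lambda>z. typeD \<epsilon> (A' z) (B' z)) = (\<lambda>c1 c2 c3 c4.
    (let w13 = rot13 (y $ 2) (y $ 3) $ b; w14 = rot14 (y $ 2) (y $ 3) $ b;
         w23 = rot23 (y $ 2) (y $ 3) $ b; w24 = rot24 (y $ 2) (y $ 3) $ b
     in typeD \<epsilon> (Dframe y b A') (Dframe y b B') c1 c2 c3 c4
      - mixD \<epsilon> (3 * (A' y * w23 - \<epsilon> * (B' y * w14))) (3 * (A' y * w24 + \<epsilon> * (B' y * w13)))
      (- 3 * (A' y * w13 - \<epsilon> * (B' y * w24))) (- 3 * (A' y * w14 + \<epsilon> * (B' y * w23))) c1 c2 c3 c4))"
proof (intro ext)
  fix c1 c2 c3 c4
  obtain u12 u34 where rot: "rot y b = rotation \<epsilon> u12 (rot13 (y $ 2) (y $ 3) $ b) (rot14 (y $ 2) (y $ 3) $ b)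
     (rot23 (y $ 2) (y $ 3) $ b) (rot24 (y $ 2) (y $ 3) $ b) u34"
    using rot_rotation[OF assms(1)] by blast
  have "Dframe y b (\<lambda>z. typeD \<epsilon> (A' z) (B' z) c1 c2 c3 c4) = typeD \<epsilon> (Dframe y b A') (Dframe y b B') c1
      c2 c3 c4"
    unfolding Dframe_def pdiff_typeD(2)[OF assms(2,3)]
    by (simp add: typeD_linear[of \<epsilon> "partial _ _ _"] typeD_linear[of \<epsilon> "sum _ _"] sum.distrib
        distrib_left sum_distrib_right mult.assoc)
  then show "nabla y b (\<lambda>z. typeD \<epsilon> (A' z) (B' z)) c1 c2 c3 c4 = (let w13 = rot13 (y $ 2) (y $ 3) $ b;
      w14 = rot14 (y $ 2) (y $ 3) $ b;
         w23 = rot23 (y $ 2) (y $ 3) $ b; w24 = rot24 (y $ 2) (y $ 3) $ b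
     in typeD \<epsilon> (Dframe y b A') (Dframe y b B') c1 c2 c3 c4
      - mixD \<epsilon> (3 * (A' y * w23 - \<epsilon> * (B' y * w14))) (3 * (A' y * w24 + \<epsilon> * (B' y * w13)))
      (- 3 * (A' y * w13 - \<epsilon> * (B' y * w24))) (- 3 * (A' y * w14 + \<epsilon> * (B' y * w23))) c1 c2 c3 c4)"
    unfolding nabla_def rot act_typeD[OF eps_sq] Let_def by simp
qed

text \<open>Gradient part and rotation part of the covariant derivative are orthogonal. The last
  bracket is the real part of \<open>(A1 + \<i> B1) (A2 + \<i> B2) z'^2\<close>, with the conjugate
  \<open>z'\<close> of \<open>z = r + \<i> a cos \<theta>\<close>.\<close>

lemma covd_covd_typeD:
  assumes "y \<in> U"
    and T: "\<And>z. z \<in> U \<Longrightarrow> T z = pull (cof z) (typeD \<epsilon> (A1 z) (B1 z))" "\<And>k. pdiff k A1 y" "\<And>k. pdiff k B1 y"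
    and T': "\<And>z. z \<in> U \<Longrightarrow> T' z = pull (cof z) (typeD \<epsilon> (A2 z) (B2 z))" "\<And>k. pdiff k A2 y" "\<And>k. pdiff k B2 y"
  shows "(\<Sum>m\<in>UNIV. \<Sum>n\<in>UNIV. inv_metric g y m n * contract4 g y (covd g T y m) (covd g T' y n))
    = (\<Sum>b\<in>UNIV. eta \<epsilon> b * (48 * (Dframe y b A1 * Dframe y b A2 - Dframe y b B1 * Dframe y b B2)))
     + 288 * (kn_Delta a m q (y $ 2) - (a * sin (y $ 3))\<^sup>2) / (P (y $ 2) (y $ 3))^3 *
        ((A1 y * A2 y - B1 y * B2 y) * ((y $ 2)\<^sup>2 - (a * cos (y $ 3))\<^sup>2)
         + (A1 y * B2 y + B1 y * A2 y) * (2 * (y $ 2) * (a * cos (y $ 3))))"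
proof -
  define r p D R s c where "r = y $ 2" and "p = P (y $ 2) (y $ 3)" and "D = d (y $ 2)" and "R
      = \<rho> (y $ 2) (y $ 3)" and "s = sin (y $ 3)" and "c = cos (y $ 3)"
  define dl where "dl = \<Delta> (y $ 2)"
  note defs = p_def[symmetric] D_def[symmetric] R_def[symmetric] s_def[symmetric] c_def[symmetric]
      dl_def[symmetric]
  have R: "R\<^sup>2 = p" "R * R = p"
    using relations[OF assms(1)] by (simp_all add: p_def R_def power2_eq_square)
  have D: "D\<^sup>2 = \<epsilon> * dl"
    using pos[OF assms(1)] by (simp add: D_def d_def dl_def)
  have e: "\<epsilon> * \<epsilon> = 1" by (rule eps_sq)
  have nz: "R \<noteq> 0" "p \<noteq> 0"
    using nonzero[OF assms(1)] unfolding R_def p_def by blast+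
  \<comment> \<open>The scalar product of the \<open>mixD\<close> parts with the factor 3 taken out
    of each parameter; hence the factor \<open>144 = 16 * 3 * 3\<close>.\<close>
  let ?q = "\<lambda>b. let w13 = rot13 (y $ 2) (y $ 3) $ b; w14 = rot14 (y $ 2) (y $ 3) $ b;
         w23 = rot23 (y $ 2) (y $ 3) $ b; w24 = rot24 (y $ 2) (y $ 3) $ b
     in (A1 y * w23 - \<epsilon> * (B1 y * w14)) * (A2 y * w23 - \<epsilon> * (B2 y * w14))
      + (A1 y * w24 + \<epsilon> * (B1 y * w13)) * (A2 y * w24 + \<epsilon> * (B2 y * w13))
      - (A1 y * w13 - \<epsilon> * (B1 y * w24)) * (A2 y * w13 - \<epsilon> * (B2 y * w24))
      - (A1 y * w14 + \<epsilon> * (B1 y * w23)) * (A2 y * w14 + \<epsilon> * (B2 y * w23))"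
  have "(\<Sum>b\<in>UNIV. eta \<epsilon> b * ?q b) = \<epsilon> * (2 * (dl - (a * s)\<^sup>2) / p ^ 3 * ((A1 y * A2 y - B1 y * B2 y) *
      (r\<^sup>2 - (a * c)\<^sup>2)
         + (A1 y * B2 y + B1 y * A2 y) * (2 * r * (a * c))))"
    apply (simp add: Let_def sum_4 rot13_def rot14_def rot23_def rot24_def eta_def defs r_def)
    apply (simp add: nz divide_simps R)
    using D e R(1)
    apply algebra
    done
  then have q: "(\<Sum>b\<in>UNIV. eta \<epsilon> b * (144 * \<epsilon> * ?q b)) = 144 * \<epsilon> * (\<epsilon> * (2 * (dl - (a * s)\<^sup>2) / p ^ 3 *
      ((A1 y * A2 y - B1 y * B2 y) * (r\<^sup>2 - (a * c)\<^sup>2)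
         + (A1 y * B2 y + B1 y * A2 y) * (2 * r * (a * c)))))"
    by (simp only: mult.left_commute[of "eta _ _"] sum_distrib_left[symmetric])
  have "(\<Sum>m\<in>UNIV. \<Sum>n\<in>UNIV. inv_metric g y m n * contract4 g y (covd g T y m) (covd g T' y n))
    = (\<Sum>b\<in>UNIV. eta \<epsilon> b * (48 * (Dframe y b A1 * Dframe y b A2 - Dframe y b B1 * Dframe y b B2)
        + 144 * \<epsilon> * ?q b))"
  proof -
    have "(\<Sum>m\<in>UNIV. \<Sum>n\<in>UNIV. inv_metric g y m n * contract4 g y (covd g T y m) (covd g T' y n))
      = (\<Sum>b\<in>UNIV. eta \<epsilon> b * frame_prod (eta \<epsilon>) (nabla y b (\<lambda>z. typeD \<epsilon> (A1 z) (B1 z))) (nabla y b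
          (\<lambda>z. typeD \<epsilon> (A2 z) (B2 z))))"
      by (rule covd_covd_frame[OF assms(1)]) (simp_all add: T T' pdiff_typeD(1))
    moreover have "frame_prod (eta \<epsilon>) (nabla y b (\<lambda>z. typeD \<epsilon> (A1 z) (B1 z))) (nabla y b (\<lambda>z. typeD \<epsilon>
        (A2 z) (B2 z)))
      = 48 * (Dframe y b A1 * Dframe y b A2 - Dframe y b B1 * Dframe y b B2) + 144 * \<epsilon> * ?q b" for b
      unfolding nabla_typeD[OF assms(1) T(2,3)] nabla_typeD[OF assms(1) T'(2,3)] Let_def
          frame_prod_typeD_mixD[OF eps_sq]
      by algebra
    ultimately show ?thesis by simp
  qed
  also have "\<dots> = (\<Sum>b\<in>UNIV. eta \<epsilon> b * (48 * (Dframe y b A1 * Dframe y b A2 - Dframe y b B1 * Dframe y b B2)))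
     + 144 * (\<epsilon> * \<epsilon>) * (2 * (dl - (a * s)\<^sup>2) / p ^ 3 * ((A1 y * A2 y - B1 y * B2 y) * (r\<^sup>2 - (a * c)\<^sup>2)
         + (A1 y * B2 y + B1 y * A2 y) * (2 * r * (a * c))))"
    unfolding distrib_left[of "eta _ _"] sum.distrib q by (simp only: mult.assoc)
  finally show ?thesis
    by (simp add: e r_def defs)
qed

text \<open>Scalar products of the gradients of \<open>A\<close> and \<open>B\<close>: the two
  derivatives contribute \<open>\<rho>^8\<close> each to the denominator and the inverse metric
  another \<open>\<rho>^2\<close>.\<close>

definition gradAA where "gradAA y = (\<Delta> (y $ 2) * (numA_r (y $ 2) (a * cos (y $ 3)))\<^sup>2
   + (a * sin (y $ 3))\<^sup>2 * (numA_y (y $ 2) (a * cos (y $ 3)))\<^sup>2) / (P (y $ 2) (y $ 3))^9" for y :: "real^4"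
definition gradBB where "gradBB y = (\<Delta> (y $ 2) * (numB_r (y $ 2) (a * cos (y $ 3)))\<^sup>2
   + (a * sin (y $ 3))\<^sup>2 * (numB_y (y $ 2) (a * cos (y $ 3)))\<^sup>2) / (P (y $ 2) (y $ 3))^9" for y :: "real^4"
definition gradAB where "gradAB y = (\<Delta> (y $ 2) * (numA_r (y $ 2) (a * cos (y $ 3)) * numB_r (y $ 2)
    (a * cos (y $ 3)))
   + (a * sin (y $ 3))\<^sup>2 * (numA_y (y $ 2) (a * cos (y $ 3)) * numB_y (y $ 2) (a * cos (y $ 3)))) / (P
       (y $ 2) (y $ 3))^9" for y :: "real^4"

lemma grad_eq:
  assumes "y \<in> U"
  shows "(\<Sum>b\<in>UNIV. eta \<epsilon> b * (Dframe y b A)\<^sup>2) = gradAA y"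
    "(\<Sum>b\<in>UNIV. eta \<epsilon> b * (Dframe y b B)\<^sup>2) = gradBB y"
    "(\<Sum>b\<in>UNIV. eta \<epsilon> b * (Dframe y b A * Dframe y b B)) = gradAB y"
proof -
  define p D R where "p = P (y $ 2) (y $ 3)" and "D = d (y $ 2)" and "R = \<rho> (y $ 2) (y $ 3)"
  define dl where "dl = \<Delta> (y $ 2)"
  note defs = p_def[symmetric] D_def[symmetric] R_def[symmetric] dl_def[symmetric]
  have R: "R\<^sup>2 = p" "R * R = p"
    using relations[OF assms(1)] by (simp_all add: p_def R_def power2_eq_square)
  have "\<epsilon> * D\<^sup>2 = dl"
    using pos[OF assms(1)] by (simp add: D_def d_def dl_def eps_sq flip: mult.assoc)
  then have D: "\<epsilon> * (D * D * u) = dl * u" for u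
    by (simp add: power2_eq_square flip: mult.assoc)
  have nz: "R \<noteq> 0" "p \<noteq> 0"
    using nonzero[OF assms(1)] unfolding R_def p_def by blast+
  \<comment> \<open>One computation serves all three products. The sign \<open>\<epsilon>\<close> of
    the second frame vector turns the square of the root \<open>D\<close> back into
    \<open>\<Delta>\<close>.\<close>
  have sq: "\<epsilon> * ((D / R * (u / p^4)) * (D / R * (v / p^4))) + (w / p^4 / R) * (w' / p^4 / R)
      = (dl * (u * v) + w * w') / p^9" for u v w w'
  proof -
    have "\<epsilon> * ((D / R * (u / p^4)) * (D / R * (v / p^4))) = \<epsilon> * (D * D * (u * v)) / (R * R * p^8)"
      by (simp add: eval_nat_numeral mult_ac)
    moreover have "(w / p^4 / R) * (w' / p^4 / R) = w * w' / (R * R * p^8)"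
      by (simp add: eval_nat_numeral mult_ac)
    ultimately show ?thesis unfolding D R by (simp add: add_divide_distrib eval_nat_numeral)
  qed
  note sq = sq[of "num_r (y $ 2) (a * cos (y $ 3))" "num_r' (y $ 2) (a * cos (y $ 3))"
      "- (a * sin (y $ 3) * num_y (y $ 2) (a * cos (y $ 3)))" "- (a * sin (y $ 3) * num_y' (y $ 2)
          (a * cos (y $ 3)))" for num_r num_r' num_y num_y']
  show "(\<Sum>b\<in>UNIV. eta \<epsilon> b * (Dframe y b A)\<^sup>2) = gradAA y"
    unfolding sum_4 Dframe_A_B[OF assms] gradAA_def defs vector_4 power2_eq_square
    using sq[of numA_r numA_r numA_y numA_y] by (simp add: eta_def mult_ac)
  show "(\<Sum>b\<in>UNIV. eta \<epsilon> b * (Dframe y b B)\<^sup>2) = gradBB y"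
    unfolding sum_4 Dframe_A_B[OF assms] gradBB_def defs vector_4 power2_eq_square
    using sq[of numB_r numB_r numB_y numB_y] by (simp add: eta_def mult_ac)
  show "(\<Sum>b\<in>UNIV. eta \<epsilon> b * (Dframe y b A * Dframe y b B)) = gradAB y"
    unfolding sum_4 Dframe_A_B[OF assms] gradAB_def defs vector_4 power2_eq_square
    using sq[of numA_r numB_r numA_y numB_y] by (simp add: eta_def mult_ac)
qed

lemma Dframe_cmult:
  assumes "\<And>k. pdiff k f y" shows "Dframe y b (\<lambda>z. u * f z) = u * Dframe y b f"
proof -
  have "partial k (\<lambda>z. u * f z) y = u * partial k f y" for k
    by (rule has_partial_partial[OF has_partial_cmult[OF assms[unfolded pdiff_def]]])
  then show ?thesis
    unfolding Dframe_def by (simp add: sum_distrib_left mult.left_commute)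
qed

lemma Dframe_I:
  assumes "y \<in> U"
  shows "Dframe y b (I1 g) = 96 * (A y * Dframe y b A - B y * Dframe y b B)"
    "Dframe y b (I2 g) = 96 * \<sigma> * (A y * Dframe y b B + B y * Dframe y b A)"
proof -
  note d = pdiff_A_B[OF assms, unfolded pdiff_def]
  have I1: "partial k (I1 g) y = 96 * (A y * partial k A y - B y * partial k B y)" for k
  proof -
    have "has_partial k (\<lambda>z. 48 * A z * A z + (- 48) * B z * B z)
       ((48 * partial k A y * A y + 48 * A y * partial k A y) + ((- 48) * partial k B y * B y
           + (- 48) * B y * partial k B y)) y"
      by (intro has_partial_add has_partial_mult has_partial_cmult d)
    then have "has_partial k (I1 g) ((48 * partial k A y * A y + 48 * A y * partial k A y)
        + ((- 48) * partial k B y * B y + (- 48) * B y * partial k B y)) y"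
      by (rule has_partial_cong[OF open_U assms, rotated]) (simp add: I1_typeD power2_eq_square)
    from has_partial_partial[OF this] show ?thesis by simp
  qed
  show "Dframe y b (I1 g) = 96 * (A y * Dframe y b A - B y * Dframe y b B)"
    unfolding Dframe_def I1 by (simp add: sum_4 algebra_simps)
  have I2: "partial k (I2 g) y = 96 * \<sigma> * (A y * partial k B y + B y * partial k A y)" for k
  proof -
    have "has_partial k (\<lambda>z. 96 * \<sigma> * (A z * B z)) (96 * \<sigma> * (partial k A y * B y + A y * partial k B y)) y"
      by (intro has_partial_mult has_partial_cmult d)
    then have "has_partial k (I2 g) (96 * \<sigma> * (partial k A y * B y + A y * partial k B y)) y"
      by (rule has_partial_cong[OF open_U assms, rotated]) (simp add: I2_typeD)
    from has_partial_partial[OF this] show ?thesis by (simp add: mult.commute add.commute)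
  qed
  show "Dframe y b (I2 g) = 96 * \<sigma> * (A y * Dframe y b B + B y * Dframe y b A)"
    unfolding Dframe_def I2 by (simp add: sum_4 algebra_simps)
qed

lemma I5_eq:
  assumes "y \<in> U"
  shows "I5 g y = 9216 * ((A y)\<^sup>2 * gradAA y - 2 * A y * B y * gradAB y + (B y)\<^sup>2 * gradBB y)"
  unfolding I5_def grad_grad_frame[OF assms] Dframe_I[OF assms] grad_eq[OF assms, symmetric]
  unfolding sum_4 by algebra

lemma I6_eq:
  assumes "y \<in> U"
  shows "I6 g y = 9216 * ((A y)\<^sup>2 * gradBB y + 2 * A y * B y * gradAB y + (B y)\<^sup>2 * gradAA y)"
proof -
  have "\<sigma> * \<sigma> = 1" using sigma by auto
  then show ?thesis
    unfolding I6_def grad_grad_frame[OF assms] Dframe_I[OF assms] grad_eq[OF assms, symmetric]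
    unfolding sum_4 by algebra
qed

text \<open>The coefficient 288 of the overview. The denominator is \<open>\<rho>^6\<close> because
  \<open>1/z^2\<close> is rewritten as \<open>z'^2/\<rho>^4\<close>.\<close>

definition \<kappa> where "\<kappa> y = 288 * (\<Delta> (y $ 2) - (a * sin (y $ 3))\<^sup>2) / (P (y $ 2) (y $ 3))^3" for y :: "real^4"

lemma I3_eq:
  assumes "y \<in> U"
  shows "I3 g y = 48 * (gradAA y - gradBB y) + \<kappa> y * (((A y)\<^sup>2 - (B y)\<^sup>2) * ((y $ 2)\<^sup>2 - (a * cos (y $ 3))\<^sup>2)
     + 2 * A y * B y * (2 * (y $ 2) * (a * cos (y $ 3))))"
  unfolding I3_def \<kappa>_def grad_eq[OF assms, symmetric]
  by (subst covd_covd_typeD[OF assms weyl_typeD pdiff_A_B[OF assms] weyl_typeD pdiff_A_B[OF assms]])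
    (simp_all add: sum_4 algebra_simps power2_eq_square)

lemma I4_eq:
  assumes "y \<in> U"
  shows "I4 g y = \<sigma> * (96 * gradAB y + \<kappa> y * (2 * A y * B y * ((y $ 2)\<^sup>2 - (a * cos (y $ 3))\<^sup>2)
     - ((A y)\<^sup>2 - (B y)\<^sup>2) * (2 * (y $ 2) * (a * cos (y $ 3)))))"
proof -
  have pd: "pdiff k (\<lambda>z. u * A z) y" "pdiff k (\<lambda>z. u * B z) y" for k u
    by (rule has_partial_pdiff[OF has_partial_cmult[OF pdiff_A_B(1)[OF assms, unfolded pdiff_def]]],
        rule has_partial_pdiff[OF has_partial_cmult[OF pdiff_A_B(2)[OF assms, unfolded pdiff_def]]])
  show ?thesis
    unfolding I4_def
    by (subst covd_covd_typeD[OF assms weyl_typeD pdiff_A_B[OF assms] dual_weyl_typeD pd(2) pd(1)])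
      (simp_all only: Dframe_cmult[OF pdiff_A_B(1)[OF assms]] Dframe_cmult[OF pdiff_A_B(2)[OF assms]]
          \<kappa>_def grad_eq[OF assms, symmetric] sum_4, algebra)
qed

end

section \<open>Reduction of the numerator to a polynomial identity\<close>

definition chi_poly :: "real \<Rightarrow> real \<Rightarrow> real \<Rightarrow> real \<Rightarrow> real \<Rightarrow> real" where
  "chi_poly a m q r y = 
    ( m^2 * (r*m - 19*q^2/66) * y^12
      - 2 * ( - (7*q^6/132)
              - 17*m*(m - 176*r/17)*q^4/132
              - 3*m^2*(a^2 - 25/9*r*m + 427/18*r^2)*q^2/11
              + m^3*r*(a^2 - r*m + 8*r^2) ) * y^10
      + 30 * 
            ( - (q^8/396)
              + (- (1/165)*a^2 + 79/990*r*m - 17/180*r^2)*q^6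
              + 9*(a^2 - 1079/324*r*m + 143/27*r^2)*m*r*q^4/55
              - 9*m^2*r^2*(a^2 - 71/45*r*m + 307/108*r^2)*q^2/11
              + m^3*r^3*(a^2 - r*m + 19/10*r^2) ) * y^8
      - 84 * r^2 *
            ( - (q^8/36)
              + (- (2/33)*a^2 + 7/22*r*m - 41/396*r^2)*q^6
              + 6*m*(a^2 - 475/216*r*m + 11/9*r^2)*r*q^4/11
              - 15*m^2*(a^2 - 61/45*r*m + 89/90*r^2)*r^2*q^2/11
              + m^3*r^3*(a^2 - r*m + 6/7*r^2) ) * y^6
      + 60 * r^4 *
            ( - (7*q^8/66)
              + (- (7/33)*a^2 + 392/495*r*m - 287/1980*r^2)*q^6
              + 63*(a^2 - 601/324*r*m + 121/189*r^2)*m*r*q^4/55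
              - 21*m^2*(a^2 - 401/315*r*m + 307/504*r^2)*r^2*q^2/11
              + m^3*r^3*(a^2 - r*m + 7/12*r^2) ) * y^4
      - 10 *
            ( - (91*q^8/330)
              + (- (28/55)*a^2 + 263/165*r*m - 17/60*r^2)*q^6
              + 108*m*(a^2 - 2213/1296*r*m + 44/81*r^2)*r*q^4/55
              - 27*m^2*(a^2 - 167/135*r*m + 427/810*r^2)*r^2*q^2/11
              + m^3*r^3*(a^2 - r*m + 28/55*r^2) ) * r^6 * y^2
      + 2/11 * (r*m - q^2)^2 * r^8 *
            ( - (7*q^4/12)
              + (- (a^2) + 5/3*r*m - 7/12*r^2)*q^2
              + m*r*(a^2 - r*m + 1/2*r^2) ) )"

text \<open>With \<open>u = 1/\<rho>^2\<close> every summand has degree 15 in \<open>u\<close>.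
  Splitting this power off first leaves an identity without denominators;
  \<open>2304 = 48^2\<close>.\<close>

lemma numerator_scaling:
  fixes A B X Y G G' k C D u :: real
  defines "X \<equiv> A\<^sup>2 - B\<^sup>2" and "Y \<equiv> 2 * A * B"
  shows "9216 * (2 * (2 * (A * u^3) * (B * u^3)) * (G' * u^9) - ((A * u^3)\<^sup>2 - (B * u^3)\<^sup>2) * (G * u^9
      - H * u^9))
     + 12/5 * (48 * ((A * u^3)\<^sup>2 - (B * u^3)\<^sup>2) * (48 * (G * u^9 - H * u^9)
           + 288 * k * u^3 * (((A * u^3)\<^sup>2 - (B * u^3)\<^sup>2) * C + 2 * (A * u^3) * (B * u^3) * D))
       - 48 * (2 * (A * u^3) * (B * u^3)) * (96 * (G' * u^9)
           + 288 * k * u^3 * (2 * (A * u^3) * (B * u^3) * C - ((A * u^3)\<^sup>2 - (B * u^3)\<^sup>2) * D)))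
    = 2304 * (4 * (2 * Y * G' - X * (G - H))
      + 12/5 * (X * (G - H + 6 * k * (X * C + Y * D)) - Y * (2 * G' + 6 * k * (Y * C - X * D)))) * u^15"
  unfolding assms by algebra

context kerr_newman_frame
begin

text \<open>The computational core, a polynomial identity in \<open>a\<close>, \<open>m\<close>,
  \<open>q\<close>, \<open>r\<close>, \<open>y\<close>, in which \<open>S\<close> stands for
  \<open>(a sin \<theta>)^2\<close>. The factor \<open>q^2\<close> reflects the cancellation at
  \<open>q = 0\<close>, the factor \<open>r^2 + y^2\<close> lowers the power of
  \<open>\<rho>^2\<close> in the denominator from 15 to 14, and 528/5 normalizes the coefficient of
  \<open>m^3 r y^12\<close> in \<open>chi_poly\<close> to one.\<close>

lemma chi_poly_identity:
  fixes r y :: real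
  defines "S \<equiv> a\<^sup>2 - y\<^sup>2"
  defines "G \<equiv> \<Delta> r * (numA_r r y)\<^sup>2 + S * (numA_y r y)\<^sup>2"
    and "H \<equiv> \<Delta> r * (numB_r r y)\<^sup>2 + S * (numB_y r y)\<^sup>2"
    and "G' \<equiv> \<Delta> r * (numA_r r y * numB_r r y) + S * (numA_y r y * numB_y r y)"
    and "X \<equiv> (numA r y)\<^sup>2 - (numB r y)\<^sup>2" and "Y \<equiv> 2 * numA r y * numB r y"
    and "C \<equiv> r\<^sup>2 - y\<^sup>2" and "D \<equiv> 2 * r * y"
  shows "4 * (2 * Y * G' - X * (G - H))
      + 12/5 * (X * (G - H + 6 * (\<Delta> r - S) * (X * C + Y * D)) - Y * (2 * G' + 6 * (\<Delta> r - S) * (Y * C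
          - X * D)))
    = 528/5 * q\<^sup>2 * (r\<^sup>2 + y\<^sup>2) * chi_poly a m q r y"
  unfolding assms chi_poly_def numA_r_def numB_r_def numA_y_def numB_y_def numA_def numB_def
      kn_Delta_def by algebra

lemma chi_numerator:
  assumes "y \<in> U"
  shows "I6 g y - I5 g y + 12/5 * (I1 g y * I3 g y - I2 g y * I4 g y)
    = 2304 * 528 / 5 * q\<^sup>2 * chi_poly a m q (y $ 2) (a * cos (y $ 3)) / (P (y $ 2) (y $ 3))^14"
proof -
  define r yy p u where "r = y $ 2" and "yy = a * cos (y $ 3)" and "p = P r (y $ 3)" and "u = 1 / p"
  have S: "(a * sin (y $ 3))\<^sup>2 = a\<^sup>2 - yy\<^sup>2"
    by (simp add: yy_def power_mult_distrib sin_squared_eq algebra_simps)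
  have p: "p = r\<^sup>2 + yy\<^sup>2" and nz: "p \<noteq> 0"
    using nonzero(1)[OF assms] by (simp_all add: p_def r_def yy_def P_eq)
  have u: "w / p^n = w * u^n" for w n
    by (simp add: u_def power_one_over)
  have s: "\<sigma> * \<sigma> = 1" using sigma by auto
  have A: "A y = numA r yy * u^3" "B y = numB r yy * u^3"
    unfolding u[symmetric] by (simp_all add: psi_num r_def yy_def p_def)
  have grad: "gradAA y = (\<Delta> r * (numA_r r yy)\<^sup>2 + (a\<^sup>2 - yy\<^sup>2) * (numA_y r yy)\<^sup>2) * u^9"
    "gradBB y = (\<Delta> r * (numB_r r yy)\<^sup>2 + (a\<^sup>2 - yy\<^sup>2) * (numB_y r yy)\<^sup>2) * u^9"
    "gradAB y = (\<Delta> r * (numA_r r yy * numB_r r yy) + (a\<^sup>2 - yy\<^sup>2) * (numA_y r yy * numB_y r yy)) * u^9"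
    "\<kappa> y = 288 * (\<Delta> r - (a\<^sup>2 - yy\<^sup>2)) * u^3"
    unfolding gradAA_def gradBB_def gradAB_def \<kappa>_def S r_def[symmetric] yy_def[symmetric]
        p_def[symmetric] u by (rule refl)+
  \<comment> \<open>\<open>I2\<close> and \<open>I4\<close> both change sign with the orientation,
    so their product contains only \<open>\<sigma> * \<sigma>\<close>.\<close>
  have I: "I5 g y = 9216 * ((A y)\<^sup>2 * gradAA y - 2 * A y * B y * gradAB y + (B y)\<^sup>2 * gradBB y)"
    "I6 g y = 9216 * ((A y)\<^sup>2 * gradBB y + 2 * A y * B y * gradAB y + (B y)\<^sup>2 * gradAA y)"
    "I1 g y * I3 g y = 48 * ((A y)\<^sup>2 - (B y)\<^sup>2) * (48 * (gradAA y - gradBB y)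
        + \<kappa> y * (((A y)\<^sup>2 - (B y)\<^sup>2) * (r\<^sup>2 - yy\<^sup>2) + 2 * A y * B y * (2 * r * yy)))"
    "I2 g y * I4 g y = (\<sigma> * \<sigma>) * (48 * (2 * A y * B y) * (96 * gradAB y
        + \<kappa> y * (2 * A y * B y * (r\<^sup>2 - yy\<^sup>2) - ((A y)\<^sup>2 - (B y)\<^sup>2) * (2 * r * yy))))"
    unfolding I6_eq[OF assms] I5_eq[OF assms] I3_eq[OF assms] I4_eq[OF assms] I1_typeD[OF assms]
        I2_typeD[OF assms]
      r_def[symmetric] yy_def[symmetric] by simp_all
  \<comment> \<open>This is \<open>-9216\<close> times the real part of
    \<open>\<Psi>^2 (\<nabla>\<Psi>)^2\<close>, where \<open>(\<nabla>\<Psi>)^2\<close> has real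
    part \<open>gradAA - gradBB\<close> and imaginary part \<open>2 gradAB\<close>.\<close>
  have "I6 g y - I5 g y = 9216 * (2 * (2 * A y * B y) * gradAB y - ((A y)\<^sup>2 - (B y)\<^sup>2) * (gradAA y
      - gradBB y))"
    unfolding I by algebra
  then have "I6 g y - I5 g y + 12/5 * (I1 g y * I3 g y - I2 g y * I4 g y)
     = 2304 * (528/5 * q\<^sup>2 * (r\<^sup>2 + yy\<^sup>2) * chi_poly a m q r yy) * u^15"
    unfolding I(3,4) s mult_1 A grad chi_poly_identity[symmetric] by (simp only: numerator_scaling)
  also have "\<dots> = 2304 * 528 / 5 * q\<^sup>2 * chi_poly a m q r yy / p^14"
    unfolding u[symmetric] p[symmetric] using nz by (simp add: eval_nat_numeral)
  finally show ?thesis by (simp only: r_def yy_def p_def)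
qed

end

section \<open>The denominator and the final formula\<close>

lemma powr_5_2_48: "(48::real) powr (5/2) = 9216 * sqrt 3"
proof -
  have "(48::real) powr (5/2) = 48 powr 2 * 48 powr (1/2)"
    using powr_add[of "48::real" 2 "1/2"] by simp
  also have "\<dots> = 2304 * sqrt (16 * 3)"
    by (simp add: powr_half_sqrt)
  also have "sqrt (16 * 3) = 4 * sqrt (3::real)"
    using real_sqrt_mult[of 16 3] by simp
  finally show ?thesis by simp
qed

theorem theorem35:
  fixes a m q t r \<theta> \<phi> c :: real and g :: metric and x :: "real^4"
  assumes g: "g = kerr_newman a m q"
    and x: "x = vector [t, r, \<theta>, \<phi>]"
    and c: "c = cos \<theta>"
    and rho: "kn_rho2 a r \<theta> \<noteq> 0"
    and Delta: "kn_Delta a m q r \<noteq> 0"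
    and sin: "sin \<theta> \<noteq> 0"
    and nondeg: "(I1 g x)\<^sup>2 + (I2 g x)\<^sup>2 \<noteq> 0"
  shows "chi g x =
    44 * sqrt 3 * q^2
      / (5 * (c^2 * a^2 * m^2 + (r*m - q^2)^2) powr (5/2) * (r^2 + a^2 * c^2)^4)
    * ( a^12 * m^2 * (r*m - 19*q^2/66) * c^12
      - 2 * ( - (7*q^6/132)
              - 17*m*(m - 176*r/17)*q^4/132
              - 3*m^2*(a^2 - 25/9*r*m + 427/18*r^2)*q^2/11
              + m^3*r*(a^2 - r*m + 8*r^2) ) * a^10 * c^10
      + 30 * a^8 *
            ( - (q^8/396)
              + (- (1/165)*a^2 + 79/990*r*m - 17/180*r^2)*q^6
              + 9*(a^2 - 1079/324*r*m + 143/27*r^2)*m*r*q^4/55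
              - 9*m^2*r^2*(a^2 - 71/45*r*m + 307/108*r^2)*q^2/11
              + m^3*r^3*(a^2 - r*m + 19/10*r^2) ) * c^8
      - 84 * r^2 *
            ( - (q^8/36)
              + (- (2/33)*a^2 + 7/22*r*m - 41/396*r^2)*q^6
              + 6*m*(a^2 - 475/216*r*m + 11/9*r^2)*r*q^4/11
              - 15*m^2*(a^2 - 61/45*r*m + 89/90*r^2)*r^2*q^2/11
              + m^3*r^3*(a^2 - r*m + 6/7*r^2) ) * a^6 * c^6
      + 60 * r^4 *
            ( - (7*q^8/66)
              + (- (7/33)*a^2 + 392/495*r*m - 287/1980*r^2)*q^6
              + 63*(a^2 - 601/324*r*m + 121/189*r^2)*m*r*q^4/55
              - 21*m^2*(a^2 - 401/315*r*m + 307/504*r^2)*r^2*q^2/11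
              + m^3*r^3*(a^2 - r*m + 7/12*r^2) ) * a^4 * c^4
      - 10 *
            ( - (91*q^8/330)
              + (- (28/55)*a^2 + 263/165*r*m - 17/60*r^2)*q^6
              + 108*m*(a^2 - 2213/1296*r*m + 44/81*r^2)*r*q^4/55
              - 27*m^2*(a^2 - 167/135*r*m + 427/810*r^2)*r^2*q^2/11
              + m^3*r^3*(a^2 - r*m + 28/55*r^2) ) * r^6 * a^2 * c^2
      + 2/11 * (r*m - q^2)^2 * r^8 *
            ( - (7*q^4/12)
              + (- (a^2) + 5/3*r*m - 7/12*r^2)*q^2
              + m*r*(a^2 - r*m + 1/2*r^2) ) )"
proof -
  let ?g = "kerr_newman a m q"
  \<comment> \<open>The signs at the given point, which put it into \<open>U\<close>.\<close>
  define \<epsilon> \<sigma> where "\<epsilon> = sgn (kn_Delta a m q r)" and "\<sigma> = sgn (sin \<theta>)"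
  interpret kerr_newman_frame a m q \<epsilon> \<sigma>
    using Delta sin by unfold_locales (auto simp: \<epsilon>_def \<sigma>_def sgn_if)
  have x23: "x $ 2 = r" "x $ 3 = \<theta>" by (simp_all add: x)
  have "\<epsilon> * kn_Delta a m q r > 0" "\<sigma> * sin \<theta> > 0"
    using Delta sin by (auto simp: \<epsilon>_def \<sigma>_def sgn_if)
  then have xU: "x \<in> U" using rho by (simp add: U_def x23)
  define y p K where "y = a * c" and "p = kn_rho2 a r \<theta>" and "K = c^2 * a^2 * m^2 + (r*m - q^2)^2"
  have p: "p = r\<^sup>2 + y\<^sup>2" by (simp add: p_def y_def c kn_rho2_def power_mult_distrib)
  have p0: "p > 0" using pos(1)[OF xU] by (simp add: x23 p_def)
  have A: "A x = numA r y / p^3" "B x = numB r y / p^3"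
    by (simp_all add: psi_num x23 y_def c p_def)
  \<comment> \<open>The squared modulus of \<open>(q^2 - m z') z'^2\<close>: \<open>K\<close> is
    that of \<open>q^2 - m z'\<close>, and \<open>p^2\<close> is that of
    \<open>z'^2\<close>.\<close>
  have "(numA r y)\<^sup>2 + (numB r y)\<^sup>2 = K * p\<^sup>2"
    unfolding numA_def numB_def p K_def y_def by algebra
  moreover have "(A x)\<^sup>2 + (B x)\<^sup>2 = ((numA r y)\<^sup>2 + (numB r y)\<^sup>2) / p^6"
    unfolding A by (simp add: power_divide add_divide_distrib)
  ultimately have AB: "(A x)\<^sup>2 + (B x)\<^sup>2 = K / p^4"
    using p0 by (simp add: eval_nat_numeral)
  have "\<sigma> * \<sigma> = 1" using sigma by auto
  \<comment> \<open>The squared modulus of \<open>48 \<Psi>^2\<close>.\<close>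
  then have "(I1 ?g x)\<^sup>2 + (I2 ?g x)\<^sup>2 = (48 * ((A x)\<^sup>2 + (B x)\<^sup>2))\<^sup>2"
    unfolding I1_typeD[OF xU] I2_typeD[OF xU] by algebra
  then have norm: "(I1 ?g x)\<^sup>2 + (I2 ?g x)\<^sup>2 = (48 * (K / p^4))\<^sup>2"
    unfolding AB .
  have "K \<ge> 0" by (simp add: K_def)
  \<comment> \<open>Nondegeneracy of the invariants gives positivity of \<open>K\<close>, which the
    laws for \<open>powr\<close> with fractional exponents require.\<close>
  moreover have "K \<noteq> 0" using nondeg norm by (auto simp: assms(1))
  ultimately have K: "K > 0" by simp
  have "((I1 ?g x)\<^sup>2 + (I2 ?g x)\<^sup>2) powr (5/4) = ((48 * (K / p^4)) powr 2) powr (5/4)"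
    unfolding norm using K p0 by simp
  also have "\<dots> = (48 * (K / p^4)) powr (5/2)"
    by (simp add: powr_powr)
  also have "\<dots> = 48 powr (5/2) * (K powr (5/2) / (p^4) powr (5/2))"
    using K p0 by (simp add: powr_mult powr_divide)
  also have "(p^4) powr (5/2) = (p powr 4) powr (5/2)"
    using p0 by simp
  also have "\<dots> = p powr 10"
    by (simp add: powr_powr)
  also have "\<dots> = p^10"
    using p0 by simp
  finally have den: "((I1 ?g x)\<^sup>2 + (I2 ?g x)\<^sup>2) powr (5/4) = 9216 * sqrt 3 * (K powr (5/2) / p^10)"
    unfolding powr_5_2_48 .
  have "chi ?g x = (2304 * 528 / 5 * q\<^sup>2 * chi_poly a m q r y / p^14) / (9216 * sqrt 3 * (K powr (5/2) /
      p^10))"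
    unfolding chi_def den chi_numerator[OF xU] by (simp add: x23 y_def c p_def)
  \<comment> \<open>The numerator carries \<open>1/p^14\<close> and the denominator
    \<open>1/p^10\<close>, which leaves \<open>1/p^4\<close>; the constant is
    \<open>2304 * 528 / 9216 = 132\<close>.\<close>
  also have "\<dots> = (132 / sqrt 3) * q\<^sup>2 / (5 * K powr (5/2) * p^4) * chi_poly a m q r y"
    using p0 K by (simp add: field_simps eval_nat_numeral)
  also have "132 / sqrt 3 = 44 * sqrt (3::real)"
    by (simp add: field_simps)
  also have "p = r\<^sup>2 + a\<^sup>2 * c\<^sup>2" by (simp add: p y_def power_mult_distrib)
  finally have chi: "chi ?g x = 44 * sqrt 3 * q\<^sup>2 / (5 * K powr (5/2) * (r\<^sup>2 + a\<^sup>2 * c\<^sup>2)^4) * chi_poly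
      a m q r y" .
  show ?thesis
    unfolding assms(1) chi K_def
    by (rule arg_cong[where f = "\<lambda>u. _ * u"]) (simp only: chi_poly_def y_def power_mult_distrib mult_ac)
qed

end
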